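(* Let $n\ge 1$ and let $\gamma\in\mathcal{D}_n$ be a Dyck path. Then \[ X_{\gamma}(\mathbf{x};q)=\sum_{\mu\vdash n} q^{\operatorname{area}(\gamma)-n(\mu)}\, r_{\gamma,\mu}(q)\,\Big(\prod_{i\ge 1}[m_i(\mu)]_q!\Big)\, P_{\mu}(\mathbf{x};q). \]
   Context: $q$-notation: $[m]_q=1+q+\dots+q^{m-1}$, $[m]_q!=[1]_q\cdots[m]_q$. For a partition $\mu$, $m_i(\mu)$ is the number of parts equal to $i$, $\ell(\mu)$ the number of parts, and $n(\mu)=\sum_{i\ge1}(i-1)\mu_i$. Dyck paths: $\mathcal{D}_n$ is the set of lattice paths from $(0,0)$ to $(n,n)$ with unit north and east steps never going below $y=x$. For $i\in[n]$ the column height $\gamma(i)$ is the $y$-coordinate of the east step of $\gamma$ from $x=i-1$ to $x=i$ (so $\gamma(1)\le\dots\le\gamma(n)$ and $i\le\gamma(i)\le n$). $\operatorname{area}(\gamma)=\sum_{i=1}^n(\gamma(i)-i)$. The cell $(i,j)$ is the unit square in column $i$ and row $j$; a cell $(i,j)$ with $1\le i<j\le n$ lies above $\gamma$ if $j>\gamma(i)$. Chromatic quasisymmetric function: let $G_\gamma$ be the graph on $[n]$ with edges $\{i,j\}$ for $1\le i<j\le\gamma(i)$. Then $X_\gamma(\mathbf{x};q)=\sum_\kappa q^{\operatorname{asc}(\kappa)}\prod_{v=1}^n x_{\kappa(v)}$, summed over proper colorings $\kappa:[n]\to\mathbb{Z}_{>0}$ of $G_\gamma$, where $\operatorname{asc}(\kappa)$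 is the number of edges $\{i,j\}$ with $i<j$ and $\kappa(i)<\kappa(j)$. Hall–Littlewood polynomials: for a partition $\mu$ with at most $N$ parts, written $(\mu_1,\dots,\mu_N)$ padded with zeros, $P_\mu(x_1,\dots,x_N;q)=\frac{1}{\prod_{i\ge0}[m_i(\mu)]_q!}\sum_{w\in S_N} w\Big(x_1^{\mu_1}\cdots x_N^{\mu_N}\prod_{1\le i<j\le N}\frac{x_i-qx_j}{x_i-x_j}\Big)$, where $m_0(\mu)$ is the number of zero entries among $\mu_1,\dots,\mu_N$ and $w$ acts by $x_i\mapsto x_{w(i)}$. These are stable under setting the last variable to $0$; $P_\mu(\mathbf{x};q)$ is the resulting symmetric function in infinitely many variables. Linked rook placements: a linked rook of $\gamma$ is a sequence $((a_1,b_1),\dots,(a_\ell,b_\ell))$, $\ell\ge1$, of cells above $\gamma$ (called rooks) with $1\le a_t<b_t\le n$ and $b_t=a_{t+1}$ for $t\in[\ell-1]$. A cell $(i,j)$ attacks a cell $(i',j')$ if $i'\in\{i,j\}$ or $j'\in\{i,j\}$. A linked rook placement on $\gamma$ is a finite set $\{L_1,\dots,L_k\}$ of linked rooks of $\gamma$ such that any rook of $L_s$ and any rook of $L_t$, $s\ne t$, do not attack each other (the empty placement is allowed). Extended placement, ranks and type: given a linked rook placement $P$, each of its linked rooks, written $((c_1,c_2),(c_2,c_3),\dots,(c_{\ell-1},c_\ell))$ with $c_1<\dots<c_\ell$, gives the extended linked rook $(u_1,\dots,u_{2\ell})=((c_1,c_1),(c_1,c_2),(c_2,c_2),(c_2,c_3),\dots,(c_\ell,c_\ell),(c_\ell,n+1))$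 of length $\ell$ (row $n+1$ is an extra "extended row"); each $i\in[n]$ which is neither a row nor a column index of a rook of $P$ gives the extended linked rook $((i,i),(i,n+1))$ of length $1$. The set of all these is $\operatorname{ext}(P)$; each diagonal cell $(i,i)$, $i\in[n]$, lies in exactly one of them. The cells $u_s$ are extended rooks, and $u_s$ has rank $\lfloor s/2\rfloor$. The type of $P$ is the partition of $n$ obtained by sorting the lengths of the members of $\operatorname{ext}(P)$ in weakly decreasing order; $\mathrm{LRP}(\gamma,\mu)$ denotes the set of linked rook placements on $\gamma$ of type $\mu$. Free cells: for a linked rook placement $P$ and a cell $(i,j)$ above $\gamma$, let $(i,j')$ be the topmost extended rook of $\operatorname{ext}(P)$ in column $i$, with rank $a$, and $(i',j)$ the leftmost extended rook of $\operatorname{ext}(P)$ in row $j$, with rank $b$. The cell $(i,j)$ is free if ($i<i'$ and $b\le a$) or ($i'<i$ and $b<a$). $\mathrm{fc}_\gamma(P)$ is the number of free cells of $P$, and $r_{\gamma,\mu}(q)=\sum_{P\in\mathrm{LRP}(\gamma,\mu)}q^{\mathrm{fc}_\gamma(P)}$.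
   Formalization: A free cell (i,j) is also required to satisfy j<j', i.e. to lie strictly below the topmost extended rook (i,j') of its column; without this the identity fails, e.g. for n=3 and column heights (1,3,3), where r_{(2,1)} would be 2q instead of 1+q. *)

theory Defs
  imports
    "HOL-Computational_Algebra.Polynomial"
    "HOL-Computational_Algebra.Fraction_Field"
    "HOL-Combinatorics.Permutations"
    "HOL-Library.Multiset"
    "HOL-Library.FuncSet"
    "HOL-Library.Poly_Mapping"
begin

section \<open>Coefficients, polynomials and formal series\<close>

text \<open>
  The coefficient field is the field of rational functions in an indeterminate \<open>q\<close> over the
  rationals.  A monomial in the variables \<open>x\<^sub>i\<close> is its finitely supported exponent vector.  Series in
  infinitely many variables (in particular symmetric and quasisymmetric functions) are given by
  their coefficients.  The variables are indexed by the positive integers; the index \<open>0\<close> does not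
  occur in any of the polynomials and series below.
\<close>

type_synonym qfield = "rat poly fract"
type_synonym monomial = "nat \<Rightarrow>\<^sub>0 nat"
type_synonym mpolynomial = "monomial \<Rightarrow>\<^sub>0 qfield"
type_synonym series = "monomial \<Rightarrow> qfield"

definition q :: qfield where
  "q = Fract [:0, 1:] 1"

definition q_int :: "nat \<Rightarrow> qfield" where
  "q_int m = (\<Sum>k<m. q ^ k)"

definition q_fact :: "nat \<Rightarrow> qfield" where
  "q_fact m = (\<Prod>k=1..m. q_int k)"


section \<open>Partitions\<close>

definition partitions :: "nat \<Rightarrow> nat list set" where
  "partitions n = {\<mu>. sorted_wrt (\<ge>) \<mu> \<and> 0 \<notin> set \<mu> \<and> sum_list \<mu> = n}"

text \<open>Lists are indexed from \<open>0\<close>, so the weight \<open>i - 1\<close> of the \<open>i\<close>-th part becomes \<open>i\<close>.\<close>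

definition n_stat :: "nat list \<Rightarrow> nat" where
  "n_stat \<mu> = (\<Sum>i<length \<mu>. i * \<mu> ! i)"

text \<open>
  The product of \<open>[m\<^sub>i]\<^sub>q!\<close> over all values \<open>i\<close> that occur in the list; for all other \<open>i\<close> the
  factor is \<open>[0]\<^sub>q! = 1\<close>.
\<close>

definition mult_q_fact :: "nat list \<Rightarrow> qfield" where
  "mult_q_fact xs = (\<Prod>i\<in>set xs. q_fact (count_list xs i))"


section \<open>Dyck paths\<close>

datatype step = North | East

definition dyck_paths :: "nat \<Rightarrow> step list set" where
  "dyck_paths n = {\<gamma>. count_list \<gamma> North = n \<and> count_list \<gamma> East = n \<and>
     (\<forall>k\<le>length \<gamma>. count_list (take k \<gamma>) East \<le> count_list (take k \<gamma>) North)}"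

text \<open>The \<open>y\<close>-coordinates of the east steps of a path that starts at height \<open>y\<close>.\<close>

fun east_heights :: "nat \<Rightarrow> step list \<Rightarrow> nat list" where
  "east_heights y [] = []"
| "east_heights y (North # \<gamma>) = east_heights (Suc y) \<gamma>"
| "east_heights y (East # \<gamma>) = y # east_heights y \<gamma>"

definition col_height :: "step list \<Rightarrow> nat \<Rightarrow> nat" where
  "col_height \<gamma> i = east_heights 0 \<gamma> ! (i - 1)"

definition area :: "nat \<Rightarrow> step list \<Rightarrow> int" where
  "area n \<gamma> = (\<Sum>i=1..n. int (col_height \<gamma> i) - int i)"

definition cells_above :: "nat \<Rightarrow> step list \<Rightarrow> (nat \<times> nat) set" where
  "cells_above n \<gamma> = {(i, j). 1 \<le> i \<and> i < j \<and> j \<le> n \<and> col_height \<gamma> i < j}"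


section \<open>Chromatic quasisymmetric functions\<close>

text \<open>The edge \<open>{i, j}\<close> with \<open>i < j\<close> is represented by the pair \<open>(i, j)\<close>.\<close>

definition graph_edges :: "nat \<Rightarrow> step list \<Rightarrow> (nat \<times> nat) set" where
  "graph_edges n \<gamma> = {(i, j). 1 \<le> i \<and> i < j \<and> j \<le> n \<and> j \<le> col_height \<gamma> i}"

definition proper_colorings :: "nat \<Rightarrow> step list \<Rightarrow> (nat \<Rightarrow> nat) set" where
  "proper_colorings n \<gamma> =
     {\<kappa> \<in> {1..n} \<rightarrow>\<^sub>E {1..}. \<forall>(i, j) \<in> graph_edges n \<gamma>. \<kappa> i \<noteq> \<kappa> j}"

definition ascents :: "nat \<Rightarrow> step list \<Rightarrow> (nat \<Rightarrow> nat) \<Rightarrow> nat" where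
  "ascents n \<gamma> \<kappa> = card {(i, j) \<in> graph_edges n \<gamma>. \<kappa> i < \<kappa> j}"

definition coloring_monomial :: "nat \<Rightarrow> (nat \<Rightarrow> nat) \<Rightarrow> monomial" where
  "coloring_monomial n \<kappa> = (\<Sum>v=1..n. Poly_Mapping.single (\<kappa> v) 1)"

text \<open>Only finitely many colorings contribute to each coefficient.\<close>

definition chromatic_qsym :: "nat \<Rightarrow> step list \<Rightarrow> series" where
  "chromatic_qsym n \<gamma> = (\<lambda>\<alpha>.
     \<Sum>\<kappa> | \<kappa> \<in> proper_colorings n \<gamma> \<and> coloring_monomial n \<kappa> = \<alpha>. q ^ ascents n \<gamma> \<kappa>)"


section \<open>Hall--Littlewood polynomials\<close>

text \<open>Constants and variables in the field of rational functions in the \<open>x\<^sub>i\<close>.\<close>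

definition rf_const :: "qfield \<Rightarrow> mpolynomial fract" where
  "rf_const c = Fract (Poly_Mapping.single 0 c) 1"

definition rf_var :: "nat \<Rightarrow> mpolynomial fract" where
  "rf_var i = Fract (Poly_Mapping.single (Poly_Mapping.single i 1) 1) 1"

definition pad :: "nat \<Rightarrow> nat list \<Rightarrow> nat list" where
  "pad N \<mu> = \<mu> @ replicate (N - length \<mu>) 0"

text \<open>
  The defining formula, an identity of rational functions in \<open>x\<^sub>1, \<dots>, x\<^sub>N\<close>, with the action
  \<open>x\<^sub>i \<mapsto> x\<^bsub>w i\<^esub>\<close> of \<open>w\<close> carried out.
\<close>

definition hall_littlewood_rf :: "nat \<Rightarrow> nat list \<Rightarrow> mpolynomial fract" where
  "hall_littlewood_rf N \<mu> =
     rf_const (1 / mult_q_fact (pad N \<mu>)) *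
     (\<Sum>w | w permutes {1..N}.
        (\<Prod>i=1..N. rf_var (w i) ^ (pad N \<mu> ! (i - 1))) *
        (\<Prod>(i, j) \<in> {(i, j). 1 \<le> i \<and> i < j \<and> j \<le> N}.
           (rf_var (w i) - rf_const q * rf_var (w j)) / (rf_var (w i) - rf_var (w j))))"

text \<open>This rational function is a polynomial.\<close>

definition hall_littlewood_poly :: "nat \<Rightarrow> nat list \<Rightarrow> mpolynomial" where
  "hall_littlewood_poly N \<mu> = (THE p. Fract p 1 = hall_littlewood_rf N \<mu>)"

text \<open>
  The symmetric function in infinitely many variables: the coefficient of a monomial is read off
  from \<open>P\<^sub>\<mu>(x\<^sub>1, \<dots>, x\<^sub>N)\<close> for an \<open>N\<close> not smaller than the number of parts of \<open>\<mu>\<close> and the index of each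
  variable in the monomial.  By stability, all such \<open>N\<close> give the same coefficient; the least one
  is taken.
\<close>

definition hall_littlewood :: "nat list \<Rightarrow> series" where
  "hall_littlewood \<mu> = (\<lambda>\<alpha>. Poly_Mapping.lookup
     (hall_littlewood_poly (Max (insert (length \<mu>) (Poly_Mapping.keys \<alpha>))) \<mu>) \<alpha>)"


section \<open>Linked rook placements\<close>

text \<open>The cell \<open>(i, j)\<close> is the one in column \<open>i\<close> and row \<open>j\<close>.\<close>

definition linked_rook :: "nat \<Rightarrow> step list \<Rightarrow> (nat \<times> nat) list \<Rightarrow> bool" where
  "linked_rook n \<gamma> L \<longleftrightarrow> L \<noteq> [] \<and> set L \<subseteq> cells_above n \<gamma> \<and>
     (\<forall>t. Suc t < length L \<longrightarrow> snd (L ! t) = fst (L ! Suc t))"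

definition attacks :: "nat \<times> nat \<Rightarrow> nat \<times> nat \<Rightarrow> bool" where
  "attacks u v \<longleftrightarrow> fst v \<in> {fst u, snd u} \<or> snd v \<in> {fst u, snd u}"

definition linked_rook_placements :: "nat \<Rightarrow> step list \<Rightarrow> (nat \<times> nat) list set set" where
  "linked_rook_placements n \<gamma> =
     {P. finite P \<and> (\<forall>L\<in>P. linked_rook n \<gamma> L) \<and>
         (\<forall>L\<in>P. \<forall>L'\<in>P. L \<noteq> L' \<longrightarrow> (\<forall>u\<in>set L. \<forall>v\<in>set L'. \<not> attacks u v))}"

text \<open>
  The nodes \<open>c\<^sub>1 < \<dots> < c\<^sub>l\<close> of a linked rook \<open>((c\<^sub>1, c\<^sub>2), \<dots>, (c\<^bsub>l-1\<^esub>, c\<^sub>l))\<close>, and the extended linked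
  rook \<open>((c\<^sub>1, c\<^sub>1), (c\<^sub>1, c\<^sub>2), (c\<^sub>2, c\<^sub>2), \<dots>, (c\<^sub>l, c\<^sub>l), (c\<^sub>l, n+1))\<close> with given nodes.  The latter is a list of
  \<open>2l\<close> cells, and its length as an extended linked rook is \<open>l\<close>.
\<close>

definition nodes :: "(nat \<times> nat) list \<Rightarrow> nat list" where
  "nodes L = fst (hd L) # map snd L"

fun extended_rook :: "nat \<Rightarrow> nat list \<Rightarrow> (nat \<times> nat) list" where
  "extended_rook n [] = []"
| "extended_rook n [c] = [(c, c), (c, n + 1)]"
| "extended_rook n (c # d # cs) = (c, c) # (c, d) # extended_rook n (d # cs)"

definition ext :: "nat \<Rightarrow> (nat \<times> nat) list set \<Rightarrow> (nat \<times> nat) list set" where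
  "ext n P = (\<lambda>L. extended_rook n (nodes L)) ` P \<union>
     {extended_rook n [i] | i. i \<in> {1..n} \<and> (\<forall>L\<in>P. \<forall>(a, b)\<in>set L. i \<noteq> a \<and> i \<noteq> b)}"

definition ext_cells :: "nat \<Rightarrow> (nat \<times> nat) list set \<Rightarrow> (nat \<times> nat) set" where
  "ext_cells n P = (\<Union>U\<in>ext n P. set U)"

text \<open>
  The cell \<open>u\<^sub>s\<close> has rank \<open>\<lfloor>s / 2\<rfloor>\<close>, where \<open>s\<close> counts from \<open>1\<close>.  An extended rook of a placement
  occurs in only one member of \<open>ext n P\<close>, and only once there.
\<close>

definition ext_rank :: "nat \<Rightarrow> (nat \<times> nat) list set \<Rightarrow> nat \<times> nat \<Rightarrow> nat" where
  "ext_rank n P u =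
     (THE r. \<exists>U\<in>ext n P. \<exists>s\<in>{1..length U}. U ! (s - 1) = u \<and> r = s div 2)"

definition placement_type :: "nat \<Rightarrow> (nat \<times> nat) list set \<Rightarrow> nat list" where
  "placement_type n P =
     rev (sorted_list_of_multiset (image_mset (\<lambda>U. length U div 2) (mset_set (ext n P))))"

definition LRP :: "nat \<Rightarrow> step list \<Rightarrow> nat list \<Rightarrow> (nat \<times> nat) list set set" where
  "LRP n \<gamma> \<mu> = {P \<in> linked_rook_placements n \<gamma>. placement_type n P = \<mu>}"

definition top_row :: "nat \<Rightarrow> (nat \<times> nat) list set \<Rightarrow> nat \<Rightarrow> nat" where
  "top_row n P i = Max {j'. (i, j') \<in> ext_cells n P}"

definition left_col :: "nat \<Rightarrow> (nat \<times> nat) list set \<Rightarrow> nat \<Rightarrow> nat" where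
  "left_col n P j = Min {i'. (i', j) \<in> ext_cells n P}"

text \<open>
  Besides the comparison of ranks, a free cell \<open>(i, j)\<close> has to lie below the topmost extended rook
  \<open>(i, j')\<close> of its column.  The condition \<open>j < j'\<close> cannot be dropped from the expansion: for \<open>n = 3\<close>
  and column heights \<open>1, 3, 3\<close> the coefficient of \<open>x\<^sub>1\<^sup>2 x\<^sub>2\<close> in the chromatic quasisymmetric function
  is \<open>1 + q\<close>.  On the Hall--Littlewood side only \<open>\<mu> = (2, 1)\<close> contributes to it, through the
  placements \<open>{((1, 2))}\<close> and \<open>{((1, 3))}\<close>.  With \<open>j < j'\<close> they have \<open>0\<close> and \<open>1\<close> free cells; by
  the comparison of ranks alone both would have one, giving \<open>2q\<close>.
\<close>

definition free_cells :: "nat \<Rightarrow> step list \<Rightarrow> (nat \<times> nat) list set \<Rightarrow> (nat \<times> nat) set" where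
  "free_cells n \<gamma> P = {(i, j) \<in> cells_above n \<gamma>.
     let j' = top_row n P i;
         i' = left_col n P j;
         a = ext_rank n P (i, j');
         b = ext_rank n P (i', j)
     in j < j' \<and> (i < i' \<and> b \<le> a \<or> i' < i \<and> b < a)}"

definition r_poly :: "nat \<Rightarrow> step list \<Rightarrow> nat list \<Rightarrow> qfield" where
  "r_poly n \<gamma> \<mu> = (\<Sum>P\<in>LRP n \<gamma> \<mu>. q ^ card (free_cells n \<gamma> P))"

end

theory Submission
  imports Defs "HOL-Computational_Algebra.Polynomial_Factorial"
begin

text \<open>
  Build the graph along the path: a north step creates a vertex adjacent to all open vertices, an
  east step closes the oldest open vertex.  The generating function of the colorings with prescribed
  colours of the open vertices is then a word in two operators \<open>dplus\<close> and \<open>dminus\<close>, and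
  \<open>dplus dminus = dminus dplus + Phi\<close>, where \<open>Phi\<close> links the new vertex to the oldest open one.
  Moving all \<open>dminus\<close> to the left expresses \<open>X\<^sub>\<gamma>\<close> as a sum over the ways of linking vertices, that
  is, over linked rook placements; sorting the links by a Hecke action on the positions of the open
  vertices produces the powers of \<open>q\<close> that count free cells.  A placement of type \<open>\<mu>\<close> with \<open>l\<close> parts
  contributes \<open>dminus\<^sup>l\<close> of a function that satisfies the Demazure--Lusztig relations in the variables
  and that is, up to a power of \<open>q\<close>, the monomial \<open>x\<^sup>\<mu>\<close> at the tuple \<open>(1, \<dots>, l)\<close>.  The sum of its values
  over all tuples is therefore the Hecke symmetrization of \<open>x\<^sup>\<mu>\<close>, which is a Hall--Littlewood polynomial.
\<close>


section \<open>Operators on functions of colour tuples\<close>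

text \<open>\<open>Phi\<close> reaches only the oldest open vertex, whereas a new vertex must be
  able to prolong every chain whose end is closed. A closed end survives only as a position that
  \<open>dminus\<close> sums over, so \<open>Phi\<close> has to be carried past further
  \<open>dminus\<close>, at the cost of a Hecke generator for each position passed. Two facts turn
  the generators into powers of \<open>t\<close>: chain lengths decide how they act
  (\<open>word_fn_swap\<close>), and on two positions that are both summed over a generator is
  multiplication by \<open>t\<close> (\<open>dminus_dminus_hecke\<close>). No inverse of a generator
  arises if the lengths of the closed ends decrease weakly. Independence of the order allows this to
  be assumed; equal lengths then add up to t-integers, which are spread over the positions again in
  the way free cells count them. Up to conventions, \<open>dplus\<close>, \<open>dminus\<close> and
  \<open>Phi\<close> satisfy relations of the Dyck path algebra of Carlsson and Mellit. That Hecke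
  action moves positions; the Demazure--Lusztig relations concern the colours instead, and through
  them the values at (1, ..., k) determine all others.\<close>

definition swap_adj :: "nat \<Rightarrow> 'a list \<Rightarrow> 'a list" where
  "swap_adj i c = c[i := c ! Suc i, Suc i := c ! i]"

lemma length_swap_adj [simp]: "length (swap_adj i c) = length c"
  by (simp add: swap_adj_def)

lemma mset_swap_adj [simp]: "Suc i < length c \<Longrightarrow> mset (swap_adj i c) = mset c"
  by (simp add: swap_adj_def mset_swap)

lemma set_swap_adj [simp]: "Suc i < length c \<Longrightarrow> set (swap_adj i c) = set c"
  by (metis mset_swap_adj set_mset_mset)

lemma distinct_swap_adj [simp]: "Suc i < length c \<Longrightarrow> distinct (swap_adj i c) = distinct c"
  by (simp add: swap_adj_def)

lemma swap_adj_append: "swap_adj (length a) (a @ u # v # b) = a @ v # u # b"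
  by (simp add: swap_adj_def nth_append list_update_append)

lemma swap_adj_append1: "Suc i < length a \<Longrightarrow> swap_adj i (a @ b) = swap_adj i a @ b"
  by (simp add: swap_adj_def nth_append list_update_append)

lemma swap_adj_Cons: "swap_adj (Suc i) (y # c) = y # swap_adj i c"
  by (simp add: swap_adj_def)

lemma swap_adj_0: "swap_adj 0 (u # v # c) = v # u # c"
  by (simp add: swap_adj_def)

text \<open>A Hecke generator mixes a tuple with the one in which two entries are exchanged, so an
  identity in which both entries are summed over becomes a termwise one only after (u, v) and (v, u)
  are combined.\<close>

lemma sum_distinct_pairs:
  fixes H :: "nat \<Rightarrow> nat \<Rightarrow> 'a::comm_monoid_add"
  assumes "finite S"
  shows "(\<Sum>u\<in>S. \<Sum>v\<in>S-{u}. H u v) = (\<Sum>u\<in>S. \<Sum>v\<in>{v\<in>S. u < v}. H u v + H v u)"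
proof -
  have e: "S - {u} = {v\<in>S. u < v} \<union> {v\<in>S. v < u}" for u by auto
  have "(\<Sum>u\<in>S. \<Sum>v\<in>S-{u}. H u v) = (\<Sum>u\<in>S. (\<Sum>v\<in>{v\<in>S. u < v}. H u v) + (\<Sum>v\<in>{v\<in>S. v < u}. H u v))"
    unfolding e using assms by (intro sum.cong refl sum.union_disjoint) auto
  also have "\<dots> = (\<Sum>u\<in>S. \<Sum>v\<in>{v\<in>S. u < v}. H u v) + (\<Sum>u\<in>S. \<Sum>v\<in>{v\<in>S. v < u}. H u v)"
    by (rule sum.distrib)
  also have "(\<Sum>u\<in>S. \<Sum>v\<in>{v\<in>S. v < u}. H u v) = (\<Sum>v\<in>S. \<Sum>u\<in>{u\<in>S. v < u}. H u v)"
    using assms by (rule sum.swap_restrict) (use assms in auto)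
  finally show ?thesis by (simp add: sum.distrib)
qed

text \<open>Restricting the colours to 1, ..., N keeps all sums finite. The field and
  \<open>t\<close> stay abstract until they become the rational functions in the variables and the
  constant \<open>q\<close>.\<close>

locale colour_tuples =
  fixes N :: nat and t :: "'a::field"
  assumes t_nonzero: "t \<noteq> 0"
begin

text \<open>A tuple lists the colours of the open vertices, the newest vertex first.\<close>

definition tuples :: "nat \<Rightarrow> nat list set" where
  "tuples k = {c. length c = k \<and> distinct c \<and> set c \<subseteq> {1..N}}"

definition asc_wt :: "nat \<Rightarrow> nat \<Rightarrow> 'a" where
  "asc_wt b y = (if b < y then t else 1)"

definition new_wt :: "(nat \<Rightarrow> 'a) \<Rightarrow> nat \<Rightarrow> nat list \<Rightarrow> 'a" where
  "new_wt x y r = x y * (\<Prod>b\<in>set r. asc_wt b y)"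

text \<open>One minus the weight of an edge between an older vertex of colour b and a new one of
  colour y, where a monochromatic edge has weight 0.\<close>

definition link :: "nat \<Rightarrow> nat \<Rightarrow> 'a" where
  "link b y = (if b = y then 1 else if b < y then 1 - t else 0)"

definition dplus :: "(nat \<Rightarrow> 'a) \<Rightarrow> (nat list \<Rightarrow> 'a) \<Rightarrow> nat list \<Rightarrow> 'a" where
  "dplus x F c = (case c of [] \<Rightarrow> 0 | y # r \<Rightarrow> new_wt x y r * F r)"

definition dminus :: "(nat list \<Rightarrow> 'a) \<Rightarrow> nat list \<Rightarrow> 'a" where
  "dminus F r = (\<Sum>b\<in>{1..N} - set r. F (r @ [b]))"

text \<open>
  The difference between creating a vertex that is not adjacent to the oldest open vertex and one
  that is, cf. lemma \<open>dplus_dminus\<close>.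
\<close>

definition Phi :: "(nat \<Rightarrow> 'a) \<Rightarrow> (nat list \<Rightarrow> 'a) \<Rightarrow> nat list \<Rightarrow> 'a" where
  "Phi x F c = (case c of [] \<Rightarrow> 0
     | y # r \<Rightarrow> new_wt x y r * (\<Sum>b\<in>{1..N} - set r. link b y * F (r @ [b])))"

text \<open>A Hecke generator T acting on positions, normalized by (T - t)(T + 1) = 0. The entries
  of a tuple are distinct, so the second branch is the case of a descent.\<close>

definition hecke :: "nat \<Rightarrow> (nat list \<Rightarrow> 'a) \<Rightarrow> nat list \<Rightarrow> 'a" where
  "hecke i F c = (if c ! i < c ! Suc i then F (swap_adj i c)
     else (t - 1) * F c + t * F (swap_adj i c))"

lemma dplus_Cons: "dplus x F (y # r) = new_wt x y r * F r"
  by (simp add: dplus_def)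

lemma Phi_Cons: "Phi x F (y # r) = new_wt x y r * (\<Sum>b\<in>{1..N} - set r. link b y * F (r @ [b]))"
  by (simp add: Phi_def)

lemma tuples_snoc: "r @ [b] \<in> tuples (Suc k) \<longleftrightarrow> r \<in> tuples k \<and> b \<in> {1..N} - set r"
  by (auto simp: tuples_def)

lemma tuples_SucE:
  assumes "c \<in> tuples (Suc k)"
  obtains y r where "c = y # r" "r \<in> tuples k" "y \<in> {1..N} - set r"
  using assms by (cases c) (auto simp: tuples_def)

lemma swap_adj_tuples: "c \<in> tuples k \<Longrightarrow> Suc i < k \<Longrightarrow> swap_adj i c \<in> tuples k"
  by (auto simp: tuples_def)

text \<open>The functions are total on lists, but the operator identities concern distinct colours
  in the range 1, ..., N, so equality is taken on tuples of a fixed length.\<close>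

definition eqv :: "nat \<Rightarrow> (nat list \<Rightarrow> 'a) \<Rightarrow> (nat list \<Rightarrow> 'a) \<Rightarrow> bool" where
  "eqv k F G \<longleftrightarrow> (\<forall>c\<in>tuples k. F c = G c)"

lemma eqvI: "(\<And>c. c \<in> tuples k \<Longrightarrow> F c = G c) \<Longrightarrow> eqv k F G"
  by (simp add: eqv_def)

lemma eqvD: "eqv k F G \<Longrightarrow> c \<in> tuples k \<Longrightarrow> F c = G c"
  by (simp add: eqv_def)

lemma eqv_refl: "eqv k F F" by (simp add: eqv_def)
lemma eqv_sym: "eqv k F G \<Longrightarrow> eqv k G F" by (simp add: eqv_def)
lemma eqv_trans [trans]: "eqv k F G \<Longrightarrow> eqv k G H \<Longrightarrow> eqv k F H" by (simp add: eqv_def)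

lemma eqv_dplus: "eqv k F G \<Longrightarrow> eqv (Suc k) (dplus x F) (dplus x G)"
  by (rule eqvI, erule tuples_SucE) (simp add: dplus_Cons eqvD)

lemma eqv_dminus: "eqv (Suc k) F G \<Longrightarrow> eqv k (dminus F) (dminus G)"
  by (auto simp: eqv_def dminus_def tuples_snoc intro!: sum.cong)

lemma eqv_dminus_pow: "eqv (k + l) F G \<Longrightarrow> eqv k ((dminus ^^ l) F) ((dminus ^^ l) G)"
proof (induction l arbitrary: k)
  case (Suc l)
  from Suc.IH[of "Suc k"] Suc.prems have "eqv (Suc k) ((dminus ^^ l) F) ((dminus ^^ l) G)"
    by simp
  then show ?case by (simp add: eqv_dminus)
qed simp

lemma eqv_Phi: "eqv (Suc k) F G \<Longrightarrow> eqv (Suc k) (Phi x F) (Phi x G)"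
  by (rule eqvI, erule tuples_SucE)
     (auto simp: Phi_Cons eqv_def tuples_snoc intro!: sum.cong)

lemma dminus_scale: "dminus (\<lambda>c. a * F c) = (\<lambda>c. a * dminus F c)"
  by (auto simp: dminus_def fun_eq_iff sum_distrib_left)

lemma dminus_add: "dminus (\<lambda>c. F c + G c) = (\<lambda>c. dminus F c + dminus G c)"
  by (auto simp: dminus_def fun_eq_iff sum.distrib)

lemma dminus_sum: "dminus (\<lambda>c. \<Sum>i\<in>I. F i c) = (\<lambda>c. \<Sum>i\<in>I. dminus (F i) c)"
  by (auto simp: dminus_def fun_eq_iff intro: sum.swap)

lemma dminus_pow_scale: "(dminus ^^ l) (\<lambda>c. a * F c) = (\<lambda>c. a * (dminus ^^ l) F c)"
  by (induction l) (auto simp: dminus_scale)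

lemma dplus_scale: "dplus x (\<lambda>c. a * F c) = (\<lambda>c. a * dplus x F c)"
  by (auto simp: dplus_def fun_eq_iff split: list.splits)

lemma dplus_sum: "dplus x (\<lambda>c. \<Sum>i\<in>I. F i c) = (\<lambda>c. \<Sum>i\<in>I. dplus x (F i) c)"
  by (auto simp: dplus_def fun_eq_iff sum_distrib_left split: list.splits)

lemma Phi_scale: "Phi x (\<lambda>c. a * F c) = (\<lambda>c. a * Phi x F c)"
  by (auto simp: Phi_def fun_eq_iff sum_distrib_left algebra_simps split: list.splits intro!: sum.cong)

lemma new_wt_snoc: "b \<notin> set r \<Longrightarrow> new_wt x y (r @ [b]) = asc_wt b y * new_wt x y r"
  by (simp add: new_wt_def algebra_simps)

lemma new_wt_Cons: "b \<notin> set r \<Longrightarrow> new_wt x y (b # r) = asc_wt b y * new_wt x y r"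
  by (simp add: new_wt_def algebra_simps)

lemma new_wt_cong: "set r = set r' \<Longrightarrow> new_wt x y r = new_wt x y r'"
  by (simp add: new_wt_def)

text \<open>In \<open>dplus x (dminus F)\<close> the removed colour b may equal the new colour y, as
  the two vertices are not adjacent; in \<open>dminus (dplus x F)\<close> it may not, and the edge
  contributes \<open>asc_wt b y\<close>. The identity is 1 = \<open>asc_wt b y\<close> +
  \<open>link b y\<close> for b different from y, and \<open>link y y\<close> = 1 for the remaining
  term.\<close>

lemma dplus_dminus:
  "eqv (Suc k) (dplus x (dminus F)) (\<lambda>c. dminus (dplus x F) c + Phi x F c)"
proof (rule eqvI, erule tuples_SucE)
  fix c y r assume c: "c = y # r" "r \<in> tuples k" "y \<in> {1..N} - set r"
  let ?S = "{1..N} - set r"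
  have S: "?S = insert y (?S - {y})" "{1..N} - set (y # r) = ?S - {y}" using c by auto
  have "dplus x (dminus F) c = (\<Sum>b\<in>?S. new_wt x y r * F (r @ [b]))"
    by (simp add: c dplus_Cons dminus_def sum_distrib_left)
  also have "\<dots> = new_wt x y r * F (r @ [y]) + (\<Sum>b\<in>?S-{y}. new_wt x y r * F (r @ [b]))"
    by (subst S(1), subst sum.insert) auto
  finally have 1: "dplus x (dminus F) c = \<dots>" .
  have 2: "dminus (dplus x F) c = (\<Sum>b\<in>?S-{y}. asc_wt b y * (new_wt x y r * F (r @ [b])))"
    unfolding dminus_def c S(2) by (intro sum.cong) (auto simp: dplus_Cons new_wt_snoc)
  have "Phi x F c = (\<Sum>b\<in>?S. link b y * (new_wt x y r * F (r @ [b])))"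
    by (simp add: c Phi_Cons sum_distrib_left algebra_simps)
  also have "\<dots> = new_wt x y r * F (r @ [y]) + (\<Sum>b\<in>?S-{y}. link b y * (new_wt x y r * F (r @ [b])))"
    by (subst S(1), subst sum.insert) (auto simp: link_def)
  finally have 3: "Phi x F c = \<dots>" .
  have "(\<Sum>b\<in>?S-{y}. new_wt x y r * F (r @ [b])) =
     (\<Sum>b\<in>?S-{y}. asc_wt b y * (new_wt x y r * F (r @ [b]))) +
     (\<Sum>b\<in>?S-{y}. link b y * (new_wt x y r * F (r @ [b])))"
    unfolding sum.distrib[symmetric]
    by (intro sum.cong) (auto simp: asc_wt_def link_def algebra_simps)
  then show "dplus x (dminus F) c = dminus (dplus x F) c + Phi x F c"
    unfolding 1 2 3 by simp
qed

section \<open>Relations between the Hecke generators and the three operators\<close>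

lemma hecke_dplus:
  assumes "Suc i < k"
  shows "eqv (Suc k) (hecke (Suc i) (dplus x F)) (dplus x (hecke i F))"
proof (rule eqvI, erule tuples_SucE)
  fix c y r assume c: "c = y # r" "r \<in> tuples k" "y \<in> {1..N} - set r"
  have "Suc i < length r" using c assms by (auto simp: tuples_def)
  then have "new_wt x y (swap_adj i r) = new_wt x y r" by (intro new_wt_cong) simp
  then show "hecke (Suc i) (dplus x F) c = dplus x (hecke i F) c"
    by (simp add: c hecke_def dplus_Cons swap_adj_Cons algebra_simps)
qed

text \<open>Positions are counted from the newest vertex, so removing the oldest one leaves the
  index alone, while \<open>dplus\<close> and \<open>Phi\<close> shift it by one.\<close>

lemma hecke_dminus:
  assumes "Suc i < k"
  shows "eqv k (hecke i (dminus F)) (dminus (hecke i F))"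
proof (rule eqvI)
  fix c assume c: "c \<in> tuples k"
  then have l: "Suc i < length c" using assms by (simp add: tuples_def)
  then show "hecke i (dminus F) c = dminus (hecke i F) c"
    by (simp add: hecke_def dminus_def swap_adj_append1 nth_append sum_distrib_left sum.distrib)
qed

lemma hecke_Phi:
  assumes "Suc i < k"
  shows "eqv (Suc k) (hecke (Suc i) (Phi x F)) (Phi x (hecke i F))"
proof (rule eqvI, erule tuples_SucE)
  fix c y r assume c: "c = y # r" "r \<in> tuples k" "y \<in> {1..N} - set r"
  have l: "Suc i < length r" using c assms by (auto simp: tuples_def)
  then have w: "new_wt x y (swap_adj i r) = new_wt x y r" by (intro new_wt_cong) simp
  show "hecke (Suc i) (Phi x F) c = Phi x (hecke i F) c"
    using l by (simp add: c hecke_def Phi_Cons swap_adj_Cons w nth_append swap_adj_append1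
      algebra_simps sum.distrib sum_distrib_left sum_subtractf)
qed

text \<open>The two newest vertices see the same older colours and each other. Exchanging their
  colours only decides whether the edge between them is an ascent, hence the eigenvalue
  \<open>t\<close>.\<close>

lemma hecke_dplus_dplus:
  "eqv (Suc (Suc k)) (hecke 0 (dplus x (dplus x F))) (\<lambda>c. t * dplus x (dplus x F) c)"
proof (rule eqvI, elim tuples_SucE)
  fix c y r b r' assume c: "c = y # r" "y \<in> {1..N} - set r" "r = b # r'" "b \<in> {1..N} - set r'"
  then have "y \<noteq> b" by auto
  with c show "hecke 0 (dplus x (dplus x F)) c = t * dplus x (dplus x F) c"
    by (auto simp: hecke_def dplus_Cons swap_adj_0 new_wt_Cons asc_wt_def algebra_simps)
qed

text \<open>Both positions are summed over, and the values of \<open>hecke k F\<close> at (u, v) and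
  (v, u) add up to \<open>t\<close> times the sum of those of F.\<close>

lemma dminus_dminus_hecke:
  "eqv k (dminus (dminus (hecke k F))) (\<lambda>c. t * dminus (dminus F) c)"
proof (rule eqvI)
  fix c assume c: "c \<in> tuples k"
  let ?S = "{1..N} - set c"
  have 1: "dminus (dminus G) c = (\<Sum>u\<in>?S. \<Sum>v\<in>{v\<in>?S. u < v}. G (c @ [u, v]) + G (c @ [v, u]))" for G
  proof -
    have "dminus (dminus G) c = (\<Sum>u\<in>?S. \<Sum>v\<in>?S - {u}. G (c @ [u, v]))"
      unfolding dminus_def by (intro sum.cong) auto
    then show ?thesis by (simp add: sum_distinct_pairs)
  qed
  have k: "length c = k" using c by (simp add: tuples_def)
  have sw: "swap_adj k (c @ [u, v]) = c @ [v, u]" for u v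
    using swap_adj_append[of c u v "[]"] k by simp
  have ge: "(c @ [u, v]) ! k = u" "(c @ [u, v]) ! Suc k = v" for u v
    using k by (auto simp: nth_append)
  show "dminus (dminus (hecke k F)) c = t * dminus (dminus F) c"
    unfolding 1 sum_distrib_left
    by (intro sum.cong refl) (auto simp: hecke_def sw ge algebra_simps)
qed

text \<open>On the left the newest vertex is linked to the oldest one, on the right the second
  newest; the generator exchanges the two. Once the common factor is taken out, the coefficient of
  each value of G depends only on the relative order of y, a and b.\<close>

lemma Phi_dplus:
  "eqv (Suc (Suc k)) (Phi x (dplus x G)) (hecke 0 (dplus x (Phi x G)))"
proof (rule eqvI, elim tuples_SucE)
  fix c y r a r' assume c: "c = y # r" "y \<in> {1..N} - set r" "r = a # r'" "a \<in> {1..N} - set r'"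
  define S where "S = {1..N} - set r'"
  let ?w = "\<lambda>y. new_wt x y r'"
  have fin: "finite S" by (simp add: S_def)
  have ya: "y \<noteq> a" "y \<in> S" "a \<in> S" using c by (auto simp: S_def)
  define K where "K = ?w y * ?w a"
  \<comment> \<open>A zero coefficient at b = a extends the sum to all of S, which makes it
    comparable term by term with the right-hand side.\<close>
  have L: "Phi x (dplus x G) c = (\<Sum>b\<in>S. K * (asc_wt a y * (link b y * (if b = a then 0 else asc_wt b a * G (r' @ [b])))))"
  proof -
    have "Phi x (dplus x G) c = new_wt x y r * (\<Sum>b\<in>S - {a}. link b y * (asc_wt b a * ?w a * G (r' @ [b])))"
      unfolding c(1) Phi_Cons by (rule arg_cong2[where f="(*)"], rule refl, rule sum.cong)
        (auto simp: c(3) S_def dplus_Cons new_wt_snoc)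
    also have "\<dots> = (\<Sum>b\<in>S - {a}. K * (asc_wt a y * (link b y * (asc_wt b a * G (r' @ [b])))))"
      using c by (auto simp: sum_distrib_left K_def new_wt_Cons algebra_simps)
    also have "\<dots> = (\<Sum>b\<in>S. K * (asc_wt a y * (link b y * (if b = a then 0 else asc_wt b a * G (r' @ [b])))))"
      using fin by (intro sum.mono_neutral_cong_left) auto
    finally show ?thesis .
  qed
  have R: "dplus x (Phi x G) (u # v # r') = (\<Sum>b\<in>S. K * (asc_wt v u * (link b v * G (r' @ [b]))))"
    if "u = y \<and> v = a \<or> u = a \<and> v = y" for u v
    using that c by (auto simp: dplus_Cons Phi_Cons S_def sum_distrib_left K_def new_wt_Cons algebra_simps)
  show "Phi x (dplus x G) c = hecke 0 (dplus x (Phi x G)) c"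
  proof (cases "y < a")
    case True
    have "hecke 0 (dplus x (Phi x G)) c = dplus x (Phi x G) (a # y # r')"
      using True by (simp add: c hecke_def swap_adj_0)
    also have "\<dots> = Phi x (dplus x G) c"
      unfolding L using R[of a y] True
      by (auto intro!: sum.cong simp: asc_wt_def link_def)
    finally show ?thesis ..
  next
    case False
    then have "a < y" using ya by auto
    have "hecke 0 (dplus x (Phi x G)) c = (t - 1) * dplus x (Phi x G) (y # a # r') + t * dplus x (Phi x G) (a # y # r')"
      using False by (simp add: c hecke_def swap_adj_0)
    also have "\<dots> = Phi x (dplus x G) c"
      unfolding L using R[of a y] R[of y a] \<open>a < y\<close>
      by (auto simp: sum_distrib_left sum.distrib[symmetric] intro!: sum.cong)
        (auto simp: asc_wt_def link_def algebra_simps)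
    finally show ?thesis ..
  qed
qed

text \<open>On the left the last position is summed over and the one before it is linked, on the
  right the other way round; the generator makes up for the exchange. This is the rule by which
  \<open>Phi\<close> passes to the inside of \<open>dminus\<close>.\<close>

lemma Phi_dminus:
  "eqv (Suc k) (Phi x (dminus (hecke k G))) (dminus (Phi x G))"
proof (rule eqvI, elim tuples_SucE)
  fix c y r assume c: "c = y # r" "y \<in> {1..N} - set r" "r \<in> tuples k"
  define S where "S = {1..N} - set r"
  let ?w = "new_wt x y r"
  have fin: "finite S" "y \<in> S" using c by (auto simp: S_def)
  have k: "length r = k" using c by (simp add: tuples_def)
  have sw: "swap_adj k (r @ [u, v]) = r @ [v, u]" for u v
    using swap_adj_append[of r u v "[]"] k by simp
  have ge: "(r @ [u, v]) ! k = u" "(r @ [u, v]) ! Suc k = v" for u v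
    using k by (auto simp: nth_append)
  have "Phi x (dminus (hecke k G)) c = (\<Sum>u\<in>S. \<Sum>v\<in>S - {u}. ?w * (link u y * hecke k G (r @ [u, v])))"
    unfolding c(1) Phi_Cons sum_distrib_left dminus_def S_def by (intro sum.cong) auto
  then have L: "Phi x (dminus (hecke k G)) c = (\<Sum>u\<in>S. \<Sum>v\<in>{v\<in>S. u < v}. ?w * (link u y * hecke k G (r @ [u, v])) + ?w * (link v y * hecke k G (r @ [v, u])))"
    using fin by (simp add: sum_distinct_pairs)
  have "dminus (Phi x G) c = (\<Sum>v\<in>S-{y}. \<Sum>u\<in>S - {v}. ?w * (asc_wt v y * (link u y * G (r @ [v, u]))))"
    unfolding c(1) dminus_def by (rule sum.cong)
      (auto simp: S_def Phi_Cons sum_distrib_left new_wt_snoc algebra_simps intro!: sum.cong)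
  also have "\<dots> = (\<Sum>v\<in>S. \<Sum>u\<in>S - {v}. ?w * ((if v = y then 0 else asc_wt v y) * (link u y * G (r @ [v, u]))))"
    using fin by (intro sum.mono_neutral_cong_left) (auto intro!: sum.cong)
  finally have R: "dminus (Phi x G) c = (\<Sum>v\<in>S. \<Sum>u\<in>{u\<in>S. v < u}. ?w * ((if v = y then 0 else asc_wt v y) * (link u y * G (r @ [v, u]))) + ?w * ((if u = y then 0 else asc_wt u y) * (link v y * G (r @ [u, v]))))"
    using fin by (simp add: sum_distinct_pairs)
  show "Phi x (dminus (hecke k G)) c = dminus (Phi x G) c"
    unfolding L R
    by (intro sum.cong refl) (auto simp: hecke_def sw ge asc_wt_def link_def algebra_simps)
qed

text \<open>An exchange of the two oldest positions becomes an exchange of the two new vertices that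
  are linked to them.\<close>

lemma Phi_Phi:
  "eqv (Suc (Suc k)) (Phi x (Phi x (hecke k G))) (hecke 0 (Phi x (Phi x G)))"
proof (rule eqvI, elim tuples_SucE)
  fix c y r a r' assume c: "c = y # r" "y \<in> {1..N} - set r" "r = a # r'" "a \<in> {1..N} - set r'"
    "r' \<in> tuples k"
  define S where "S = {1..N} - set r'"
  let ?w = "\<lambda>y. new_wt x y r'"
  have fin: "finite S" by (simp add: S_def)
  have ya: "y \<noteq> a" "y \<in> S" "a \<in> S" using c by (auto simp: S_def)
  have k: "length r' = k" using c by (simp add: tuples_def)
  have sw: "swap_adj k (r' @ [u, v]) = r' @ [v, u]" for u v
    using swap_adj_append[of r' u v "[]"] k by simp
  have ge: "(r' @ [u, v]) ! k = u" "(r' @ [u, v]) ! Suc k = v" for u v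
    using k by (auto simp: nth_append)
  define K where "K = ?w y * ?w a"
  \<comment> \<open>The coefficient of H (r' @ [u, v]) for new colours p and s, apart from K: u is
    linked to p and v to s. The value 0 at u = s lets u range over all of S, so that (u, v) can be
    paired with (v, u).\<close>
  define m where "m p s u v = asc_wt s p * ((if u = s then 0 else link u p * asc_wt u s) * link v s)" for p s u v
  have L: "Phi x (Phi x H) (p # s # r') = (\<Sum>u\<in>S. \<Sum>v\<in>{v\<in>S. u < v}. K * (m p s u v * H (r' @ [u, v])) + K * (m p s v u * H (r' @ [v, u])))"
    if ps: "p = y \<and> s = a \<or> p = a \<and> s = y" for p s H
  proof -
    have 1: "s \<notin> set r'" using ps c by auto
    have "Phi x (Phi x H) (p # s # r') = (\<Sum>u\<in>S - {s}. \<Sum>v\<in>S - {u}. K * (m p s u v * H (r' @ [u, v])))"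
      unfolding Phi_Cons[of _ _ p] sum_distrib_left using ps 1
      by (intro sum.cong)
        (auto simp: S_def Phi_Cons sum_distrib_left new_wt_snoc new_wt_Cons K_def m_def algebra_simps intro!: sum.cong)
    also have "\<dots> = (\<Sum>u\<in>S. \<Sum>v\<in>S - {u}. K * (m p s u v * H (r' @ [u, v])))"
      using fin by (intro sum.mono_neutral_left) (auto simp: m_def)
    finally show ?thesis using fin by (simp add: sum_distinct_pairs)
  qed
  have La: "Phi x (Phi x (hecke k G)) c = (\<Sum>u\<in>S. \<Sum>v\<in>{v\<in>S. u < v}. K * (m y a u v * hecke k G (r' @ [u, v])) + K * (m y a v u * hecke k G (r' @ [v, u])))"
    unfolding c(1,3) by (rule L) auto
  show "Phi x (Phi x (hecke k G)) c = hecke 0 (Phi x (Phi x G)) c"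
  proof (cases "y < a")
    case True
    have "hecke 0 (Phi x (Phi x G)) c = Phi x (Phi x G) (a # y # r')"
      using True by (simp add: c hecke_def swap_adj_0)
    also have "\<dots> = Phi x (Phi x (hecke k G)) c"
      unfolding La using L[of a y G]
      apply (simp add: sum_distrib_left sum.distrib[symmetric])
      apply (intro sum.cong refl)
      using True by (auto simp: hecke_def sw ge m_def asc_wt_def link_def algebra_simps)
    finally show ?thesis ..
  next
    case False
    then have ay: "a < y" using ya by auto
    have "hecke 0 (Phi x (Phi x G)) c = (t - 1) * Phi x (Phi x G) (y # a # r') + t * Phi x (Phi x G) (a # y # r')"
      using False by (simp add: c hecke_def swap_adj_0)
    also have "\<dots> = Phi x (Phi x (hecke k G)) c"
      unfolding La using L[of a y G] L[of y a G]
      apply (simp add: sum_distrib_left sum.distrib[symmetric])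
      apply (intro sum.cong refl)
      using ay by (auto simp: hecke_def sw ge m_def asc_wt_def link_def algebra_simps)
    finally show ?thesis ..
  qed
qed

end

section \<open>Functions indexed by words of chain lengths\<close>

text \<open>
  The exponent \<open>word_stat\<close> is chosen such that \<open>state_fn\<close> below does not depend on the order of \<open>\<Lambda>\<close>.
\<close>

definition pair_stat :: "nat \<Rightarrow> nat \<Rightarrow> int" where
  "pair_stat a b = (if a \<le> b then 1 else 0) - int (min a b)"

fun word_stat :: "nat list \<Rightarrow> int" where
  "word_stat [] = 0"
| "word_stat (a # \<rho>) = sum_list (map (pair_stat a) \<rho>) + word_stat \<rho>"

lemma word_stat_append:
  "word_stat (\<alpha> @ \<beta>) = word_stat \<alpha> + word_stat \<beta> + (\<Sum>a\<leftarrow>\<alpha>. \<Sum>b\<leftarrow>\<beta>. pair_stat a b)"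
  by (induction \<alpha>) (auto simp: algebra_simps)

lemma word_stat_swap:
  assumes "u < v"
  shows "word_stat (\<alpha> @ u # v # \<beta>) = word_stat (\<alpha> @ v # u # \<beta>) + 1"
proof -
  have "pair_stat u v = pair_stat v u + 1" using assms by (simp add: pair_stat_def)
  then show ?thesis by (simp add: word_stat_append algebra_simps)
qed

text \<open>A new vertex without a link leaves the exponent unchanged.\<close>

lemma sum_list_pair_stat_1: "0 \<notin> set \<rho> \<Longrightarrow> sum_list (map (pair_stat 1) \<rho>) = 0"
proof (induction \<rho>)
  case (Cons a \<rho>)
  then show ?case by (cases a) (auto simp: pair_stat_def)
qed simp

lemma pair_stat_diff_new:
  "sum_list (map (\<lambda>b. pair_stat b d) \<eta>) - sum_list (map (pair_stat (Suc d)) \<eta>)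
     = int (length (filter (\<lambda>b. b \<le> d) \<eta>))"
  by (induction \<eta>) (auto simp: pair_stat_def min_def)

lemma pair_stat_diff_ge:
  "\<forall>b\<in>set \<beta>. d \<le> b \<Longrightarrow>
   sum_list (map (\<lambda>b. pair_stat b d) \<beta>) - sum_list (map (pair_stat (Suc d)) \<beta>)
     = int (count_list \<beta> d)"
  by (induction \<beta>) (auto simp: pair_stat_def min_def)

lemma pair_stat_diff_le:
  "\<forall>b\<in>set \<beta>. b \<le> d \<Longrightarrow>
   sum_list (map (pair_stat d) \<beta>) - sum_list (map (pair_stat (Suc d)) \<beta>) = int (count_list \<beta> d)"
  by (induction \<beta>) (auto simp: pair_stat_def min_def)

text \<open>The exponent when a chain of length d is prolonged by a new vertex, so that its entry
  moves to the front. The entries of \<eta> belong to open vertices, those of \<alpha> and \<beta>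
  to closed ends. The term for \<beta> is kept apart because the factor in
  \<open>Phi_dminus_pow_word_fn\<close> cancels it.\<close>

lemma word_stat_raise:
  assumes "\<forall>b\<in>set \<alpha>. d \<le> b" "\<forall>b\<in>set \<beta>. b \<le> d"
  shows "word_stat (\<eta> @ \<alpha> @ d # \<beta>) = word_stat (Suc d # \<eta> @ \<alpha> @ \<beta>)
    + int (length (filter (\<lambda>b. b \<le> d) \<eta>) + count_list \<alpha> d) + int (count_list \<beta> d)"
proof -
  have "word_stat (\<eta> @ \<alpha> @ d # \<beta>) - word_stat (Suc d # \<eta> @ \<alpha> @ \<beta>)
     = (sum_list (map (\<lambda>b. pair_stat b d) \<eta>) - sum_list (map (pair_stat (Suc d)) \<eta>))
     + (sum_list (map (\<lambda>b. pair_stat b d) \<alpha>) - sum_list (map (pair_stat (Suc d)) \<alpha>))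
     + (sum_list (map (pair_stat d) \<beta>) - sum_list (map (pair_stat (Suc d)) \<beta>))"
    by (simp add: word_stat_append sum_list_addf)
  then show ?thesis
    using pair_stat_diff_new[of d \<eta>] pair_stat_diff_ge[OF assms(1)] pair_stat_diff_le[OF assms(2)]
    by simp
qed

lemma sum_q_int_snoc:
  fixes t :: "'a::comm_semiring_1"
  assumes "set \<Lambda>' = insert u (set \<Lambda>)"
    and "\<And>d. count_list \<Lambda>' d = count_list \<Lambda> d + (if d = u then 1 else 0)"
  shows "(\<Sum>d\<in>set \<Lambda>'. (\<Sum>j<count_list \<Lambda>' d. t ^ j) * f d)
    = t ^ count_list \<Lambda> u * f u + (\<Sum>d\<in>set \<Lambda>. (\<Sum>j<count_list \<Lambda> d. t ^ j) * f d)"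
proof -
  have 1: "(\<Sum>d\<in>set \<Lambda>. (\<Sum>j<count_list \<Lambda> d. t ^ j) * f d)
      = (\<Sum>d\<in>insert u (set \<Lambda>). (\<Sum>j<count_list \<Lambda> d. t ^ j) * f d)"
    by (rule sum.mono_neutral_left) (auto simp: count_list_0_iff)
  have 2: "insert u (set \<Lambda>) = insert u (set \<Lambda> - {u})" by auto
  show ?thesis unfolding 1 assms(1) unfolding 2
    by (subst (1 2) sum.insert) (auto simp: assms(2) algebra_simps)
qed

text \<open>Whether equal entries are weighted by the number of equal ones before them, as here, or
  behind them, as in \<open>sum_count_drop\<close>, their weights add up to the same t-integer. One
  count can therefore replace the other, and the list may be reordered in between.\<close>

lemma sum_count_take:
  fixes t :: "'a::comm_semiring_1"
  shows "(\<Sum>r<length \<Lambda>. t ^ count_list (take r \<Lambda>) (\<Lambda> ! r) * f (\<Lambda> ! r))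
    = (\<Sum>d\<in>set \<Lambda>. (\<Sum>j<count_list \<Lambda> d. t ^ j) * f d)"
proof (induction \<Lambda> rule: rev_induct)
  case (snoc u \<Lambda>)
  have "(\<Sum>r<length (\<Lambda> @ [u]). t ^ count_list (take r (\<Lambda> @ [u])) ((\<Lambda> @ [u]) ! r) * f ((\<Lambda> @ [u]) ! r))
    = (\<Sum>r<length \<Lambda>. t ^ count_list (take r \<Lambda>) (\<Lambda> ! r) * f (\<Lambda> ! r)) + t ^ count_list \<Lambda> u * f u"
    by (auto simp: nth_append intro!: sum.cong)
  also have "\<dots> = (\<Sum>d\<in>set \<Lambda>. (\<Sum>j<count_list \<Lambda> d. t ^ j) * f d) + t ^ count_list \<Lambda> u * f u"
    by (simp add: snoc.IH)
  also have "\<dots> = (\<Sum>d\<in>set (\<Lambda> @ [u]). (\<Sum>j<count_list (\<Lambda> @ [u]) d. t ^ j) * f d)"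
    by (subst sum_q_int_snoc[of _ u \<Lambda>]) (auto simp: add.commute)
  finally show ?case .
qed simp

lemma sum_count_drop:
  fixes t :: "'a::comm_semiring_1"
  shows "(\<Sum>r<length \<Lambda>. t ^ count_list (drop (Suc r) \<Lambda>) (\<Lambda> ! r) * f (\<Lambda> ! r))
    = (\<Sum>d\<in>set \<Lambda>. (\<Sum>j<count_list \<Lambda> d. t ^ j) * f d)"
proof (induction \<Lambda>)
  case (Cons u \<Lambda>)
  have "(\<Sum>r<length (u # \<Lambda>). t ^ count_list (drop (Suc r) (u # \<Lambda>)) ((u # \<Lambda>) ! r) * f ((u # \<Lambda>) ! r))
    = t ^ count_list \<Lambda> u * f u + (\<Sum>d\<in>set \<Lambda>. (\<Sum>j<count_list \<Lambda> d. t ^ j) * f d)"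
    using Cons.IH by (simp add: sum.lessThan_Suc_shift del: sum.lessThan_Suc)
  also have "\<dots> = (\<Sum>d\<in>set (u # \<Lambda>). (\<Sum>j<count_list (u # \<Lambda>) d. t ^ j) * f d)"
    by (subst sum_q_int_snoc[of "u # \<Lambda>" u \<Lambda>]) auto
  finally show ?case .
qed simp

context colour_tuples
begin

text \<open>Each entry of the word is the length of the chain ending at that position of the tuple.
  Length 1 is a vertex without a link; a greater length at the front arises from \<open>Phi\<close>,
  which takes over the chain at the oldest position, hence the rotation of the word. No chain has
  length 0; the value there is a default.\<close>

function word_fn :: "(nat \<Rightarrow> 'a) \<Rightarrow> nat list \<Rightarrow> nat list \<Rightarrow> 'a" where
  "word_fn x [] = (\<lambda>c. 1)"
| "word_fn x (0 # \<rho>) = (\<lambda>c. 0)"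
| "word_fn x (Suc 0 # \<rho>) = dplus x (word_fn x \<rho>)"
| "word_fn x (Suc (Suc d) # \<rho>) = Phi x (word_fn x (\<rho> @ [Suc d]))"
  by pat_completeness auto
termination by (relation "measure (\<lambda>(x, \<rho>). sum_list \<rho>)") auto

text \<open>Behind the first position the generator passes through \<open>dplus\<close> or
  \<open>Phi\<close> to a word with smaller sum. On the first two positions the relations above
  apply; two lengths of at least 2 lead, by \<open>Phi_Phi\<close>, to the last two positions of a
  word with smaller sum.\<close>

lemma word_fn_swap:
  assumes "0 \<notin> set \<rho>" "Suc i < length \<rho>"
  shows "(\<rho> ! i < \<rho> ! Suc i \<longrightarrow> eqv (length \<rho>) (word_fn x (swap_adj i \<rho>)) (hecke i (word_fn x \<rho>))) \<and>
    (\<rho> ! i = \<rho> ! Suc i \<longrightarrow> eqv (length \<rho>) (hecke i (word_fn x \<rho>)) (\<lambda>c. t * word_fn x \<rho> c))"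
  using assms
proof (induction "sum_list \<rho>" arbitrary: \<rho> i rule: less_induct)
  case less
  obtain a \<rho>' where \<rho>: "\<rho> = a # \<rho>'" using less.prems by (cases \<rho>) auto
  then obtain a' where a: "a = Suc a'" using less.prems by (cases a) auto
  show ?case
  proof (cases i)
    case (Suc i')
    show ?thesis
    proof (cases a')
      case 0
      have IH: "(\<rho>' ! i' < \<rho>' ! Suc i' \<longrightarrow> eqv (length \<rho>') (word_fn x (swap_adj i' \<rho>')) (hecke i' (word_fn x \<rho>'))) \<and>
        (\<rho>' ! i' = \<rho>' ! Suc i' \<longrightarrow> eqv (length \<rho>') (hecke i' (word_fn x \<rho>')) (\<lambda>c. t * word_fn x \<rho>' c))"
        using less.prems by (intro less.hyps) (auto simp: \<rho> a Suc)
      have h: "eqv (Suc (length \<rho>')) (hecke (Suc i') (dplus x (word_fn x \<rho>'))) (dplus x (hecke i' (word_fn x \<rho>')))"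
        using less.prems by (intro hecke_dplus) (auto simp: \<rho> Suc)
      show ?thesis
        using IH[THEN conjunct1, rule_format, THEN eqv_dplus, THEN eqv_trans, OF _ eqv_sym[OF h]]
          eqv_trans[OF h, OF IH[THEN conjunct2, rule_format, THEN eqv_dplus]]
        by (simp add: \<rho> a 0 Suc swap_adj_Cons dplus_scale)
    next
      case (Suc d)
      let ?\<sigma> = "\<rho>' @ [Suc d]"
      have l: "Suc i' < length \<rho>'" using less.prems by (simp add: \<rho> \<open>i = _\<close>)
      have IH: "(?\<sigma> ! i' < ?\<sigma> ! Suc i' \<longrightarrow> eqv (length ?\<sigma>) (word_fn x (swap_adj i' ?\<sigma>)) (hecke i' (word_fn x ?\<sigma>))) \<and>
        (?\<sigma> ! i' = ?\<sigma> ! Suc i' \<longrightarrow> eqv (length ?\<sigma>) (hecke i' (word_fn x ?\<sigma>)) (\<lambda>c. t * word_fn x ?\<sigma> c))"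
        using less.prems by (intro less.hyps) (auto simp: \<rho> a Suc \<open>i = _\<close>)
      have h: "eqv (Suc (length \<rho>')) (hecke (Suc i') (Phi x (word_fn x ?\<sigma>))) (Phi x (hecke i' (word_fn x ?\<sigma>)))"
        using l by (intro hecke_Phi)
      have IH1: "\<rho>' ! i' < \<rho>' ! Suc i' \<Longrightarrow> eqv (Suc (length \<rho>')) (word_fn x (swap_adj i' ?\<sigma>)) (hecke i' (word_fn x ?\<sigma>))"
        and IH2: "\<rho>' ! i' = \<rho>' ! Suc i' \<Longrightarrow> eqv (Suc (length \<rho>')) (hecke i' (word_fn x ?\<sigma>)) (\<lambda>c. t * word_fn x ?\<sigma> c)"
        using IH l by (simp_all add: nth_append)
      show ?thesis
        using IH1[THEN eqv_Phi, THEN eqv_trans, OF _ eqv_sym[OF h]]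
          eqv_trans[OF h, OF IH2[THEN eqv_Phi]] l
        by (simp add: \<rho> a Suc \<open>i = _\<close> swap_adj_Cons swap_adj_append1 Phi_scale)
    qed
  next
    case 0
    obtain b \<sigma> where \<rho>': "\<rho>' = b # \<sigma>" using less.prems by (cases \<rho>') (auto simp: \<rho> 0)
    then obtain b' where b: "b = Suc b'" using less.prems \<rho> by (cases b) auto
    consider "a' = 0" "b' = 0" | e where "a' = 0" "b' = Suc e" | d where "a' = Suc d" "b' = 0"
      | d e where "a' = Suc d" "b' = Suc e"
      by (cases a'; cases b') auto
    then show ?thesis
    proof cases
      case 1
      then show ?thesis using hecke_dplus_dplus by (auto simp: \<rho> \<rho>' a b 0)
    next
      case 2
      then show ?thesis using Phi_dplus by (auto simp: \<rho> \<rho>' a b 0 swap_adj_0)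
    next
      case 3
      \<comment> \<open>The first length exceeds the second, so both premises fail.\<close>
      then show ?thesis by (auto simp: \<rho> \<rho>' a b 0)
    next
      case (4 d e)
      let ?\<sigma> = "\<sigma> @ [Suc d, Suc e]"
      let ?l = "length \<sigma>"
      have ge: "?\<sigma> ! ?l = Suc d" "?\<sigma> ! Suc ?l = Suc e" by (auto simp: nth_append)
      have sw: "swap_adj ?l ?\<sigma> = \<sigma> @ [Suc e, Suc d]" using swap_adj_append[of \<sigma> _ _ "[]"] by simp
      have IH: "(?\<sigma> ! ?l < ?\<sigma> ! Suc ?l \<longrightarrow> eqv (length ?\<sigma>) (word_fn x (swap_adj ?l ?\<sigma>)) (hecke ?l (word_fn x ?\<sigma>))) \<and>
        (?\<sigma> ! ?l = ?\<sigma> ! Suc ?l \<longrightarrow> eqv (length ?\<sigma>) (hecke ?l (word_fn x ?\<sigma>)) (\<lambda>c. t * word_fn x ?\<sigma> c))"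
        using less.prems by (intro less.hyps) (auto simp: \<rho> \<rho>' a b 4)
      note h = Phi_Phi[of ?l x "word_fn x ?\<sigma>"]
      have IH1: "eqv (Suc (Suc ?l)) (word_fn x (\<sigma> @ [Suc e, Suc d])) (hecke ?l (word_fn x ?\<sigma>))" if "d < e"
        using IH that unfolding ge sw by simp
      have IH2: "eqv (Suc (Suc ?l)) (hecke ?l (word_fn x ?\<sigma>)) (\<lambda>c. t * word_fn x ?\<sigma> c)" if "d = e"
        using IH that unfolding ge sw by simp
      show ?thesis
        using IH1[THEN eqv_Phi, THEN eqv_Phi, THEN eqv_trans, OF _ h]
          eqv_trans[OF eqv_sym[OF h], OF IH2[THEN eqv_Phi, THEN eqv_Phi]]
        by (auto simp: \<rho> \<rho>' a b 4 0 swap_adj_0 Phi_scale)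
    qed
  qed
qed

lemma word_fn_asc:
  assumes "0 \<notin> set (\<alpha> @ u # v # \<beta>)" "u < v"
  shows "eqv (length \<alpha> + length \<beta> + 2) (word_fn x (\<alpha> @ v # u # \<beta>)) (hecke (length \<alpha>) (word_fn x (\<alpha> @ u # v # \<beta>)))"
  using word_fn_swap[OF assms(1), of "length \<alpha>" x] assms(2)
  by (simp add: swap_adj_append nth_append)

lemma word_fn_eq:
  assumes "0 \<notin> set (\<alpha> @ u # u # \<beta>)"
  shows "eqv (length \<alpha> + length \<beta> + 2) (hecke (length \<alpha>) (word_fn x (\<alpha> @ u # u # \<beta>))) (\<lambda>c. t * word_fn x (\<alpha> @ u # u # \<beta>) c)"
  using word_fn_swap[OF assms(1), of "length \<alpha>" x]
  by (simp add: nth_append)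

section \<open>Passing through repeated \<open>dminus\<close>\<close>

lemma dminus_pow_hecke_low:
  assumes "Suc i < k"
  shows "eqv k ((dminus ^^ l) (hecke i F)) (hecke i ((dminus ^^ l) F))"
  using assms
proof (induction l arbitrary: k)
  case (Suc l)
  have "eqv k ((dminus ^^ Suc l) (hecke i F)) (dminus (hecke i ((dminus ^^ l) F)))"
    using Suc.IH[of "Suc k"] Suc.prems by (simp add: eqv_dminus)
  also have "eqv k \<dots> (hecke i (dminus ((dminus ^^ l) F)))"
    by (rule eqv_sym, rule hecke_dminus) (use Suc.prems in auto)
  finally show ?case by simp
qed (simp add: eqv_refl)

text \<open>Both exchanged positions are summed over: the l' positions behind them go first, the
  pair itself then contributes \<open>t\<close>, and the m positions in front of it that are still
  to be removed see only a scalar.\<close>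

lemma dminus_pow_hecke:
  assumes "k \<le> i" "Suc i < k + l"
  shows "eqv k ((dminus ^^ l) (hecke i F)) (\<lambda>c. t * (dminus ^^ l) F c)"
proof -
  define m where "m = i - k"
  define l' where "l' = l - (m + 2)"
  have l: "l = (m + 2) + l'" using assms by (simp add: m_def l'_def)
  have pow: "dminus ^^ l = (dminus ^^ m) \<circ> (dminus ^^ 2) \<circ> (dminus ^^ l')"
    unfolding l funpow_add by (rule refl)
  have "eqv (i + 2) ((dminus ^^ l') (hecke i F)) (hecke i ((dminus ^^ l') F))"
    by (rule dminus_pow_hecke_low) simp
  then have "eqv i ((dminus ^^ 2) ((dminus ^^ l') (hecke i F))) ((dminus ^^ 2) (hecke i ((dminus ^^ l') F)))"
    by (rule eqv_dminus_pow)
  also have "eqv i \<dots> (\<lambda>c. t * (dminus ^^ 2) ((dminus ^^ l') F) c)"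
    using dminus_dminus_hecke[of i] by (simp add: numeral_2_eq_2)
  finally have "eqv (k + m) ((dminus ^^ 2) ((dminus ^^ l') (hecke i F))) (\<lambda>c. t * (dminus ^^ 2) ((dminus ^^ l') F) c)"
    using assms by (simp add: m_def)
  then show ?thesis unfolding pow
    by (auto dest: eqv_dminus_pow simp: dminus_pow_scale)
qed

text \<open>\<eta> holds the chain lengths at the open vertices, \<Lambda> those at the closed chain
  ends, whose colours are summed over.\<close>

definition state_fn :: "(nat \<Rightarrow> 'a) \<Rightarrow> nat list \<Rightarrow> nat list \<Rightarrow> nat list \<Rightarrow> 'a" where
  "state_fn x \<eta> \<Lambda> = (\<lambda>c. t powi word_stat (\<eta> @ \<Lambda>) * (dminus ^^ length \<Lambda>) (word_fn x (\<eta> @ \<Lambda>)) c)"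

lemma dminus_state_fn: "dminus (state_fn x (\<eta> @ [e]) \<Lambda>) = state_fn x \<eta> (e # \<Lambda>)"
  by (simp add: state_fn_def dminus_scale)

text \<open>The exchange is a generator acting on two positions that are summed over, hence a factor
  \<open>t\<close>, and \<open>word_stat\<close> changes by one to compensate it.\<close>

lemma state_fn_swap_less:
  assumes "0 \<notin> set (\<eta> @ \<alpha> @ u # v # \<beta>)" "u < v"
  shows "eqv (length \<eta>) (state_fn x \<eta> (\<alpha> @ u # v # \<beta>)) (state_fn x \<eta> (\<alpha> @ v # u # \<beta>))"
proof -
  let ?i = "length \<eta> + length \<alpha>" and ?l = "length \<alpha> + length \<beta> + 2"
  have l: "length \<eta> + ?l = length (\<eta> @ \<alpha>) + length \<beta> + 2" by simp
  have "eqv (length \<eta> + ?l) (word_fn x (\<eta> @ \<alpha> @ v # u # \<beta>)) (hecke ?i (word_fn x (\<eta> @ \<alpha> @ u # v # \<beta>)))"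
    using word_fn_asc[of "\<eta> @ \<alpha>" u v \<beta> x] assms unfolding l by simp
  then have "eqv (length \<eta>) ((dminus ^^ ?l) (word_fn x (\<eta> @ \<alpha> @ v # u # \<beta>)))
      ((dminus ^^ ?l) (hecke ?i (word_fn x (\<eta> @ \<alpha> @ u # v # \<beta>))))"
    by (rule eqv_dminus_pow)
  also have "eqv (length \<eta>) \<dots> (\<lambda>c. t * (dminus ^^ ?l) (word_fn x (\<eta> @ \<alpha> @ u # v # \<beta>)) c)"
    by (rule dminus_pow_hecke) auto
  finally have 1: "eqv (length \<eta>) ((dminus ^^ ?l) (word_fn x (\<eta> @ \<alpha> @ v # u # \<beta>))) \<dots>" .
  have "t powi word_stat (\<eta> @ \<alpha> @ u # v # \<beta>) = t powi word_stat (\<eta> @ \<alpha> @ v # u # \<beta>) * t"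
    using word_stat_swap[OF assms(2), of "\<eta> @ \<alpha>" \<beta>] t_nonzero by (simp add: power_int_add)
  then show ?thesis using 1 by (auto simp: eqv_def state_fn_def)
qed

lemma state_fn_swap:
  assumes "0 \<notin> set (\<eta> @ \<alpha> @ u # v # \<beta>)"
  shows "eqv (length \<eta>) (state_fn x \<eta> (\<alpha> @ u # v # \<beta>)) (state_fn x \<eta> (\<alpha> @ v # u # \<beta>))"
proof (cases u v rule: linorder_cases)
  case less
  then show ?thesis using state_fn_swap_less assms by auto
next
  case equal
  then show ?thesis by (simp add: eqv_refl)
next
  case greater
  then show ?thesis using state_fn_swap_less[of \<eta> \<alpha> v u \<beta>] assms by (auto intro: eqv_sym)
qed

lemma state_fn_move:
  assumes "0 \<notin> set (\<eta> @ \<alpha> @ u # \<beta> @ \<gamma>)"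
  shows "eqv (length \<eta>) (state_fn x \<eta> (\<alpha> @ \<beta> @ u # \<gamma>)) (state_fn x \<eta> (\<alpha> @ u # \<beta> @ \<gamma>))"
  using assms
proof (induction \<beta> arbitrary: \<alpha>)
  case (Cons b \<beta>)
  have "eqv (length \<eta>) (state_fn x \<eta> ((\<alpha> @ [b]) @ \<beta> @ u # \<gamma>)) (state_fn x \<eta> ((\<alpha> @ [b]) @ u # \<beta> @ \<gamma>))"
    using Cons.prems by (intro Cons.IH) auto
  also have "eqv (length \<eta>) \<dots> (state_fn x \<eta> (\<alpha> @ u # b # \<beta> @ \<gamma>))"
    using state_fn_swap[of \<eta> \<alpha> b u "\<beta> @ \<gamma>"] Cons.prems by auto
  finally show ?case by simp
qed (simp add: eqv_refl)

lemma state_fn_perm: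
  assumes "mset \<Lambda> = mset \<Lambda>'" "0 \<notin> set (\<eta> @ \<Lambda>)"
  shows "eqv (length \<eta>) (state_fn x \<eta> \<Lambda>) (state_fn x \<eta> \<Lambda>')"
proof -
  have "eqv (length \<eta>) (state_fn x \<eta> (\<alpha> @ \<Lambda>)) (state_fn x \<eta> (\<alpha> @ \<Lambda>'))" if "0 \<notin> set (\<eta> @ \<alpha> @ \<Lambda>)" for \<alpha>
    using that assms(1)
  proof (induction \<Lambda> arbitrary: \<alpha> \<Lambda>')
    case (Cons u \<Lambda>)
    have "u \<in> set \<Lambda>'" using Cons.prems by (metis list.set_intros(1) set_mset_mset)
    then obtain \<beta> \<gamma> where \<Lambda>': "\<Lambda>' = \<beta> @ u # \<gamma>" by (meson split_list)
    then have m: "mset \<Lambda> = mset (\<beta> @ \<gamma>)" using Cons.prems by simp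
    then have s: "set \<Lambda> = set (\<beta> @ \<gamma>)" by (metis set_mset_mset)
    have "eqv (length \<eta>) (state_fn x \<eta> ((\<alpha> @ [u]) @ \<Lambda>)) (state_fn x \<eta> ((\<alpha> @ [u]) @ \<beta> @ \<gamma>))"
      using Cons.prems m by (intro Cons.IH) auto
    also have "eqv (length \<eta>) \<dots> (state_fn x \<eta> (\<alpha> @ \<beta> @ u # \<gamma>))"
      using state_fn_move[of \<eta> \<alpha> u \<beta> \<gamma>] Cons.prems s by (auto intro: eqv_sym)
    finally show ?case by (simp add: \<Lambda>')
  qed (simp add: eqv_refl)
  from this[of "[]"] assms show ?thesis by simp
qed

text \<open>Each passage of \<open>dplus\<close> across a \<open>dminus\<close> leaves a term behind
  in which the new vertex is linked to the position which that \<open>dminus\<close> removes; j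
  counts the \<open>dminus\<close> that are still outside.\<close>

lemma dplus_dminus_pow:
  "eqv (Suc k) (dplus x ((dminus ^^ l) F))
     (\<lambda>c. (dminus ^^ l) (dplus x F) c + (\<Sum>j<l. (dminus ^^ j) (Phi x ((dminus ^^ (l - 1 - j)) F)) c))"
proof (induction l arbitrary: k)
  case (Suc l)
  have "eqv (Suc k) (dplus x ((dminus ^^ Suc l) F))
     (\<lambda>c. dminus (dplus x ((dminus ^^ l) F)) c + Phi x ((dminus ^^ l) F) c)"
    using dplus_dminus by simp
  moreover have "eqv (Suc k) (dminus (dplus x ((dminus ^^ l) F)))
    (\<lambda>c. (dminus ^^ Suc l) (dplus x F) c + (\<Sum>j<l. (dminus ^^ Suc j) (Phi x ((dminus ^^ (l - 1 - j)) F)) c))"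
    using eqv_dminus[OF Suc.IH[of "Suc k"]] by (simp add: dminus_add dminus_sum)
  ultimately show ?case
    unfolding eqv_def by (simp add: sum.lessThan_Suc_shift del: sum.lessThan_Suc)
qed (simp add: eqv_refl)

text \<open>To prolong the chain of length d, \<open>Phi\<close> has to pass the positions of
  \<beta>, and \<open>Phi_dminus\<close> asks for a generator at each. An entry b < d supplies it by
  its exchange with d; for b = d the generator acts as \<open>t\<close>, which costs a factor 1/t.
  An entry b > d would call for the inverse of a generator, hence the assumption on \<beta>.\<close>

lemma Phi_dminus_pow_word_fn:
  assumes "0 \<notin> set (\<alpha> @ d # \<beta>)" "\<forall>b\<in>set \<beta>. b \<le> d"
  shows "eqv (Suc (length \<alpha>)) (Phi x ((dminus ^^ length \<beta>) (word_fn x (\<alpha> @ d # \<beta>))))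
    (\<lambda>c. t powi (- int (count_list \<beta> d)) * (dminus ^^ length \<beta>) (word_fn x (Suc d # \<alpha> @ \<beta>)) c)"
  using assms
proof (induction \<beta> arbitrary: \<alpha>)
  case Nil
  then obtain d' where "d = Suc d'" by (cases d) auto
  then show ?case by (simp add: eqv_refl)
next
  case (Cons b \<beta>)
  let ?a = "length \<alpha>" and ?l = "length \<beta>"
  let ?s = "if b = d then inverse t else 1"
  have IH: "eqv (Suc (Suc ?a)) (Phi x ((dminus ^^ ?l) (word_fn x (\<alpha> @ b # d # \<beta>))))
    (\<lambda>c. t powi (- int (count_list \<beta> d)) * (dminus ^^ ?l) (word_fn x (Suc d # \<alpha> @ b # \<beta>)) c)"
    using Cons.IH[of "\<alpha> @ [b]"] Cons.prems by simp
  have l: "Suc (Suc ?a) + ?l = ?a + ?l + 2" by simp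
  have "eqv (Suc (Suc ?a) + ?l) (word_fn x (\<alpha> @ d # b # \<beta>)) (\<lambda>c. ?s * hecke ?a (word_fn x (\<alpha> @ b # d # \<beta>)) c)"
  proof (cases "b = d")
    case True
    then show ?thesis unfolding l using word_fn_eq[of \<alpha> d \<beta> x] Cons.prems t_nonzero
      by (auto simp: eqv_def)
  next
    case False
    then show ?thesis unfolding l using word_fn_asc[of \<alpha> b d \<beta> x] Cons.prems by auto
  qed
  from eqv_dminus_pow[OF this]
  have 1: "eqv (Suc (Suc ?a)) ((dminus ^^ ?l) (word_fn x (\<alpha> @ d # b # \<beta>)))
      (\<lambda>c. ?s * (dminus ^^ ?l) (hecke ?a (word_fn x (\<alpha> @ b # d # \<beta>))) c)"
    by (simp add: dminus_pow_scale)
  have "eqv (Suc (Suc ?a)) ((dminus ^^ ?l) (hecke ?a (word_fn x (\<alpha> @ b # d # \<beta>))))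
      (hecke ?a ((dminus ^^ ?l) (word_fn x (\<alpha> @ b # d # \<beta>))))"
    by (rule dminus_pow_hecke_low) simp
  with 1 have "eqv (Suc (Suc ?a)) ((dminus ^^ ?l) (word_fn x (\<alpha> @ d # b # \<beta>)))
      (\<lambda>c. ?s * hecke ?a ((dminus ^^ ?l) (word_fn x (\<alpha> @ b # d # \<beta>))) c)"
    by (auto simp: eqv_def)
  from eqv_Phi[OF eqv_dminus[OF this]]
  have "eqv (Suc ?a) (Phi x ((dminus ^^ Suc ?l) (word_fn x (\<alpha> @ d # b # \<beta>))))
      (\<lambda>c. ?s * Phi x (dminus (hecke ?a ((dminus ^^ ?l) (word_fn x (\<alpha> @ b # d # \<beta>))))) c)"
    by (simp add: dminus_scale Phi_scale)
  moreover have "eqv (Suc ?a) (Phi x (dminus (hecke ?a ((dminus ^^ ?l) (word_fn x (\<alpha> @ b # d # \<beta>))))))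
    (dminus (Phi x ((dminus ^^ ?l) (word_fn x (\<alpha> @ b # d # \<beta>)))))"
    by (rule Phi_dminus)
  moreover note eqv_dminus[OF IH]
  moreover have "t powi (- int (count_list (b # \<beta>) d)) = ?s * t powi (- int (count_list \<beta> d))"
    using t_nonzero by (auto simp: power_int_minus field_simps)
  ultimately show ?case by (auto simp: eqv_def dminus_scale)
qed

lemma dplus_state_fn_sorted:
  assumes "0 \<notin> set (\<eta> @ \<Lambda>)" "sorted_wrt (\<ge>) \<Lambda>"
  shows "eqv (Suc (length \<eta>)) (dplus x (state_fn x \<eta> \<Lambda>))
    (\<lambda>c. state_fn x (1 # \<eta>) \<Lambda> c + (\<Sum>r<length \<Lambda>.
       t ^ (length (filter (\<lambda>b. b \<le> \<Lambda> ! r) \<eta>) + count_list (take r \<Lambda>) (\<Lambda> ! r)) *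
       state_fn x (Suc (\<Lambda> ! r) # \<eta>) (take r \<Lambda> @ drop (Suc r) \<Lambda>) c))"
proof -
  let ?l = "length \<Lambda>" and ?W = "word_fn x (\<eta> @ \<Lambda>)" and ?s = "t powi word_stat (\<eta> @ \<Lambda>)"
  have main: "eqv (Suc (length \<eta>)) (dplus x (state_fn x \<eta> \<Lambda>))
     (\<lambda>c. ?s * (dminus ^^ ?l) (dplus x ?W) c + (\<Sum>j<?l. ?s * (dminus ^^ j) (Phi x ((dminus ^^ (?l - 1 - j)) ?W)) c))"
    using dplus_dminus_pow[of "length \<eta>" x ?l ?W]
    by (simp add: state_fn_def dplus_scale eqv_def sum_distrib_left algebra_simps)
  have new: "?s * (dminus ^^ ?l) (dplus x ?W) c = state_fn x (1 # \<eta>) \<Lambda> c" for c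
    using assms(1) sum_list_pair_stat_1[of "\<eta> @ \<Lambda>"] by (simp add: state_fn_def)
  have att: "?s * (dminus ^^ r) (Phi x ((dminus ^^ (?l - 1 - r)) ?W)) c =
       t ^ (length (filter (\<lambda>b. b \<le> \<Lambda> ! r) \<eta>) + count_list (take r \<Lambda>) (\<Lambda> ! r)) *
       state_fn x (Suc (\<Lambda> ! r) # \<eta>) (take r \<Lambda> @ drop (Suc r) \<Lambda>) c"
    if r: "r < ?l" and c: "c \<in> tuples (Suc (length \<eta>))" for r c
  proof -
    define \<alpha> \<beta> d where "\<alpha> = take r \<Lambda>" and "\<beta> = drop (Suc r) \<Lambda>" and "d = \<Lambda> ! r"
    have \<Lambda>: "\<Lambda> = \<alpha> @ d # \<beta>" using r by (simp add: \<alpha>_def \<beta>_def d_def id_take_nth_drop)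
    have la: "length \<alpha> = r" "length \<beta> = ?l - 1 - r" using r by (auto simp: \<alpha>_def \<beta>_def)
    have le: "\<forall>b\<in>set \<alpha>. d \<le> b" "\<forall>b\<in>set \<beta>. b \<le> d"
      using assms(2) unfolding \<Lambda> by (auto simp: sorted_wrt_append)
    have "eqv (Suc (length (\<eta> @ \<alpha>))) (Phi x ((dminus ^^ length \<beta>) (word_fn x ((\<eta> @ \<alpha>) @ d # \<beta>))))
     (\<lambda>c. t powi (- int (count_list \<beta> d)) * (dminus ^^ length \<beta>) (word_fn x (Suc d # (\<eta> @ \<alpha>) @ \<beta>)) c)"
      using assms(1) le by (intro Phi_dminus_pow_word_fn) (auto simp: \<Lambda>)
    then have "eqv (Suc (length \<eta>) + r) (Phi x ((dminus ^^ length \<beta>) ?W))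
     (\<lambda>c. t powi (- int (count_list \<beta> d)) * (dminus ^^ length \<beta>) (word_fn x (Suc d # \<eta> @ \<alpha> @ \<beta>)) c)"
      using la(1) by (simp add: \<Lambda>)
    from eqv_dminus_pow[OF this]
    have "(dminus ^^ r) (Phi x ((dminus ^^ length \<beta>) ?W)) c = t powi (- int (count_list \<beta> d)) *
       (dminus ^^ r) ((dminus ^^ length \<beta>) (word_fn x (Suc d # \<eta> @ \<alpha> @ \<beta>))) c"
      using c by (simp add: eqv_def dminus_pow_scale)
    also have "(dminus ^^ r) ((dminus ^^ length \<beta>) (word_fn x (Suc d # \<eta> @ \<alpha> @ \<beta>))) =
       (dminus ^^ length (\<alpha> @ \<beta>)) (word_fn x (Suc d # \<eta> @ \<alpha> @ \<beta>))"
      by (simp add: la funpow_add)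
    finally have 1: "(dminus ^^ r) (Phi x ((dminus ^^ length \<beta>) ?W)) c = t powi (- int (count_list \<beta> d)) *
       (dminus ^^ length (\<alpha> @ \<beta>)) (word_fn x (Suc d # \<eta> @ \<alpha> @ \<beta>)) c" .
    \<comment> \<open>The negative exponent for \<beta> cancels the last term of
      \<open>word_stat_raise\<close>.\<close>
    have "word_stat (\<eta> @ \<Lambda>) + - int (count_list \<beta> d) =
      int (length (filter (\<lambda>b. b \<le> d) \<eta>) + count_list \<alpha> d) + word_stat (Suc d # \<eta> @ \<alpha> @ \<beta>)"
      unfolding \<Lambda> using word_stat_raise[OF le, of \<eta>] by simp
    then have "?s * t powi (- int (count_list \<beta> d)) =
      t ^ (length (filter (\<lambda>b. b \<le> d) \<eta>) + count_list \<alpha> d) * t powi word_stat (Suc d # \<eta> @ \<alpha> @ \<beta>)"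
      using t_nonzero by (metis power_int_add power_int_of_nat)
    then show ?thesis
      unfolding state_fn_def \<alpha>_def[symmetric] \<beta>_def[symmetric] d_def[symmetric] la(2)[symmetric] 1
      by (metis (no_types, lifting) append_Cons mult.assoc)
  qed
  show ?thesis
  proof (rule eqvI)
    fix c assume c: "c \<in> tuples (Suc (length \<eta>))"
    show "dplus x (state_fn x \<eta> \<Lambda>) c = state_fn x (1 # \<eta>) \<Lambda> c + (\<Sum>r<length \<Lambda>.
       t ^ (length (filter (\<lambda>b. b \<le> \<Lambda> ! r) \<eta>) + count_list (take r \<Lambda>) (\<Lambda> ! r)) *
       state_fn x (Suc (\<Lambda> ! r) # \<eta>) (take r \<Lambda> @ drop (Suc r) \<Lambda>) c)"
      unfolding eqvD[OF main c] new
      by (intro arg_cong2[where f="(+)"] refl sum.cong att c) auto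
  qed
qed

text \<open>For closed ends in arbitrary order. Linking to any of the m ends of length d gives the
  same function, with the t-integer of m as total weight. This weight is spread again over the
  positions in the given order, now counting equal lengths behind instead of in front, as free cells
  do.\<close>

lemma dplus_state_fn:
  assumes "0 \<notin> set (\<eta> @ \<Lambda>)"
  shows "eqv (Suc (length \<eta>)) (dplus x (state_fn x \<eta> \<Lambda>))
    (\<lambda>c. state_fn x (1 # \<eta>) \<Lambda> c + (\<Sum>r<length \<Lambda>.
       t ^ (length (filter (\<lambda>b. b \<le> \<Lambda> ! r) \<eta>) + count_list (drop (Suc r) \<Lambda>) (\<Lambda> ! r)) *
       state_fn x (Suc (\<Lambda> ! r) # \<eta>) (take r \<Lambda> @ drop (Suc r) \<Lambda>) c))"
proof (rule eqvI)
  fix c assume c: "c \<in> tuples (Suc (length \<eta>))"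
  define M where "M = rev (sort \<Lambda>)"
  have ms: "mset M = mset \<Lambda>" by (simp add: M_def)
  then have SL: "set M = set \<Lambda>" "length M = length \<Lambda>" by (metis set_mset_mset) (metis ms size_mset)
  have sorted: "sorted_wrt (\<ge>) M" by (simp add: M_def sorted_wrt_rev)
  \<comment> \<open>What depends on the chosen length alone: since the order of the closed ends is
    immaterial, it does not matter which end of length d is removed.\<close>
  define f where "f d = t ^ length (filter (\<lambda>b. b \<le> d) \<eta>) * state_fn x (Suc d # \<eta>) (remove1 d \<Lambda>) c" for d
  have f: "t ^ (length (filter (\<lambda>b. b \<le> K ! r) \<eta>) + m) * state_fn x (Suc (K ! r) # \<eta>) (take r K @ drop (Suc r) K) c
      = t ^ m * f (K ! r)" if "mset K = mset \<Lambda>" "r < length K" for K r m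
  proof -
    have K: "K = take r K @ K ! r # drop (Suc r) K" using that(2) by (rule id_take_nth_drop)
    have "mset (take r K @ drop (Suc r) K) = mset (remove1 (K ! r) \<Lambda>)"
      using arg_cong[OF K, of mset] by (simp add: that(1) del: append_take_drop_id)
    moreover have "0 \<notin> set (take r K @ drop (Suc r) K)"
      using assms that by (metis Un_iff in_set_dropD in_set_takeD set_append set_mset_mset)
    ultimately have "eqv (length (Suc (K ! r) # \<eta>)) (state_fn x (Suc (K ! r) # \<eta>) (take r K @ drop (Suc r) K))
       (state_fn x (Suc (K ! r) # \<eta>) (remove1 (K ! r) \<Lambda>))"
      using assms by (intro state_fn_perm) auto
    then show ?thesis using c by (simp add: f_def eqv_def power_add mult.assoc mult.left_commute)
  qed
  have "dplus x (state_fn x \<eta> \<Lambda>) c = dplus x (state_fn x \<eta> M) c"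
    using eqv_dplus[OF state_fn_perm[OF ms[symmetric] assms]] c by (simp add: eqv_def)
  also have "\<dots> = state_fn x (1 # \<eta>) M c + (\<Sum>r<length M. t ^ count_list (take r M) (M ! r) * f (M ! r))"
    using dplus_state_fn_sorted[OF _ sorted, of \<eta> x] assms SL c f[OF ms] by (simp add: eqv_def)
  also have "state_fn x (1 # \<eta>) M c = state_fn x (1 # \<eta>) \<Lambda> c"
    using state_fn_perm[OF ms, of "1 # \<eta>" x] assms SL c by (simp add: eqv_def)
  also have "(\<Sum>r<length M. t ^ count_list (take r M) (M ! r) * f (M ! r)) =
     (\<Sum>d\<in>set M. (\<Sum>j<count_list M d. t ^ j) * f d)"
    by (rule sum_count_take)
  also have "\<dots> = (\<Sum>d\<in>set \<Lambda>. (\<Sum>j<count_list \<Lambda> d. t ^ j) * f d)"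
    using ms SL by (metis (no_types, lifting) count_mset sum.cong)
  also have "\<dots> = (\<Sum>r<length \<Lambda>. t ^ count_list (drop (Suc r) \<Lambda>) (\<Lambda> ! r) * f (\<Lambda> ! r))"
    by (rule sum_count_drop[symmetric])
  finally show "dplus x (state_fn x \<eta> \<Lambda>) c = state_fn x (1 # \<eta>) \<Lambda> c + (\<Sum>r<length \<Lambda>.
       t ^ (length (filter (\<lambda>b. b \<le> \<Lambda> ! r) \<eta>) + count_list (drop (Suc r) \<Lambda>) (\<Lambda> ! r)) *
       state_fn x (Suc (\<Lambda> ! r) # \<eta>) (take r \<Lambda> @ drop (Suc r) \<Lambda>) c)"
    by (simp add: f)
qed

end

section \<open>Exchange of two adjacent variables\<close>

abbreviation adj :: "nat \<Rightarrow> nat \<Rightarrow> nat" where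
  "adj a \<equiv> Transposition.transpose a (Suc a)"

lemma adj_simps [simp]: "adj a a = Suc a" "adj a (Suc a) = a"
  by (auto simp: Transposition.transpose_def)

lemma adj_other: "b \<noteq> a \<Longrightarrow> b \<noteq> Suc a \<Longrightarrow> adj a b = b"
  by (auto simp: Transposition.transpose_def)

lemma inj_adj: "inj (adj a)"
  by (metis injI transpose_involutory)

lemma adj_bij_betw: "1 \<le> a \<Longrightarrow> a < N \<Longrightarrow> adj a ` {1..N} = {1..N}"
  by (rule transpose_image_eq) auto

lemma map_adj_id: "a \<notin> set c \<Longrightarrow> Suc a \<notin> set c \<Longrightarrow> map (adj a) c = c"
  by (rule map_idI) (metis adj_other)

lemma map_adj_adj [simp]: "map (adj a) (map (adj a) c) = c"
  by (simp add: comp_def)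

fun precedes :: "'b \<Rightarrow> 'b \<Rightarrow> 'b list \<Rightarrow> bool" where
  "precedes a b [] = False"
| "precedes a b (y # r) = (y = a \<or> y \<noteq> b \<and> precedes a b r)"

lemma precedes_snoc:
  "a \<noteq> b \<Longrightarrow> precedes a b (r @ [z]) \<longleftrightarrow> precedes a b r \<or> (a \<notin> set r \<and> b \<notin> set r \<and> z = a)"
  by (induction r) auto

lemma precedes_only: "a \<in> set c \<Longrightarrow> b \<notin> set c \<Longrightarrow> precedes a b c"
  by (induction c) auto

lemma precedes_map_adj: "precedes (adj a b) (adj a d) (map (adj a) c) = precedes b d c"
  by (induction c) (auto simp: inj_eq[OF inj_adj])

lemma precedes_append:
  "a \<notin> set r \<Longrightarrow> b \<notin> set r \<Longrightarrow> precedes a b (r @ c) = precedes a b c"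
  by (induction r) auto

context colour_tuples
begin

text \<open>
  With denominators cleared, this is \<open>F (s\<^sub>a c) = T\<^sub>a (F c)\<close> for the Demazure--Lusztig operator \<open>T\<^sub>a\<close>,
  where the colours that do not occur in \<open>c\<close> count as older than those that do.
\<close>

definition equivariant :: "nat \<Rightarrow> ((nat \<Rightarrow> 'a) \<Rightarrow> nat list \<Rightarrow> 'a) \<Rightarrow> bool" where
  "equivariant k F \<longleftrightarrow> (\<forall>x a c. inj_on x {1..N} \<and> 1 \<le> a \<and> a < N \<and> c \<in> tuples k \<longrightarrow>
     (a \<notin> set c \<and> Suc a \<notin> set c \<longrightarrow> F (x \<circ> adj a) c = F x c) \<and>
     (precedes a (Suc a) c \<longrightarrow> (x a - x (Suc a)) * F x (map (adj a) c) =
        (1 - t) * x (Suc a) * F x c + (t * x a - x (Suc a)) * F (x \<circ> adj a) c))"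

lemma equivariant_neither:
  "equivariant k F \<Longrightarrow> inj_on x {1..N} \<Longrightarrow> 1 \<le> a \<Longrightarrow> a < N \<Longrightarrow> c \<in> tuples k \<Longrightarrow>
   a \<notin> set c \<Longrightarrow> Suc a \<notin> set c \<Longrightarrow> F (x \<circ> adj a) c = F x c"
  by (auto simp: equivariant_def)

lemma equivariant_precedes:
  "equivariant k F \<Longrightarrow> inj_on x {1..N} \<Longrightarrow> 1 \<le> a \<Longrightarrow> a < N \<Longrightarrow> c \<in> tuples k \<Longrightarrow>
   precedes a (Suc a) c \<Longrightarrow> (x a - x (Suc a)) * F x (map (adj a) c) =
        (1 - t) * x (Suc a) * F x c + (t * x a - x (Suc a)) * F (x \<circ> adj a) c"
  by (auto simp: equivariant_def)

lemma inj_on_comp_adj: "inj_on x {1..N} \<Longrightarrow> 1 \<le> a \<Longrightarrow> a < N \<Longrightarrow> inj_on (x \<circ> adj a) {1..N}"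
  by (rule comp_inj_on) (auto simp: adj_bij_betw intro: inj_on_subset[OF inj_adj])

lemma inj_on_neq: "inj_on x {1..N} \<Longrightarrow> 1 \<le> a \<Longrightarrow> a < N \<Longrightarrow> x a \<noteq> x (Suc a)"
  using inj_onD[of x "{1..N}" a "Suc a"] by auto

lemma comp_adj_adj [simp]: "(x \<circ> adj a) \<circ> adj a = x"
  by (simp add: comp_assoc)

lemma map_adj_tuples:
  assumes "c \<in> tuples k" "1 \<le> a" "a < N"
  shows "map (adj a) c \<in> tuples k"
proof -
  have "adj a ` set c \<subseteq> adj a ` {1..N}" using assms by (intro image_mono) (auto simp: tuples_def)
  then have "adj a ` set c \<subseteq> {1..N}" using adj_bij_betw assms by simp
  then show ?thesis using assms
    by (auto simp: tuples_def distinct_map intro: inj_on_subset[OF inj_adj])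
qed

text \<open>The inverse Demazure--Lusztig relation, for \<open>Suc a\<close> as the newer of the two
  colours. The relation at the exchanged tuple is taken for x and for x with the two variables
  exchanged, and the value for the latter at that tuple is eliminated.\<close>

lemma equivariant_precedes_inv:
  assumes "equivariant k F" "inj_on x {1..N}" "1 \<le> a" "a < N" "c \<in> tuples k" "precedes (Suc a) a c"
  shows "t * (x a - x (Suc a)) * F x (map (adj a) c) =
        (1 - t) * x a * F x c + (t * x a - x (Suc a)) * F (x \<circ> adj a) c"
proof -
  let ?c = "map (adj a) c"
  have c: "?c \<in> tuples k" using map_adj_tuples assms by auto
  have p: "precedes a (Suc a) ?c" using assms(6) precedes_map_adj[of a "Suc a" a c] by simp
  have 1: "(x a - x (Suc a)) * F x c = (1 - t) * x (Suc a) * F x ?c + (t * x a - x (Suc a)) * F (x \<circ> adj a) ?c"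
    using equivariant_precedes[OF assms(1-4) c p] by simp
  have 2: "(x (Suc a) - x a) * F (x \<circ> adj a) c = (1 - t) * x a * F (x \<circ> adj a) ?c + (t * x (Suc a) - x a) * F x ?c"
    using equivariant_precedes[OF assms(1) inj_on_comp_adj[OF assms(2-4)] assms(3,4) c p] by simp
  let ?D = "x a - x (Suc a)"
  have "?D * ((1 - t) * x a * F x c + (t * x a - x (Suc a)) * F (x \<circ> adj a) c)
    = (1 - t) * x a * (?D * F x c) - (t * x a - x (Suc a)) * ((x (Suc a) - x a) * F (x \<circ> adj a) c)"
    by algebra
  also have "\<dots> = ?D * (t * ?D * F x ?c)"
    unfolding 1 2 by algebra
  finally show ?thesis using inj_on_neq[OF assms(2-4)] by simp
qed

lemma equivariant_cong:
  assumes "equivariant k F" "\<And>x. eqv k (F x) (G x)"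
  shows "equivariant k G"
  unfolding equivariant_def
  using assms map_adj_tuples by (auto simp: equivariant_def eqv_def)

lemma equivariant_diff:
  assumes "equivariant k F" "equivariant k G"
  shows "equivariant k (\<lambda>x c. F x c - G x c)"
  unfolding equivariant_def
proof (intro allI impI conjI; elim conjE)
  fix x :: "nat \<Rightarrow> 'a" and a c
  assume a: "inj_on x {1..N}" "1 \<le> a" "a < N" "c \<in> tuples k"
  { assume "a \<notin> set c" "Suc a \<notin> set c"
    then show "F (x \<circ> adj a) c - G (x \<circ> adj a) c = F x c - G x c"
      using assms[THEN equivariant_neither, OF a] by simp }
  { assume "precedes a (Suc a) c"
    then show "(x a - x (Suc a)) * (F x (map (adj a) c) - G x (map (adj a) c)) =
        (1 - t) * x (Suc a) * (F x c - G x c) + (t * x a - x (Suc a)) * (F (x \<circ> adj a) c - G (x \<circ> adj a) c)"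
      using equivariant_precedes[OF assms(1) a] equivariant_precedes[OF assms(2) a] by algebra }
qed

lemma compl_image_adj:
  assumes "1 \<le> a" "a < N"
  shows "adj a ` ({1..N} - set c) = {1..N} - set (map (adj a) c)"
  using assms by (simp add: image_set_diff[OF inj_adj] adj_bij_betw)

text \<open>If neither colour occurs in c, the summands for b = a and b = \<open>Suc a\<close> are
  the only ones that are not symmetric by themselves, and the relations for both orders of the
  variables show that their sum is. If a precedes, it still does so in every c @ [b], and the sum is
  reindexed by \<open>adj a\<close>.\<close>

lemma equivariant_dminus:
  assumes F: "equivariant (Suc k) F"
  shows "equivariant k (\<lambda>x. dminus (F x))"
  unfolding equivariant_def
proof (intro allI impI conjI; elim conjE)
  fix x :: "nat \<Rightarrow> 'a" and a c
  assume a: "inj_on x {1..N}" "1 \<le> a" "a < N" and c: "c \<in> tuples k"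
  let ?S = "{1..N} - set c"
  have t: "c @ [b] \<in> tuples (Suc k)" if "b \<in> ?S" for b using that c by (simp add: tuples_snoc)
  { assume n: "a \<notin> set c" "Suc a \<notin> set c"
    have S: "?S = insert a (insert (Suc a) (?S - {a, Suc a}))" using n a by auto
    have 1: "dminus (F y) c = (F y (c @ [a]) + F y (c @ [Suc a])) + (\<Sum>b\<in>?S - {a, Suc a}. F y (c @ [b]))" for y
      unfolding dminus_def by (subst S, subst sum.insert, simp, simp, subst sum.insert) (simp_all add: add.assoc)
    have 2: "(\<Sum>b\<in>?S - {a, Suc a}. F (x \<circ> adj a) (c @ [b])) = (\<Sum>b\<in>?S - {a, Suc a}. F x (c @ [b]))"
      using n by (intro sum.cong refl equivariant_neither[OF F a] t) auto
    have p: "precedes a (Suc a) (c @ [a])" using n by (simp add: precedes_snoc)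
    have ta: "c @ [a] \<in> tuples (Suc k)" using t n a by auto
    have m: "map (adj a) (c @ [a]) = c @ [Suc a]" using n by (simp add: map_adj_id)
    let ?D = "x a - x (Suc a)"
    have 3: "?D * F x (c @ [Suc a]) =
        (1 - t) * x (Suc a) * F x (c @ [a]) + (t * x a - x (Suc a)) * F (x \<circ> adj a) (c @ [a])"
      using equivariant_precedes[OF F a ta p] unfolding m .
    have 4: "- ?D * F (x \<circ> adj a) (c @ [Suc a]) =
        (1 - t) * x a * F (x \<circ> adj a) (c @ [a]) + (t * x (Suc a) - x a) * F x (c @ [a])"
      using equivariant_precedes[OF F inj_on_comp_adj[OF a] a(2,3) ta p] unfolding m by simp
    have "?D * (F (x \<circ> adj a) (c @ [a]) + F (x \<circ> adj a) (c @ [Suc a])) = ?D * (F x (c @ [a]) + F x (c @ [Suc a]))"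
      using 3 4 by algebra
    then have "F (x \<circ> adj a) (c @ [a]) + F (x \<circ> adj a) (c @ [Suc a]) = F x (c @ [a]) + F x (c @ [Suc a])"
      using inj_on_neq[OF a] by simp
    then show "dminus (F (x \<circ> adj a)) c = dminus (F x) c" unfolding 1 2 by simp }
  { assume p: "precedes a (Suc a) c"
    have "dminus (F x) (map (adj a) c) = (\<Sum>b\<in>?S. F x (map (adj a) (c @ [b])))"
      unfolding dminus_def compl_image_adj[OF a(2,3), symmetric]
      by (subst sum.reindex) (auto intro: inj_on_subset[OF inj_adj])
    then have "(x a - x (Suc a)) * dminus (F x) (map (adj a) c) = (\<Sum>b\<in>?S. (x a - x (Suc a)) * F x (map (adj a) (c @ [b])))"
      by (simp add: sum_distrib_left)
    also have "\<dots> = (\<Sum>b\<in>?S. (1 - t) * x (Suc a) * F x (c @ [b]) + (t * x a - x (Suc a)) * F (x \<circ> adj a) (c @ [b]))"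
      using p by (intro sum.cong refl equivariant_precedes[OF F a] t) (auto simp: precedes_snoc)
    also have "\<dots> = (1 - t) * x (Suc a) * dminus (F x) c + (t * x a - x (Suc a)) * dminus (F (x \<circ> adj a)) c"
      by (simp add: sum.distrib sum_distrib_left dminus_def)
    finally show "(x a - x (Suc a)) * dminus (F x) (map (adj a) c) = \<dots>" . }
qed

lemma prod_asc_wt_adj:
  assumes "y \<noteq> a" "y \<noteq> Suc a"
  shows "(\<Prod>b\<in>set (map (adj a) r). asc_wt b y) = (\<Prod>b\<in>set r. asc_wt b y)"
proof -
  have "asc_wt (adj a b) y = asc_wt b y" for b
    using assms by (cases "b = a \<or> b = Suc a") (auto simp: asc_wt_def adj_other)
  then show ?thesis by (simp add: prod.reindex[OF inj_on_subset[OF inj_adj]])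
qed

lemma prod_asc_wt_adj_Suc:
  assumes "a \<notin> set r"
  shows "(\<Prod>b\<in>set (map (adj a) r). asc_wt b (Suc a)) = (if Suc a \<in> set r then t else 1) * (\<Prod>b\<in>set r. asc_wt b a)"
proof -
  have "asc_wt (adj a b) (Suc a) = (if b = Suc a then t else 1) * asc_wt b a" if "b \<in> set r" for b
    using assms that by (cases "b = a \<or> b = Suc a") (auto simp: asc_wt_def adj_other)
  then have "(\<Prod>b\<in>set (map (adj a) r). asc_wt b (Suc a)) = (\<Prod>b\<in>set r. (if b = Suc a then t else 1) * asc_wt b a)"
    by (simp add: prod.reindex[OF inj_on_subset[OF inj_adj]])
  then show ?thesis by (simp add: prod.distrib)
qed

lemma equivariant_dplus:
  assumes F: "equivariant k F"
  shows "equivariant (Suc k) (\<lambda>x. dplus x (F x))"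
  unfolding equivariant_def
proof (intro allI impI conjI; elim conjE)
  fix x :: "nat \<Rightarrow> 'a" and a c
  assume a: "inj_on x {1..N}" "1 \<le> a" "a < N" and "c \<in> tuples (Suc k)"
  then obtain y r where c: "c = y # r" and r: "r \<in> tuples k" "y \<in> {1..N} - set r" by (elim tuples_SucE)
  { assume n: "a \<notin> set c" "Suc a \<notin> set c"
    then have "(x \<circ> adj a) y = x y" by (simp add: c adj_other)
    then show "dplus (x \<circ> adj a) (F (x \<circ> adj a)) c = dplus x (F x) c"
      using equivariant_neither[OF F a r(1)] n by (simp add: c dplus_Cons new_wt_def) }
  { assume p: "precedes a (Suc a) c"
    show "(x a - x (Suc a)) * dplus x (F x) (map (adj a) c) =
      (1 - t) * x (Suc a) * dplus x (F x) c + (t * x a - x (Suc a)) * dplus (x \<circ> adj a) (F (x \<circ> adj a)) c"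
    proof (cases "y = a")
      case False
      then have y: "y \<noteq> a" "y \<noteq> Suc a" and p': "precedes a (Suc a) r" using p by (auto simp: c)
      define P where "P = x y * (\<Prod>b\<in>set r. asc_wt b y)"
      have w: "new_wt x y r = P" "new_wt (x \<circ> adj a) y r = P" "new_wt x y (map (adj a) r) = P"
        using y prod_asc_wt_adj[OF y, of r] by (auto simp: new_wt_def P_def adj_other)
      show ?thesis
        using arg_cong[OF equivariant_precedes[OF F a r(1) p'], of "(*) P"] y
        by (simp add: c dplus_Cons w adj_other algebra_simps)
    next
      case True
      then have ar: "a \<notin> set r" using r by auto
      define P where "P = (\<Prod>b\<in>set r. asc_wt b a)"
      have w: "new_wt x a r = x a * P" "new_wt (x \<circ> adj a) a r = x (Suc a) * P"
        "new_wt x (Suc a) (map (adj a) r) = x (Suc a) * ((if Suc a \<in> set r then t else 1) * P)"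
        using prod_asc_wt_adj_Suc[OF ar] by (auto simp: new_wt_def P_def)
      show ?thesis
      proof (cases "Suc a \<in> set r")
        case False
        have "new_wt x (Suc a) r = x (Suc a) * P"
          using w(3) False by (simp add: map_adj_id ar)
        then show ?thesis
          using equivariant_neither[OF F a r(1) ar False] False
          by (simp add: c True dplus_Cons w map_adj_id ar algebra_simps)
      next
        case mem: True
        \<comment> \<open>After the new vertex of colour a is taken away, \<open>Suc a\<close> is
          present and a is missing, so the roles are reversed and the inverse relation
          applies.\<close>
        have "t * (x a - x (Suc a)) * F x (map (adj a) r) =
            (1 - t) * x a * F x r + (t * x a - x (Suc a)) * F (x \<circ> adj a) r"
          by (rule equivariant_precedes_inv[OF F a r(1)]) (rule precedes_only[OF mem ar])
        from arg_cong[OF this, of "(*) (P * x (Suc a))"] show ?thesis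
          by (simp add: c True dplus_Cons w mem algebra_simps)
      qed
    qed }
qed

text \<open>\<open>Phi\<close> is the commutator of \<open>dplus\<close> and \<open>dminus\<close>,
  so no further computation is needed.\<close>

lemma equivariant_Phi:
  assumes "equivariant (Suc k) F"
  shows "equivariant (Suc k) (\<lambda>x. Phi x (F x))"
proof (rule equivariant_cong)
  show "equivariant (Suc k) (\<lambda>x c. dplus x (dminus (F x)) c - dminus (dplus x (F x)) c)"
    by (intro equivariant_diff equivariant_dplus equivariant_dminus assms)
  show "eqv (Suc k) (\<lambda>c. dplus x (dminus (F x)) c - dminus (dplus x (F x)) c) (Phi x (F x))" for x
    using dplus_dminus[of k x "F x"] by (simp add: eqv_def)
qed

lemma equivariant_word_fn: "equivariant (length \<rho>) (\<lambda>x. word_fn x \<rho>)"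
\<comment> \<open>The recursion carries x as a parameter, whereas the claim concerns all x at once;
  any value instantiates the induction rule.\<close>
proof (induction "undefined :: nat \<Rightarrow> 'a" \<rho> rule: word_fn.induct)
  case 1
  show ?case by (simp add: equivariant_def tuples_def)
next
  case (2 \<rho>)
  show ?case by (simp add: equivariant_def)
next
  case (3 \<rho>)
  then show ?case by (simp add: equivariant_dplus)
next
  case (4 d \<rho>)
  then show ?case by (simp add: equivariant_Phi)
qed

lemma equivariant_dminus_pow:
  "equivariant (k + l) F \<Longrightarrow> equivariant k (\<lambda>x. (dminus ^^ l) (F x))"
proof (induction l arbitrary: k)
  case (Suc l)
  then show ?case using Suc.IH[of "Suc k"] equivariant_dminus by auto
qed simp

end

section \<open>Values at the tuple (1, ..., k)\<close>

definition word_mono :: "(nat \<Rightarrow> 'a::comm_monoid_mult) \<Rightarrow> nat list \<Rightarrow> nat list \<Rightarrow> 'a" where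
  "word_mono x c \<rho> = prod_list (map2 (\<lambda>y p. x y ^ p) c \<rho>)"

lemma word_mono_Nil [simp]: "word_mono x [] [] = 1"
  by (simp add: word_mono_def)

lemma word_mono_Cons [simp]: "word_mono x (y # c) (p # \<rho>) = x y ^ p * word_mono x c \<rho>"
  by (simp add: word_mono_def)

lemma word_mono_append:
  "length c = length \<rho> \<Longrightarrow> word_mono x (c @ c') (\<rho> @ \<rho>') = word_mono x c \<rho> * word_mono x c' \<rho>'"
  by (simp add: word_mono_def)

lemma word_mono_comp_adj:
  "a \<notin> set c \<Longrightarrow> Suc a \<notin> set c \<Longrightarrow> word_mono (x \<circ> adj a) c \<rho> = word_mono x c \<rho>"
  unfolding word_mono_def
  by (rule arg_cong[where f = prod_list], rule map_cong)
     (auto dest!: set_zip_leftD simp: Transposition.transpose_def)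

context colour_tuples
begin

text \<open>Injectivity of x is what permits division by the differences of variables.\<close>

definition value_at :: "nat list \<Rightarrow> nat list \<Rightarrow> int \<Rightarrow> bool" where
  "value_at \<rho> c e \<longleftrightarrow> (\<forall>x. inj_on x {1..N} \<longrightarrow> word_fn x \<rho> c = t powi e * word_mono x c \<rho>)"

text \<open>A Demazure--Lusztig operator multiplies the product of the p-th powers of two
  neighbouring variables by \<open>t\<close>, and it exchanges exponents p' + 1 and p' without a
  coefficient. A larger difference would in general produce further monomials.\<close>

lemma value_at_swap:
  assumes v: "value_at (\<sigma>\<^sub>1 @ p # \<sigma>\<^sub>2 @ p' # \<sigma>\<^sub>3) (\<gamma>\<^sub>1 @ a # \<gamma>\<^sub>2 @ Suc a # \<gamma>\<^sub>3) e"
    and len: "length \<gamma>\<^sub>1 = length \<sigma>\<^sub>1" "length \<gamma>\<^sub>2 = length \<sigma>\<^sub>2" "length \<gamma>\<^sub>3 = length \<sigma>\<^sub>3"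
    and c: "\<gamma>\<^sub>1 @ a # \<gamma>\<^sub>2 @ Suc a # \<gamma>\<^sub>3 \<in> tuples k"
    and p: "p = p' \<or> p = Suc p'"
  shows "value_at (\<sigma>\<^sub>1 @ p # \<sigma>\<^sub>2 @ p' # \<sigma>\<^sub>3) (\<gamma>\<^sub>1 @ Suc a # \<gamma>\<^sub>2 @ a # \<gamma>\<^sub>3) (e + (if p = p' then 1 else 0))"
  unfolding value_at_def
proof (intro allI impI)
  fix x :: "nat \<Rightarrow> 'a" assume x: "inj_on x {1..N}"
  let ?c = "\<gamma>\<^sub>1 @ a # \<gamma>\<^sub>2 @ Suc a # \<gamma>\<^sub>3" and ?\<rho> = "\<sigma>\<^sub>1 @ p # \<sigma>\<^sub>2 @ p' # \<sigma>\<^sub>3"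
  let ?c' = "\<gamma>\<^sub>1 @ Suc a # \<gamma>\<^sub>2 @ a # \<gamma>\<^sub>3"
  have a: "1 \<le> a" "a < N" and d: "a \<notin> set \<gamma>\<^sub>1" "Suc a \<notin> set \<gamma>\<^sub>1" "a \<notin> set \<gamma>\<^sub>2" "Suc a \<notin> set \<gamma>\<^sub>2"
    "a \<notin> set \<gamma>\<^sub>3" "Suc a \<notin> set \<gamma>\<^sub>3" using c by (auto simp: tuples_def)
  have k: "k = length ?\<rho>" using c len by (simp add: tuples_def)
  have pr: "precedes a (Suc a) ?c" using d by (simp add: precedes_append)
  have m: "map (adj a) ?c = ?c'" using d by (simp add: map_adj_id)
  define M where "M = word_mono x \<gamma>\<^sub>1 \<sigma>\<^sub>1 * (word_mono x \<gamma>\<^sub>2 \<sigma>\<^sub>2 * word_mono x \<gamma>\<^sub>3 \<sigma>\<^sub>3)"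
  have eq: "(x a - x (Suc a)) * word_fn x ?\<rho> ?c' = (1 - t) * x (Suc a) * word_fn x ?\<rho> ?c +
     (t * x a - x (Suc a)) * word_fn (x \<circ> adj a) ?\<rho> ?c"
    using equivariant_precedes[OF equivariant_word_fn x a c[unfolded k] pr] unfolding m .
  have v1: "word_fn x ?\<rho> ?c = t powi e * (x a ^ p * x (Suc a) ^ p' * M)"
    using v x len by (simp add: value_at_def word_mono_append M_def algebra_simps)
  have v2: "word_fn (x \<circ> adj a) ?\<rho> ?c = t powi e * (x (Suc a) ^ p * x a ^ p' * M)"
    using v inj_on_comp_adj[OF x a] len d
    by (simp add: value_at_def word_mono_append word_mono_comp_adj M_def algebra_simps)
  have mono: "word_mono x ?c' ?\<rho> = x (Suc a) ^ p * x a ^ p' * M"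
    using len by (simp add: word_mono_append M_def algebra_simps)
  have ne: "x a - x (Suc a) \<noteq> 0" using inj_on_neq[OF x a] by simp
  show "word_fn x ?\<rho> ?c' = t powi (e + (if p = p' then 1 else 0)) * word_mono x ?c' ?\<rho>"
  proof (cases "p = p'")
    case True
    have "(x a - x (Suc a)) * word_fn x ?\<rho> ?c' = (x a - x (Suc a)) * (t powi e * t * (x (Suc a) ^ p * x a ^ p' * M))"
      unfolding eq[unfolded v1 v2] by (simp add: True algebra_simps)
    with ne have "word_fn x ?\<rho> ?c' = t powi e * t * (x (Suc a) ^ p * x a ^ p' * M)" by simp
    then show ?thesis unfolding mono using t_nonzero True by (simp add: power_int_add)
  next
    case False
    with p have p: "p = Suc p'" by simp
    have "(x a - x (Suc a)) * word_fn x ?\<rho> ?c' = (x a - x (Suc a)) * (t powi e * (x (Suc a) ^ p * x a ^ p' * M))"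
      unfolding eq[unfolded v1 v2] by (simp add: p algebra_simps)
    with ne have "word_fn x ?\<rho> ?c' = t powi e * (x (Suc a) ^ p * x a ^ p' * M)" by simp
    then show ?thesis unfolding mono using False by simp
  qed
qed

text \<open>Each exchange of v with a smaller length is a generator, and at an ascent of the tuple,
  here m < d, a generator is a mere exchange of the two colours.\<close>

lemma word_fn_move_last:
  assumes "0 \<notin> set (\<alpha> @ v # \<beta>)" "\<forall>b\<in>set \<beta>. b < v" "\<gamma> @ m # \<delta> \<in> tuples k" "\<forall>d\<in>set \<delta>. m < d"
    "length \<gamma> = length \<alpha>" "length \<delta> = length \<beta>"
  shows "word_fn x (\<alpha> @ v # \<beta>) (\<gamma> @ m # \<delta>) = word_fn x (\<alpha> @ \<beta> @ [v]) (\<gamma> @ \<delta> @ [m])"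
  using assms
proof (induction \<beta> arbitrary: \<alpha> \<gamma> \<delta>)
  case (Cons b \<beta>)
  then obtain d \<delta>' where \<delta>: "\<delta> = d # \<delta>'" by (cases \<delta>) auto
  have k: "k = length \<alpha> + length \<beta> + 2" using Cons.prems by (simp add: tuples_def)
  have "word_fn x (\<alpha> @ v # b # \<beta>) (\<gamma> @ m # d # \<delta>') = hecke (length \<alpha>) (word_fn x (\<alpha> @ b # v # \<beta>)) (\<gamma> @ m # d # \<delta>')"
    using word_fn_asc[of \<alpha> b v \<beta> x] Cons.prems unfolding eqv_def k[symmetric] \<delta> by auto
  also have "\<dots> = word_fn x (\<alpha> @ b # v # \<beta>) (\<gamma> @ d # m # \<delta>')"
    using Cons.prems swap_adj_append[of \<gamma> m d \<delta>'] by (simp add: hecke_def \<delta> nth_append)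
  also have "\<dots> = word_fn x ((\<alpha> @ [b]) @ \<beta> @ [v]) ((\<gamma> @ [d]) @ \<delta>' @ [m])"
    using Cons.IH[of "\<alpha> @ [b]" "\<gamma> @ [d]" \<delta>'] Cons.prems by (auto simp: \<delta> tuples_def)
  finally show ?case by (simp add: \<delta>)
qed simp

text \<open>In an increasing tuple every vertex has a smaller colour than the older ones, so no edge
  is an ascent.\<close>

lemma word_fn_ones:
  assumes "sorted_wrt (<) c" "set \<rho> \<subseteq> {1}" "length c = length \<rho>"
  shows "word_fn x \<rho> c = word_mono x c \<rho>"
  using assms
proof (induction \<rho> arbitrary: c)
  case (Cons p \<rho>)
  then obtain y r where c: "c = y # r" by (cases c) auto
  have "(\<Prod>b\<in>set r. asc_wt b y) = 1"
    using Cons.prems by (intro prod.neutral) (auto simp: c asc_wt_def)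
  then show ?case using Cons by (auto simp: c dplus_Cons new_wt_def)
qed simp

lemma word_stat_ones: "set \<rho> \<subseteq> {1} \<Longrightarrow> word_stat \<rho> = 0"
  by (induction \<rho>) (auto simp: sum_list_pair_stat_1[unfolded One_nat_def] subset_eq)

text \<open>At (1, ..., l) the newest vertex has the smallest colour, so its link forces b = 1. The
  value is therefore x 1 times that of a word in which the first part d + 1 is replaced by d at the
  end, with colour 1 there. Sorting d into its place gives \<nu>, whose value at (1, ..., l) is
  known by induction on the sum. The tuples still differ by carrying colour 1 to the place of d; on
  the way it meets only parts d and d + 1, the two cases of \<open>value_at_swap\<close>.\<close>

lemma value_at_sorted:
  assumes "sorted_wrt (\<ge>) \<mu>" "0 \<notin> set \<mu>" "length \<mu> \<le> N"
  shows "value_at \<mu> [1..<Suc (length \<mu>)] (- word_stat \<mu>)"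
  using assms
proof (induction "sum_list \<mu>" arbitrary: \<mu> rule: less_induct)
  case less
  show ?case
  proof (cases "set \<mu> \<subseteq> {1}")
    case True
    have "word_fn x \<mu> [1..<Suc (length \<mu>)] = word_mono x [1..<Suc (length \<mu>)] \<mu>" for x
      by (rule word_fn_ones) (use True in \<open>simp_all add: sorted_wrt_upt del: upt_Suc\<close>)
    then show ?thesis unfolding value_at_def using True by (simp add: word_stat_ones)
  next
    case False
    then obtain m \<mu>' where \<mu>: "\<mu> = m # \<mu>'" by (cases \<mu>) auto
    have "m \<noteq> 0" using less.prems by (auto simp: \<mu>)
    moreover have "m \<noteq> 1"
    proof
      assume "m = 1"
      moreover have "b = 1" if "b \<in> set \<mu>'" for b
      proof -
        have "b \<le> 1" using less.prems that \<open>m = 1\<close> by (auto simp: \<mu>)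
        moreover have "b \<noteq> 0" using less.prems that by (metis \<mu> list.set_intros(2))
        ultimately show ?thesis by simp
      qed
      ultimately show False using False by (auto simp: \<mu>)
    qed
    ultimately obtain d' where d': "m = Suc (Suc d')" by (metis One_nat_def not0_implies_Suc)
    define d where "d = Suc d'"
    have m: "m = Suc d" by (simp add: d' d_def)
    define \<alpha> \<beta> where "\<alpha> = takeWhile (\<lambda>b. d \<le> b) \<mu>'" and "\<beta> = dropWhile (\<lambda>b. d \<le> b) \<mu>'"
    have \<mu>': "\<mu>' = \<alpha> @ \<beta>" by (simp add: \<alpha>_def \<beta>_def)
    have s: "sorted_wrt (\<ge>) \<alpha>" "sorted_wrt (\<ge>) \<beta>" "\<forall>a\<in>set \<alpha>. a \<le> Suc d"
      "\<forall>a\<in>set \<alpha>. \<forall>b\<in>set \<beta>. b \<le> a"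
      using less.prems by (auto simp: \<mu> \<mu>' m sorted_wrt_append)
    have \<alpha>: "\<forall>a\<in>set \<alpha>. d \<le> a" by (auto simp: \<alpha>_def dest: set_takeWhileD)
    have \<beta>: "\<forall>b\<in>set \<beta>. b < d"
    proof (cases \<beta>)
      case (Cons b \<beta>')
      then have "\<not> d \<le> b" by (metis \<beta>_def hd_dropWhile list.discI list.sel(1))
      then show ?thesis using s(2) by (auto simp: Cons)
    qed simp
    define \<nu> where "\<nu> = \<alpha> @ d # \<beta>"
    define j l where "j = length \<alpha>" and "l = length \<mu>"
    have l: "l = Suc (j + length \<beta>)" by (simp add: l_def \<mu> \<mu>' j_def)
    have len\<nu>: "length \<nu> = l" by (simp add: \<nu>_def l j_def)
    have lN: "l \<le> N" using less.prems by (simp add: l_def)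
    have "value_at \<nu> [1..<Suc (length \<nu>)] (- word_stat \<nu>)"
    proof (rule less.hyps)
      show "sum_list \<nu> < sum_list \<mu>" by (simp add: \<nu>_def \<mu> \<mu>' m)
      show "sorted_wrt (\<ge>) \<nu>" using s \<alpha> \<beta> by (auto simp: \<nu>_def sorted_wrt_append intro: less_imp_le)
      show "0 \<notin> set \<nu>" using less.prems by (auto simp: \<nu>_def \<mu> \<mu>' d_def)
      show "length \<nu> \<le> N" using lN len\<nu> by simp
    qed
    then have start: "value_at \<nu> [1..<Suc l] (- word_stat \<nu>)" by (simp add: len\<nu>)
    let ?rest = "[j + 2..<Suc l]"
    \<comment> \<open>For a = j this is (1, ..., l), for a = 0 colour 1 stands behind j greater
      colours. Going from a + 1 down to a exchanges the colours a + 1 and a + 2.\<close>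
    let ?c = "\<lambda>a. [1..<Suc a] @ [a + 2..<j + 2] @ Suc a # ?rest"
    have tup: "?c a \<in> tuples l" if "a \<le> j" for a
      using that l lN by (auto simp: tuples_def simp del: upt_Suc)
    have "value_at \<nu> (?c a) (- word_stat \<nu> + int (count_list (drop a \<alpha>) d))" if "a \<le> j" for a
      using that
    proof (induction a rule: inc_induct)
      case base
      have "[1..<Suc l] = [1..<Suc j] @ Suc j # ?rest"
        using upt_add_eq_append[of 1 "Suc j" "l - j"] upt_conv_Cons[of "Suc j" "Suc l"] l by (simp del: upt_Suc)
      then show ?case using start by (simp add: j_def)
    next
      case (step a)
      have \<alpha>s: "\<alpha> = take a \<alpha> @ \<alpha> ! a # drop (Suc a) \<alpha>"
        using step by (simp add: j_def id_take_nth_drop)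
      have \<nu>s: "\<nu> = take a \<alpha> @ \<alpha> ! a # drop (Suc a) \<alpha> @ d # \<beta>"
        unfolding \<nu>_def by (subst \<alpha>s) simp
      have da: "drop a \<alpha> = \<alpha> ! a # drop (Suc a) \<alpha>" using step by (simp add: j_def Cons_nth_drop_Suc)
      have u1: "[1..<Suc (Suc a)] = [1..<Suc a] @ [Suc a]" by simp
      have u2: "[a + 2..<j + 2] = Suc (Suc a) # [Suc a + 2..<j + 2]"
        using step by (simp add: upt_conv_Cons del: upt_Suc)
      have c1: "?c (Suc a) = [1..<Suc a] @ Suc a # [Suc a + 2..<j + 2] @ Suc (Suc a) # ?rest"
        by (simp only: u1 append_assoc append_Cons append_Nil)
      have c2: "?c a = [1..<Suc a] @ Suc (Suc a) # [Suc a + 2..<j + 2] @ Suc a # ?rest"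
        by (simp only: u2 append_Cons)
      have e: "int (count_list (drop a \<alpha>) d) = int (count_list (drop (Suc a) \<alpha>) d) + (if \<alpha> ! a = d then 1 else 0)"
        by (simp add: da)
      have mem: "\<alpha> ! a \<in> set \<alpha>" using step by (simp add: j_def)
      have "value_at (take a \<alpha> @ \<alpha> ! a # drop (Suc a) \<alpha> @ d # \<beta>)
        ([1..<Suc a] @ Suc (Suc a) # [Suc a + 2..<j + 2] @ Suc a # ?rest)
        ((- word_stat \<nu> + int (count_list (drop (Suc a) \<alpha>) d)) + (if \<alpha> ! a = d then 1 else 0))"
      proof (rule value_at_swap)
        show "value_at (take a \<alpha> @ \<alpha> ! a # drop (Suc a) \<alpha> @ d # \<beta>)
          ([1..<Suc a] @ Suc a # [Suc a + 2..<j + 2] @ Suc (Suc a) # ?rest)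
          (- word_stat \<nu> + int (count_list (drop (Suc a) \<alpha>) d))"
          using step.IH unfolding c1 \<nu>s[symmetric] .
        show "[1..<Suc a] @ Suc a # [Suc a + 2..<j + 2] @ Suc (Suc a) # ?rest \<in> tuples l"
          using tup[of "Suc a"] step unfolding c1 by simp
        show "\<alpha> ! a = d \<or> \<alpha> ! a = Suc d" using mem \<alpha> s(3) by (metis le_SucE le_antisym)
      qed (use step l in \<open>auto simp: j_def simp del: upt_Suc\<close>)
      then show ?case unfolding c2 \<nu>s[symmetric] e by (simp only: add.assoc)
    qed
    from this[of 0] have val: "value_at \<nu> ([2..<j + 2] @ 1 # ?rest) (- word_stat \<nu> + int (count_list \<alpha> d))"
      by (simp add: numeral_2_eq_2 del: upt_Suc)
    have ws: "- word_stat \<nu> + int (count_list \<alpha> d) = - word_stat \<mu>"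
    proof -
      have "count_list \<beta> d = 0" "\<forall>b\<in>set \<beta>. b \<le> d" using \<beta> by (auto simp: count_list_0_iff)
      then show ?thesis
        using word_stat_raise[of \<alpha> d \<beta> "[]"] \<alpha> \<beta> by (auto simp: \<nu>_def \<mu> \<mu>' m)
    qed
    have up: "[1..<Suc l] = 1 # [2..<j + 2] @ ?rest"
      using upt_conv_Cons[of 1 "Suc l"] upt_add_eq_append[of 2 "j + 2" "l - Suc j"] l by (simp add: numeral_2_eq_2 del: upt_Suc)
    have tup0: "[2..<j + 2] @ 1 # ?rest \<in> tuples l"
      using tup[of 0] by (simp add: numeral_2_eq_2 del: upt_Suc)
    show ?thesis unfolding value_at_def
    proof (intro allI impI)
      fix x :: "nat \<Rightarrow> 'a" assume x: "inj_on x {1..N}"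
      let ?r = "[2..<j + 2] @ ?rest"
      have w: "new_wt x 1 ?r = x 1"
        unfolding new_wt_def by (subst prod.neutral) (auto simp: asc_wt_def)
      have "word_fn x \<mu> [1..<Suc l] = x 1 * (\<Sum>b\<in>{1..N} - set ?r. link b 1 * word_fn x (\<mu>' @ [d]) (?r @ [b]))"
        unfolding up using w by (simp add: \<mu> d' d_def Phi_Cons)
      \<comment> \<open>No colour is below 1, so \<open>link b 1\<close> vanishes unless b =
        1.\<close>
      also have "(\<Sum>b\<in>{1..N} - set ?r. link b 1 * word_fn x (\<mu>' @ [d]) (?r @ [b])) =
         (\<Sum>b\<in>{1}. link b 1 * word_fn x (\<mu>' @ [d]) (?r @ [b]))"
        using l lN by (intro sum.mono_neutral_right) (auto simp: link_def)
      also have "\<dots> = word_fn x (\<alpha> @ \<beta> @ [d]) ([2..<j + 2] @ ?rest @ [1])"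
        by (simp add: link_def \<mu>')
      also have "\<dots> = word_fn x \<nu> ([2..<j + 2] @ 1 # ?rest)"
        unfolding \<nu>_def using tup0 less.prems \<beta> l
        by (intro word_fn_move_last[symmetric, where k = l]) (auto simp: \<mu> \<mu>' d_def j_def simp del: upt_Suc)
      also have "\<dots> = t powi (- word_stat \<mu>) * word_mono x ([2..<j + 2] @ 1 # ?rest) \<nu>"
        using val x unfolding ws value_at_def by blast
      also have "x 1 * \<dots> = t powi (- word_stat \<mu>) * word_mono x [1..<Suc l] \<mu>"
      proof -
        have len: "length [2..<j + 2] = length \<alpha>" by (simp only: j_def length_upt diff_add_inverse2)
        show ?thesis unfolding up \<nu>_def \<mu> \<mu>' m word_mono_Cons
          by (simp only: word_mono_append[OF len] word_mono_Cons power_Suc) (simp only: ac_simps)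
      qed
      finally show "word_fn x \<mu> [1..<Suc (length \<mu>)] = t powi (- word_stat \<mu>) * word_mono x [1..<Suc (length \<mu>)] \<mu>"
        unfolding l_def .
    qed
  qed
qed

end

section \<open>Symmetrization\<close>

context colour_tuples
begin

definition ratio :: "(nat \<Rightarrow> 'a) \<Rightarrow> nat \<Rightarrow> nat \<Rightarrow> 'a" where
  "ratio x i j = (x i - t * x j) / (x i - x j)"

text \<open>The Hall--Littlewood symmetrizer in the variables with index at least k; k grows while
  the first k - 1 colours of a tuple are being fixed.\<close>

definition sym_sum :: "nat \<Rightarrow> ((nat \<Rightarrow> 'a) \<Rightarrow> 'a) \<Rightarrow> (nat \<Rightarrow> 'a) \<Rightarrow> 'a" where
  "sym_sum k h x = (\<Sum>w | w permutes {k..N}. h (x \<circ> w) *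
     (\<Prod>(i, j)\<in>{(i, j). k \<le> i \<and> i < j \<and> j \<le> N}. ratio (x \<circ> w) i j))"

lemma inj_transpose: "inj (Transposition.transpose (a :: nat) b)"
  by (metis injI transpose_involutory)

lemma finite_index_pairs: "finite {(i, j). (k::nat) \<le> i \<and> i < j \<and> j \<le> N}"
  by (rule finite_subset[of _ "{..N} \<times> {..N}"]) auto

lemma prod_ratio_transpose:
  assumes "k \<le> b" "b \<le> N" "u permutes {Suc k..N}"
  defines "w \<equiv> Transposition.transpose k b \<circ> u"
  shows "(\<Prod>(i, j)\<in>{(i, j). k \<le> i \<and> i < j \<and> j \<le> N}. ratio (x \<circ> w) i j) =
    (\<Prod>j\<in>{k..N}-{b}. ratio x b j) *
    (\<Prod>(i, j)\<in>{(i, j). Suc k \<le> i \<and> i < j \<and> j \<le> N}. ratio (x \<circ> w) i j)"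
proof -
  let ?P = "\<lambda>k. {(i, j). k \<le> i \<and> i < j \<and> j \<le> N}"
  have uk: "u k = k" using assms(3) by (simp add: permutes_def)
  have u: "u ` {Suc k..N} = {Suc k..N}" "inj_on u {Suc k..N}"
    using assms(3) by (auto simp: permutes_image permutes_inj_on)
  have "Transposition.transpose k b ` {k..N} = {k..N}"
    by (rule transpose_image_eq) (use assms in auto)
  moreover have "{Suc k..N} = {k..N} - {k}" by auto
  ultimately have "Transposition.transpose k b ` {Suc k..N} = {k..N} - {b}"
    by (simp add: image_set_diff inj_transpose)
  then have im: "w ` {Suc k..N} = {k..N} - {b}"
    unfolding w_def image_comp[symmetric] u(1) .
  have inj: "inj_on w {Suc k..N}"
    unfolding w_def by (rule comp_inj_on[OF u(2)]) (rule inj_on_subset[OF inj_transpose], simp)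
  have wk: "w k = b" by (simp add: w_def uk)
  have split: "?P k = (\<lambda>j. (k, j)) ` {Suc k..N} \<union> ?P (Suc k)"
    by (auto simp: image_iff)
  have "(\<Prod>(i, j)\<in>?P k. ratio (x \<circ> w) i j) = (\<Prod>(i, j)\<in>(\<lambda>j. (k, j)) ` {Suc k..N}. ratio (x \<circ> w) i j) *
      (\<Prod>(i, j)\<in>?P (Suc k). ratio (x \<circ> w) i j)"
    unfolding split by (rule prod.union_disjoint) (auto simp: finite_index_pairs simp del: finite_atLeastAtMost intro: finite_index_pairs[of "Suc k", simplified])
  also have "(\<Prod>(i, j)\<in>(\<lambda>j. (k, j)) ` {Suc k..N}. ratio (x \<circ> w) i j) = (\<Prod>j\<in>{Suc k..N}. ratio x b (w j))"
    by (subst prod.reindex) (auto simp: inj_on_def ratio_def wk)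
  also have "\<dots> = (\<Prod>j\<in>{k..N}-{b}. ratio x b j)"
    unfolding im[symmetric] by (simp add: prod.reindex[OF inj])
  finally show ?thesis .
qed

text \<open>The permutations are classified by the image b of k; the pairs (k, j) then give the
  product over all indices other than b.\<close>

lemma sym_sum_step:
  assumes "k \<le> N"
  shows "sym_sum k h x = (\<Sum>b\<in>{k..N}. (\<Prod>j\<in>{k..N}-{b}. ratio x b j) *
    sym_sum (Suc k) h (x \<circ> Transposition.transpose k b))"
proof -
  have ins: "{k..N} = insert k {Suc k..N}" using assms by auto
  let ?f = "\<lambda>w. h (x \<circ> w) * (\<Prod>(i, j)\<in>{(i, j). k \<le> i \<and> i < j \<and> j \<le> N}. ratio (x \<circ> w) i j)"
  have "sym_sum k h x = (\<Sum>b\<in>{k..N}. \<Sum>u | u permutes {Suc k..N}. ?f (Transposition.transpose k b \<circ> u))"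
    unfolding sym_sum_def ins by (rule sum_over_permutations_insert) auto
  also have "\<dots> = (\<Sum>b\<in>{k..N}. (\<Prod>j\<in>{k..N}-{b}. ratio x b j) *
    sym_sum (Suc k) h (x \<circ> Transposition.transpose k b))"
    unfolding sym_sum_def sum_distrib_left
    by (intro sum.cong refl) (use prod_ratio_transpose in \<open>auto simp: comp_assoc mult.left_commute\<close>)
  finally show ?thesis .
qed

text \<open>
  The values of an equivariant function at the tuples \<open>(1, \<dots>, k - 1, b)\<close>, \<open>b = k, \<dots>, N\<close>, form a
  chain \<open>g\<close> as below.
\<close>

definition hecke_chain :: "nat \<Rightarrow> (nat \<Rightarrow> (nat \<Rightarrow> 'a) \<Rightarrow> 'a) \<Rightarrow> bool" where
  "hecke_chain k g \<longleftrightarrow> (\<forall>x. inj_on x {1..N} \<longrightarrow>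
     (\<forall>a. k < a \<and> a < N \<longrightarrow> g k (x \<circ> adj a) = g k x) \<and>
     (\<forall>b. k \<le> b \<and> b < N \<longrightarrow> (x b - x (Suc b)) * g (Suc b) x =
        (1 - t) * x (Suc b) * g b x + (t * x b - x (Suc b)) * g b (x \<circ> adj b)))"

lemma transpose_adj_disjoint:
  assumes "k < m" "j < m" "k \<le> j"
  shows "adj m \<circ> Transposition.transpose k j = Transposition.transpose k j \<circ> adj m"
  using assms by (auto simp: fun_eq_iff Transposition.transpose_def)

lemma transpose_adj_conj:
  assumes "k < m"
  shows "adj m \<circ> Transposition.transpose k m = Transposition.transpose k (Suc m) \<circ> adj m"
  using assms by (auto simp: fun_eq_iff Transposition.transpose_def)

lemma inj_on_transpose:
  assumes "inj_on x {1..N}" "1 \<le> k" "k \<le> N" "1 \<le> j" "j \<le> N"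
  shows "inj_on (x \<circ> Transposition.transpose k j) {1..N}"
proof (rule comp_inj_on)
  show "inj_on x (Transposition.transpose k j ` {1..N})"
    using assms by (subst transpose_image_eq) auto
qed (rule inj_on_subset[OF inj_transpose], simp)

text \<open>The last factor of a summand is \<open>ratio x j m\<close> - 1. So \<open>f x j\<close>
  enters with the increment of its product of ratios when the index m is added, and the sum over m
  in \<open>hecke_chain_sum\<close> telescopes.\<close>

lemma hecke_chain_formula:
  assumes g: "hecke_chain k g" and k: "1 \<le> k" and m: "k \<le> m" "m \<le> N" and x: "inj_on x {1..N}"
  defines "f \<equiv> \<lambda>x j. g k (x \<circ> Transposition.transpose k j)"
  shows "g m x = f x m * (\<Prod>i\<in>{k..<m}. ratio x m i) +
    (\<Sum>j\<in>{k..<m}. f x j * (\<Prod>i\<in>{k..<m}-{j}. ratio x j i) * ((1 - t) * x m / (x j - x m)))"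
  using m x
proof (induction m arbitrary: x rule: nat_induct_at_least)
  case base
  show ?case by (simp add: f_def)
next
  case (Suc m)
  define y where "y = x \<circ> adj m"
  have m: "1 \<le> m" "m < N" using k Suc by auto
  have y: "inj_on y {1..N}" unfolding y_def using inj_on_comp_adj Suc m by auto
  have y_simps: "y m = x (Suc m)" "\<And>j. j \<in> {k..<m} \<Longrightarrow> y j = x j"
    by (auto simp: y_def adj_other)
  have ne: "x i \<noteq> x j" if "i \<in> {1..N}" "j \<in> {1..N}" "i \<noteq> j" for i j
    using that Suc.prems by (auto dest: inj_onD)
  have D: "x m - x (Suc m) \<noteq> 0" using ne m by auto
  define A where "A j = f x j * (\<Prod>i\<in>{k..<m}-{j}. ratio x j i)" for j
  define Q where "Q = (\<Prod>i\<in>{k..<m}. ratio x m i)"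
  define Q' where "Q' = (\<Prod>i\<in>{k..<m}. ratio x (Suc m) i)"
  \<comment> \<open>For j < m the exchange of the variables m and m + 1 is absorbed by the symmetry
    of \<open>g k\<close> in the variables beyond k; for j = m it leads from \<open>f x m\<close> to
    \<open>f x (Suc m)\<close>.\<close>
  have fy: "f y j = f x j" if j: "j \<in> {k..<m}" for j
  proof -
    have km: "k < m" using j by auto
    have "f y j = g k ((x \<circ> Transposition.transpose k j) \<circ> adj m)"
      using transpose_adj_disjoint[OF km, of j] j by (simp add: f_def y_def comp_assoc)
    also have "\<dots> = f x j"
      using g inj_on_transpose[OF Suc.prems(2), of k j] j k m km by (simp add: hecke_chain_def f_def)
    finally show ?thesis .
  qed
  have fm: "f y m = f x (Suc m)"
  proof (cases "k = m")
    case True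
    then show ?thesis by (simp add: f_def y_def)
  next
    case False
    then have km: "k < m" using Suc by auto
    have "f y m = g k ((x \<circ> Transposition.transpose k (Suc m)) \<circ> adj m)"
      using transpose_adj_conj[OF km] by (simp add: f_def y_def comp_assoc)
    also have "\<dots> = f x (Suc m)"
      using g inj_on_transpose[OF Suc.prems(2), of k "Suc m"] k m km by (simp add: hecke_chain_def f_def)
    finally show ?thesis .
  qed
  have g1: "g m x = f x m * Q + (\<Sum>j\<in>{k..<m}. A j * ((1 - t) * x m / (x j - x m)))"
    using Suc.IH[of x] Suc.prems m by (simp add: A_def Q_def)
  have g2: "g m y = f x (Suc m) * Q' + (\<Sum>j\<in>{k..<m}. A j * ((1 - t) * x (Suc m) / (x j - x (Suc m))))"
  proof -
    have "(\<Prod>i\<in>{k..<m}. ratio y m i) = Q'"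
      unfolding Q'_def by (intro prod.cong) (auto simp: ratio_def y_simps)
    moreover have "f y j * (\<Prod>i\<in>{k..<m}-{j}. ratio y j i) = A j" if "j \<in> {k..<m}" for j
      unfolding A_def fy[OF that] using that by (intro arg_cong2[where f="(*)"] prod.cong refl) (auto simp: ratio_def y_simps)
    moreover have "g m y = f y m * (\<Prod>i\<in>{k..<m}. ratio y m i) +
      (\<Sum>j\<in>{k..<m}. f y j * (\<Prod>i\<in>{k..<m}-{j}. ratio y j i) * ((1 - t) * y m / (y j - y m)))"
      by (rule Suc.IH) (use y m in auto)
    ultimately show ?thesis by (simp only: fm y_simps cong: sum.cong)
  qed
  have T: "(x m - x (Suc m)) * g (Suc m) x = (1 - t) * x (Suc m) * g m x + (t * x m - x (Suc m)) * g m y"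
    unfolding y_def using g Suc.prems Suc.hyps m by (simp add: hecke_chain_def)
  \<comment> \<open>The partial fraction identity that merges the coefficients of
    \<open>f x j\<close> in \<open>g m x\<close> and \<open>g m y\<close>.\<close>
  have j: "(1 - t) * x (Suc m) * (A j * ((1 - t) * x m / (x j - x m))) +
      (t * x m - x (Suc m)) * (A j * ((1 - t) * x (Suc m) / (x j - x (Suc m)))) =
      (x m - x (Suc m)) * (A j * ratio x j m * ((1 - t) * x (Suc m) / (x j - x (Suc m))))"
    if "j \<in> {k..<m}" for j
  proof -
    have "x j - x m \<noteq> 0" "x j - x (Suc m) \<noteq> 0" using ne[of j m] ne[of j "Suc m"] that k m by auto
    then show ?thesis unfolding ratio_def by (simp add: divide_simps) (simp add: algebra_simps)
  qed
  have R: "(x m - x (Suc m)) * ratio x (Suc m) m = t * x m - x (Suc m)"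
    using D by (simp add: ratio_def divide_simps) (simp add: algebra_simps)
  have A1: "f x j * (\<Prod>i\<in>{k..<Suc m}-{j}. ratio x j i) = A j * ratio x j m" if "j \<in> {k..<m}" for j
  proof -
    have "{k..<Suc m} - {j} = insert m ({k..<m} - {j})" using that by auto
    then show ?thesis by (simp add: A_def mult.assoc mult.commute)
  qed
  have A2: "{k..<Suc m} - {m} = {k..<m}" by auto
  have S: "{k..<Suc m} = insert m {k..<m}" using Suc by auto
  have "(x m - x (Suc m)) * g (Suc m) x =
     (t * x m - x (Suc m)) * (f x (Suc m) * Q') + (1 - t) * x (Suc m) * (f x m * Q) +
     (\<Sum>j\<in>{k..<m}. (1 - t) * x (Suc m) * (A j * ((1 - t) * x m / (x j - x m))) +
      (t * x m - x (Suc m)) * (A j * ((1 - t) * x (Suc m) / (x j - x (Suc m)))))"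
    unfolding T g1 g2 by (simp add: algebra_simps sum.distrib sum_distrib_left)
  also have "\<dots> = (t * x m - x (Suc m)) * (f x (Suc m) * Q') + (1 - t) * x (Suc m) * (f x m * Q) +
     (\<Sum>j\<in>{k..<m}. (x m - x (Suc m)) * (A j * ratio x j m * ((1 - t) * x (Suc m) / (x j - x (Suc m)))))"
    by (intro arg_cong2[where f="(+)"] refl sum.cong j)
  also have "\<dots> = (x m - x (Suc m)) * (f x (Suc m) * (ratio x (Suc m) m * Q') +
     (f x m * Q * ((1 - t) * x (Suc m) / (x m - x (Suc m))) +
     (\<Sum>j\<in>{k..<m}. A j * ratio x j m * ((1 - t) * x (Suc m) / (x j - x (Suc m))))))"
  proof -
    have "(1 - t) * x (Suc m) * (f x m * Q) =
       (x m - x (Suc m)) * (f x m * Q * ((1 - t) * x (Suc m) / (x m - x (Suc m))))"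
      using D by simp
    then show ?thesis
      unfolding R[symmetric] by (simp only: sum_distrib_left distrib_left ac_simps)
  qed
  also have "f x m * Q * ((1 - t) * x (Suc m) / (x m - x (Suc m))) +
     (\<Sum>j\<in>{k..<m}. A j * ratio x j m * ((1 - t) * x (Suc m) / (x j - x (Suc m)))) =
     (\<Sum>j\<in>{k..<Suc m}. f x j * (\<Prod>i\<in>{k..<Suc m}-{j}. ratio x j i) * ((1 - t) * x (Suc m) / (x j - x (Suc m))))"
    unfolding S by (subst sum.insert) (auto simp: A1[unfolded S] A2[unfolded S] Q_def intro!: sum.cong)
  also have "ratio x (Suc m) m * Q' = (\<Prod>i\<in>{k..<Suc m}. ratio x (Suc m) i)"
    unfolding S Q'_def by simp
  finally show ?case using D by simp
qed

lemma hecke_chain_sum: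
  assumes g: "hecke_chain k g" and k: "1 \<le> k" and m: "k \<le> m" "m \<le> N" and x: "inj_on x {1..N}"
  shows "(\<Sum>b\<in>{k..m}. g b x) = (\<Sum>b\<in>{k..m}. (\<Prod>j\<in>{k..m}-{b}. ratio x b j) * g k (x \<circ> Transposition.transpose k b))"
  using m
proof (induction m rule: nat_induct_at_least)
  case base
  then show ?case by simp
next
  case (Suc m)
  let ?f = "\<lambda>j. g k (x \<circ> Transposition.transpose k j)"
  have S: "{k..Suc m} = insert (Suc m) {k..m}" "{k..Suc m} - {Suc m} = {k..m}" using Suc by auto
  have I: "{k..<Suc m} = {k..m}" by auto
  have IH: "(\<Sum>b\<in>{k..m}. g b x) = (\<Sum>b\<in>{k..m}. (\<Prod>j\<in>{k..m}-{b}. ratio x b j) * ?f b)"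
    by (rule Suc.IH) (use Suc.prems in simp)
  have ne: "x j \<noteq> x (Suc m)" if "j \<in> {k..m}" for j
    using that x Suc.prems k by (auto dest: inj_onD)
  have j: "(\<Prod>i\<in>{k..Suc m}-{j}. ratio x j i) = (\<Prod>i\<in>{k..m}-{j}. ratio x j i) +
      (\<Prod>i\<in>{k..m}-{j}. ratio x j i) * ((1 - t) * x (Suc m) / (x j - x (Suc m)))" if "j \<in> {k..m}" for j
  proof -
    have "{k..Suc m} - {j} = insert (Suc m) ({k..m} - {j})" using that by auto
    then have "(\<Prod>i\<in>{k..Suc m}-{j}. ratio x j i) = ratio x j (Suc m) * (\<Prod>i\<in>{k..m}-{j}. ratio x j i)" by simp
    also have "ratio x j (Suc m) = 1 + (1 - t) * x (Suc m) / (x j - x (Suc m))"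
      using ne[OF that] by (simp add: ratio_def divide_simps) (simp add: algebra_simps)
    finally show ?thesis by (simp add: algebra_simps)
  qed
  have "(\<Sum>b\<in>{k..Suc m}. g b x) = g (Suc m) x + (\<Sum>b\<in>{k..m}. (\<Prod>j\<in>{k..m}-{b}. ratio x b j) * ?f b)"
    unfolding IH[symmetric] by (subst S(1), subst sum.insert) auto
  also have "g (Suc m) x = ?f (Suc m) * (\<Prod>i\<in>{k..m}. ratio x (Suc m) i) +
    (\<Sum>j\<in>{k..m}. ?f j * (\<Prod>i\<in>{k..m}-{j}. ratio x j i) * ((1 - t) * x (Suc m) / (x j - x (Suc m))))"
    using hecke_chain_formula[OF g k, of "Suc m" x] Suc x by (simp add: I)
  also have "?f (Suc m) * (\<Prod>i\<in>{k..m}. ratio x (Suc m) i) +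
    (\<Sum>j\<in>{k..m}. ?f j * (\<Prod>i\<in>{k..m}-{j}. ratio x j i) * ((1 - t) * x (Suc m) / (x j - x (Suc m)))) +
    (\<Sum>b\<in>{k..m}. (\<Prod>j\<in>{k..m}-{b}. ratio x b j) * ?f b) =
    (\<Prod>i\<in>{k..m}. ratio x (Suc m) i) * ?f (Suc m) + (\<Sum>b\<in>{k..m}. (\<Prod>j\<in>{k..Suc m}-{b}. ratio x b j) * ?f b)"
    unfolding add.assoc sum.distrib[symmetric]
    by (intro arg_cong2[where f="(+)"] mult.commute sum.cong refl) (simp only: j distrib_left distrib_right ac_simps)
  also have "\<dots> = (\<Sum>b\<in>{k..Suc m}. (\<Prod>j\<in>{k..Suc m}-{b}. ratio x b j) * ?f b)"
    by (subst S(1), subst sum.insert, simp, simp, subst S(2)) (simp add: S(1)[symmetric])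
  finally show ?case .
qed

section \<open>Evaluation of the symmetrizer\<close>

definition t_int :: "nat \<Rightarrow> 'a" where
  "t_int m = (\<Sum>k<m. t ^ k)"

definition t_fact :: "nat \<Rightarrow> 'a" where
  "t_fact m = (\<Prod>k=1..m. t_int k)"

text \<open>A Demazure--Lusztig operator multiplies constants by \<open>t\<close>, so the powers of
  \<open>t\<close>, constant in x, form a chain. Its sum is computed in two ways.\<close>

lemma sum_prod_ratio:
  assumes "1 \<le> k" "k \<le> N" "inj_on x {1..N}"
  shows "(\<Sum>b\<in>{k..N}. \<Prod>j\<in>{k..N}-{b}. ratio x b j) = t_int (Suc N - k)"
proof -
  have "hecke_chain k (\<lambda>b x. t ^ (b - k))"
    unfolding hecke_chain_def
    by (auto simp: Suc_diff_le algebra_simps)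
  from hecke_chain_sum[OF this assms(1,2) _ assms(3)]
  have "(\<Sum>b\<in>{k..N}. \<Prod>j\<in>{k..N}-{b}. ratio x b j) = (\<Sum>b\<in>{k..N}. t ^ (b - k))" by simp
  also have "\<dots> = t_int (Suc N - k)"
    unfolding t_int_def
    by (rule sum.reindex_bij_witness[of _ "\<lambda>i. i + k" "\<lambda>b. b - k"]) auto
  finally show ?thesis .
qed

text \<open>The classical identity behind the normalization of the Hall--Littlewood
  polynomials.\<close>

lemma sym_sum_one:
  assumes "1 \<le> k" "k \<le> Suc N" "inj_on x {1..N}"
  shows "sym_sum k (\<lambda>x. 1) x = t_fact (Suc N - k)"
  using assms(2,1,3)
proof (induction k arbitrary: x rule: inc_induct)
  case base
  have "{(i, j). Suc N \<le> i \<and> i < j \<and> j \<le> N} = {}" by auto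
  then show ?case unfolding sym_sum_def by (simp only:) (simp add: t_fact_def)
next
  case (step k)
  have kN: "k \<le> N" using step by simp
  have "sym_sum k (\<lambda>x. 1) x = (\<Sum>b\<in>{k..N}. (\<Prod>j\<in>{k..N}-{b}. ratio x b j) * t_fact (N - k))"
    unfolding sym_sum_step[OF kN]
  proof (intro sum.cong refl arg_cong2[where f="(*)"])
    fix b assume "b \<in> {k..N}"
    then have "inj_on (x \<circ> Transposition.transpose k b) {1..N}"
      using step.prems kN by (intro inj_on_transpose) auto
    then show "sym_sum (Suc k) (\<lambda>x. 1) (x \<circ> Transposition.transpose k b) = t_fact (N - k)"
      using step.IH step.prems by simp
  qed
  also have "\<dots> = t_int (Suc N - k) * t_fact (N - k)"
    unfolding sum_distrib_right[symmetric] using sum_prod_ratio[of k x] step.prems kN by simp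
  also have "\<dots> = t_fact (Suc N - k)"
    using kN by (simp add: Suc_diff_le t_fact_def)
  finally show ?case .
qed

text \<open>Invariance is available only at injective x, so injectivity has to be carried along. A
  general transposition is reached from neighbours by conjugation.\<close>

lemma adj_invariant_imp_permutes_invariant:
  fixes h :: "(nat \<Rightarrow> 'a) \<Rightarrow> 'b"
  assumes "\<And>x a. inj_on x {1..N} \<Longrightarrow> k \<le> a \<Longrightarrow> a < N \<Longrightarrow> h (x \<circ> adj a) = h x"
    and "1 \<le> k" "w permutes {k..N}" "inj_on x {1..N}"
  shows "h (x \<circ> w) = h x"
proof -
  have tr: "h (x \<circ> Transposition.transpose a b) = h x" if "a < b" "k \<le> a" "b \<le> N" "inj_on x {1..N}" for a b x
    using that
  proof (induction b arbitrary: x rule: less_induct)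
    case (less b)
    then obtain b' where b: "b = Suc b'" by (cases b) auto
    show ?case
    proof (cases "a = b'")
      case True
      show ?thesis unfolding b True[symmetric] using less.prems b True by (intro assms(1)) auto
    next
      case False
      then have ab: "a < b'" "1 \<le> b'" "b' < N" using less.prems b assms(2) by auto
      have "Transposition.transpose a b = adj b' \<circ> Transposition.transpose a b' \<circ> adj b'"
        using ab b by (auto simp: fun_eq_iff Transposition.transpose_def)
      then have "h (x \<circ> Transposition.transpose a b) = h (((x \<circ> adj b') \<circ> Transposition.transpose a b') \<circ> adj b')"
        by (simp add: comp_assoc)
      also have "\<dots> = h ((x \<circ> adj b') \<circ> Transposition.transpose a b')"
        using less.prems ab assms(2) by (intro assms(1) inj_on_transpose inj_on_comp_adj) auto
      also have "\<dots> = h (x \<circ> adj b')"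
        using less.prems ab b by (intro less.IH inj_on_comp_adj) auto
      also have "\<dots> = h x" using less.prems ab by (intro assms(1)) auto
      finally show ?thesis .
    qed
  qed
  have tr': "h (x \<circ> Transposition.transpose a b) = h x"
    if "a \<noteq> b" "a \<in> {k..N}" "b \<in> {k..N}" "inj_on x {1..N}" for a b x
    using that tr[of a b x] tr[of b a x]
    by (cases a b rule: linorder_cases) (auto simp: transpose_commute)
  have "\<forall>x. inj_on x {1..N} \<longrightarrow> h (x \<circ> w) = h x"
    using assms(3) finite_atLeastAtMost
  proof (induction rule: permutes_induct)
    case (swap a b p)
    show ?case
    proof (intro allI impI)
      fix x :: "nat \<Rightarrow> 'a" assume x: "inj_on x {1..N}"
      then have "inj_on (x \<circ> Transposition.transpose a b) {1..N}"
        using swap assms(2) by (intro inj_on_transpose) auto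
      then have "h ((x \<circ> Transposition.transpose a b) \<circ> p) = h (x \<circ> Transposition.transpose a b)"
        using swap.IH by blast
      also have "\<dots> = h x" using tr' swap x by auto
      finally show "h (x \<circ> (Transposition.transpose a b \<circ> p)) = h x" by (simp add: comp_assoc)
    qed
  qed auto
  with assms(4) show ?thesis by blast
qed

lemma inj_on_comp_permutes:
  assumes "inj_on x {1..N}" "w permutes {1..N}"
  shows "inj_on (x \<circ> w) {1..N}"
  using assms by (auto intro!: comp_inj_on permutes_inj_on simp: permutes_image)

lemma sym_sum_invariant:
  assumes "\<And>x a. inj_on x {1..N} \<Longrightarrow> k \<le> a \<Longrightarrow> a < N \<Longrightarrow> h (x \<circ> adj a) = h x"
    and "1 \<le> k" "k \<le> Suc N" "inj_on x {1..N}"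
  shows "sym_sum k h x = h x * t_fact (Suc N - k)"
proof -
  have inv: "h (x \<circ> w) = h x" if "w permutes {k..N}" for w
    using assms(1) assms(2) that assms(4) by (rule adj_invariant_imp_permutes_invariant)
  have "sym_sum k h x = (\<Sum>w | w permutes {k..N}. h x *
     (\<Prod>(i, j)\<in>{(i, j). k \<le> i \<and> i < j \<and> j \<le> N}. ratio (x \<circ> w) i j))"
    unfolding sym_sum_def using inv by (intro sum.cong refl) simp
  also have "\<dots> = h x * sym_sum k (\<lambda>x. 1) x"
    by (simp add: sym_sum_def sum_distrib_left)
  finally show ?thesis using sym_sum_one assms by simp
qed

lemma canonical_tuple: "k \<le> N \<Longrightarrow> [1..<Suc k] \<in> tuples k"
  by (auto simp: tuples_def simp del: upt_Suc)

text \<open>For the colours 1, ..., j fixed, the summands of the next \<open>dminus\<close> form a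
  chain, and its sum formula is one step of the symmetrizer. When all k colours are fixed, F is
  symmetric in the other N - k variables; symmetrizing over these gives the factor
  \<open>t_fact (N - k)\<close>.\<close>

theorem dminus_pow_symmetrization:
  assumes F: "equivariant k F" and k: "k \<le> N" and x: "inj_on x {1..N}"
  shows "(dminus ^^ k) (F x) [] * t_fact (N - k) = sym_sum 1 (\<lambda>x. F x [1..<Suc k]) x"
proof -
  let ?h = "\<lambda>x. F x [1..<Suc k]"
  have "(dminus ^^ (k - j)) (F x) [1..<Suc j] * t_fact (N - k) = sym_sum (Suc j) ?h x" if "j \<le> k" for j
    using that x
  proof (induction j arbitrary: x rule: inc_induct)
    case base
    have "?h (x \<circ> adj a) = ?h x" if "inj_on x {1..N}" "Suc k \<le> a" "a < N" for x a
      using that k by (intro equivariant_neither[OF F] canonical_tuple) auto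
    from sym_sum_invariant[where h = ?h and k = "Suc k", OF this] base k
    show ?case by simp
  next
    case (step j)
    let ?l = "k - Suc j"
    define H where "H x = (dminus ^^ ?l) (F x)" for x
    have H: "equivariant (Suc j) H"
      unfolding H_def using equivariant_dminus_pow[of "Suc j" ?l F] F step.hyps by simp
    let ?g = "\<lambda>b x. H x ([1..<Suc j] @ [b])"
    have jN: "Suc j \<le> N" using step k by simp
    have tup: "[1..<Suc j] @ [b] \<in> tuples (Suc j)" if "b \<in> {Suc j..N}" for b
      using that jN by (auto simp: tuples_def simp del: upt_Suc)
    have chain: "hecke_chain (Suc j) ?g"
      unfolding hecke_chain_def
    proof (intro allI impI conjI; (elim conjE)?)
      fix x :: "nat \<Rightarrow> 'a" and a assume "inj_on x {1..N}" "Suc j < a" "a < N"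
      then show "?g (Suc j) (x \<circ> adj a) = ?g (Suc j) x"
        using tup[of "Suc j"] jN by (intro equivariant_neither[OF H]) (auto simp del: upt_Suc)
    next
      fix x :: "nat \<Rightarrow> 'a" and b assume x: "inj_on x {1..N}" and b: "Suc j \<le> b" "b < N"
      have "map (adj b) ([1..<Suc j] @ [b]) = [1..<Suc j] @ [Suc b]"
        using b by (simp add: map_adj_id del: upt_Suc)
      moreover have "precedes b (Suc b) ([1..<Suc j] @ [b])"
        using b by (simp add: precedes_append del: upt_Suc)
      ultimately show "(x b - x (Suc b)) * ?g (Suc b) x =
          (1 - t) * x (Suc b) * ?g b x + (t * x b - x (Suc b)) * ?g b (x \<circ> adj b)"
        using equivariant_precedes[OF H x _ b(2) tup[of b]] b by (simp del: upt_Suc)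
    qed
    have "(dminus ^^ (k - j)) (F x) [1..<Suc j] = dminus (H x) [1..<Suc j]"
      using step.hyps by (simp add: H_def Suc_diff_Suc[symmetric] del: upt_Suc)
    also have "\<dots> = (\<Sum>b\<in>{Suc j..N}. ?g b x)"
      unfolding dminus_def by (intro sum.cong) (auto simp del: upt_Suc)
    also have "\<dots> = (\<Sum>b\<in>{Suc j..N}. (\<Prod>i\<in>{Suc j..N}-{b}. ratio x b i) *
        ?g (Suc j) (x \<circ> Transposition.transpose (Suc j) b))"
      using jN step.prems by (intro hecke_chain_sum[OF chain]) auto
    finally have "(dminus ^^ (k - j)) (F x) [1..<Suc j] * t_fact (N - k) =
      (\<Sum>b\<in>{Suc j..N}. (\<Prod>i\<in>{Suc j..N}-{b}. ratio x b i) *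
        (?g (Suc j) (x \<circ> Transposition.transpose (Suc j) b) * t_fact (N - k)))"
      by (simp add: sum_distrib_right mult.assoc)
    also have "\<dots> = sym_sum (Suc j) ?h x"
      unfolding sym_sum_step[OF jN]
    proof (intro sum.cong refl arg_cong2[where f="(*)"])
      fix b assume "b \<in> {Suc j..N}"
      then have inj: "inj_on (x \<circ> Transposition.transpose (Suc j) b) {1..N}"
        using step.prems jN by (intro inj_on_transpose) auto
      have "[1..<Suc (Suc j)] = [1..<Suc j] @ [Suc j]" by simp
      with step.IH[OF inj]
      show "?g (Suc j) (x \<circ> Transposition.transpose (Suc j) b) * t_fact (N - k) =
         sym_sum (Suc (Suc j)) ?h (x \<circ> Transposition.transpose (Suc j) b)"
        by (simp only: H_def)
    qed
    finally show ?case .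
  qed
  from this[of 0] show ?thesis by simp
qed

text \<open>The exponent \<open>word_stat \<mu>\<close> in \<open>state_fn\<close> cancels the one
  in \<open>value_at_sorted\<close>, which leaves the plain monomial.\<close>

theorem state_fn_symmetrization:
  assumes "sorted_wrt (\<ge>) \<mu>" "0 \<notin> set \<mu>" "length \<mu> \<le> N" "inj_on x {1..N}"
  shows "state_fn x [] \<mu> [] * t_fact (N - length \<mu>) =
    sym_sum 1 (\<lambda>x. word_mono x [1..<Suc (length \<mu>)] \<mu>) x"
proof -
  have v: "t powi word_stat \<mu> * word_fn y \<mu> [1..<Suc (length \<mu>)] = word_mono y [1..<Suc (length \<mu>)] \<mu>"
    if "inj_on y {1..N}" for y
    using value_at_sorted[OF assms(1-3)] that t_nonzero
    by (simp add: value_at_def power_int_minus del: upt_Suc)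
  have "state_fn x [] \<mu> [] * t_fact (N - length \<mu>) =
     t powi word_stat \<mu> * sym_sum 1 (\<lambda>x. word_fn x \<mu> [1..<Suc (length \<mu>)]) x"
    using dminus_pow_symmetrization[OF equivariant_word_fn assms(3,4)]
    by (simp add: state_fn_def mult.assoc del: upt_Suc)
  also have "\<dots> = sym_sum 1 (\<lambda>x. word_mono x [1..<Suc (length \<mu>)] \<mu>) x"
    unfolding sym_sum_def sum_distrib_left
    using v[OF inj_on_comp_permutes[OF assms(4)]]
    by (intro sum.cong refl) (simp add: mult.assoc[symmetric] del: upt_Suc)
  finally show ?thesis .
qed

end

section \<open>Colorings and arc sets along a Dyck path\<close>

abbreviation norths :: "step list \<Rightarrow> nat" where "norths w \<equiv> count_list w North"
abbreviation easts :: "step list \<Rightarrow> nat" where "easts w \<equiv> count_list w East"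

text \<open>
  After a prefix \<open>w\<close> of a Dyck path, the vertices \<open>1, \<dots>, norths w\<close> have been created, and the first
  \<open>easts w\<close> of them are closed: no later vertex is adjacent to them.
\<close>

definition edges :: "step list \<Rightarrow> (nat \<times> nat) set" where
  "edges w = {(i, j). \<exists>u v. w = u @ North # v \<and> j = Suc (norths u) \<and> easts u < i \<and> i \<le> norths u}"

definition non_edges :: "step list \<Rightarrow> (nat \<times> nat) set" where
  "non_edges w = {(i, j). \<exists>u v. w = u @ North # v \<and> j = Suc (norths u) \<and> 1 \<le> i \<and> i \<le> easts u}"

definition above_diagonal :: "step list \<Rightarrow> bool" where
  "above_diagonal w \<longleftrightarrow> (\<forall>u v. w = u @ v \<longrightarrow> easts u \<le> norths u)"

lemma above_diagonal_prefix: "above_diagonal (u @ v) \<Longrightarrow> above_diagonal u"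
  by (auto simp: above_diagonal_def)

lemma above_diagonal_le: "above_diagonal w \<Longrightarrow> easts w \<le> norths w"
  unfolding above_diagonal_def by (metis append_Nil2)

lemma snoc_eq_split_iff:
  "w @ [s] = u @ a # v \<longleftrightarrow> (v = [] \<and> u = w \<and> s = a) \<or> (\<exists>v'. v = v' @ [s] \<and> w = u @ a # v')"
  by (cases v rule: rev_cases) auto

lemma edges_Nil [simp]: "edges [] = {}" and non_edges_Nil [simp]: "non_edges [] = {}"
  by (auto simp: edges_def non_edges_def)

lemma edges_snoc_East [simp]: "edges (w @ [East]) = edges w"
  and non_edges_snoc_East [simp]: "non_edges (w @ [East]) = non_edges w"
  unfolding edges_def non_edges_def snoc_eq_split_iff by auto

lemma edges_snoc_North [simp]:
  "edges (w @ [North]) = edges w \<union> {easts w<..norths w} \<times> {Suc (norths w)}"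
  unfolding edges_def snoc_eq_split_iff by auto

lemma non_edges_snoc_North [simp]:
  "non_edges (w @ [North]) = non_edges w \<union> {1..easts w} \<times> {Suc (norths w)}"
  unfolding non_edges_def snoc_eq_split_iff by auto

lemma edges_bounds: "(i, j) \<in> edges w \<Longrightarrow> 1 \<le> i \<and> i < j \<and> j \<le> norths w"
  by (auto simp: edges_def)

lemma non_edges_bounds:
  "above_diagonal w \<Longrightarrow> (i, j) \<in> non_edges w \<Longrightarrow> 1 \<le> i \<and> i < j \<and> j \<le> norths w \<and> i \<le> easts w"
proof -
  assume w: "above_diagonal w" "(i, j) \<in> non_edges w"
  then obtain u v where u: "w = u @ North # v" "j = Suc (norths u)" "1 \<le> i" "i \<le> easts u"
    by (auto simp: non_edges_def)
  then have "easts u \<le> norths u" using w by (auto simp: above_diagonal_def)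
  with u show ?thesis by auto
qed

lemma finite_edges: "finite (edges w)"
  by (rule finite_subset[of _ "{..norths w} \<times> {..norths w}"]) (force dest: edges_bounds)+

lemma finite_non_edges: "above_diagonal w \<Longrightarrow> finite (non_edges w)"
  by (rule finite_subset[of _ "{..norths w} \<times> {..norths w}"]) (auto dest!: non_edges_bounds)

text \<open>This is why the colours of the open vertices form a distinct tuple and
  \<open>dminus\<close> omits the colours in r.\<close>

lemma open_vertices_adjacent:
  "easts w < i \<Longrightarrow> i < j \<Longrightarrow> j \<le> norths w \<Longrightarrow> (i, j) \<in> edges w"
proof (induction w rule: rev_induct)
  case (snoc s w)
  then show ?case by (cases s) (auto simp: le_Suc_eq)
qed simp

definition open_vertices :: "step list \<Rightarrow> nat list" where
  "open_vertices w = rev [Suc (easts w)..<Suc (norths w)]"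

lemma set_open_vertices: "set (open_vertices w) = {easts w<..norths w}"
  by (auto simp: open_vertices_def simp del: upt_Suc)

lemma length_open_vertices: "length (open_vertices w) = norths w - easts w"
  by (simp add: open_vertices_def del: upt_Suc)

lemma open_vertices_North:
  "above_diagonal w \<Longrightarrow> open_vertices (w @ [North]) = Suc (norths w) # open_vertices w"
  using above_diagonal_le[of w] by (simp add: open_vertices_def)

lemma open_vertices_East:
  "above_diagonal (w @ [East]) \<Longrightarrow> open_vertices w = open_vertices (w @ [East]) @ [Suc (easts w)]"
  using above_diagonal_le[of "w @ [East]"] by (simp add: open_vertices_def upt_conv_Cons del: upt_Suc)

context colour_tuples
begin

definition path_fn :: "(nat \<Rightarrow> 'a) \<Rightarrow> step list \<Rightarrow> nat list \<Rightarrow> 'a" where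
  "path_fn x = foldl (\<lambda>F s. case s of North \<Rightarrow> dplus x F | East \<Rightarrow> dminus F) (\<lambda>_. 1)"

lemma path_fn_simps [simp]:
  "path_fn x [] = (\<lambda>_. 1)"
  "path_fn x (w @ [North]) = dplus x (path_fn x w)"
  "path_fn x (w @ [East]) = dminus (path_fn x w)"
  by (simp_all add: path_fn_def)

definition colorings :: "step list \<Rightarrow> nat list \<Rightarrow> (nat \<Rightarrow> nat) set" where
  "colorings w c = {\<kappa> \<in> {1..norths w} \<rightarrow>\<^sub>E {1..N}. (\<forall>(i, j) \<in> edges w. \<kappa> i \<noteq> \<kappa> j) \<and> map \<kappa> (open_vertices w) = c}"

definition coloring_wt :: "(nat \<Rightarrow> 'a) \<Rightarrow> step list \<Rightarrow> (nat \<Rightarrow> nat) \<Rightarrow> 'a" where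
  "coloring_wt x w \<kappa> = t ^ card {(i, j) \<in> edges w. \<kappa> i < \<kappa> j} * (\<Prod>v=1..norths w. x (\<kappa> v))"

lemma finite_colorings: "finite (colorings w c)"
  by (rule finite_subset[of _ "{1..norths w} \<rightarrow>\<^sub>E {1..N}"]) (auto simp: colorings_def intro: finite_PiE)

lemma coloring_wt_North:
  assumes "\<kappa> \<in> colorings w r" "y \<notin> set r" "distinct r"
  shows "coloring_wt x (w @ [North]) (\<kappa>(Suc (norths w) := y)) = new_wt x y r * coloring_wt x w \<kappa>"
proof -
  let ?k = "Suc (norths w)" and ?\<kappa> = "\<kappa>(Suc (norths w) := y)"
  have old: "?\<kappa> i = \<kappa> i" if "i \<le> norths w" for i using that by simp
  have r: "map \<kappa> (open_vertices w) = r" using assms by (simp add: colorings_def)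
  have inj: "inj_on \<kappa> {easts w<..norths w}"
    using assms(3) unfolding r[symmetric] distinct_map set_open_vertices by simp
  have rset: "set r = \<kappa> ` {easts w<..norths w}"
    unfolding r[symmetric] by (simp add: set_open_vertices)
  let ?A = "{(i, j) \<in> edges w. \<kappa> i < \<kappa> j}" and ?B = "{i \<in> {easts w<..norths w}. \<kappa> i < y}"
  have "{(i, j) \<in> edges (w @ [North]). ?\<kappa> i < ?\<kappa> j} = ?A \<union> ?B \<times> {?k}"
    by (auto dest: edges_bounds)
  moreover have "?A \<inter> ?B \<times> {?k} = {}" by (auto dest: edges_bounds)
  moreover have "finite ?A" by (rule finite_subset[OF _ finite_edges[of w]]) auto
  ultimately have c: "card {(i, j) \<in> edges (w @ [North]). ?\<kappa> i < ?\<kappa> j} = card ?A + card ?B"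
    by (simp add: card_Un_disjoint card_cartesian_product)
  have "(\<Prod>b\<in>set r. asc_wt b y) = (\<Prod>i\<in>{easts w<..norths w}. if \<kappa> i < y then t else 1)"
    unfolding rset prod.reindex[OF inj] by (simp add: asc_wt_def)
  also have "\<dots> = t ^ card ?B"
    by (simp add: prod.If_cases Int_def)
  finally have p: "(\<Prod>b\<in>set r. asc_wt b y) = t ^ card ?B" .
  have "(\<Prod>v=1..norths (w @ [North]). x (?\<kappa> v)) = x y * (\<Prod>v=1..norths w. x (\<kappa> v))"
    by (simp add: mult.commute)
  then show ?thesis
    unfolding coloring_wt_def c new_wt_def p by (simp add: power_add mult_ac)
qed

lemma colorings_North:
  assumes w: "above_diagonal w" and y: "y \<in> {1..N} - set r"
  shows "bij_betw (\<lambda>\<kappa>. \<kappa>(Suc (norths w) := y)) (colorings w r) (colorings (w @ [North]) (y # r))"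
proof (rule bij_betw_byWitness[where f' = "\<lambda>\<kappa>. \<kappa>(Suc (norths w) := undefined)"])
  let ?k = "Suc (norths w)"
  have k: "?k \<notin> set (open_vertices w)" by (simp add: set_open_vertices)
  have ek: "i \<noteq> ?k \<and> j \<noteq> ?k" if "(i, j) \<in> edges w" for i j using that by (auto dest: edges_bounds)
  have und: "\<kappa> ?k = undefined" if "\<kappa> \<in> colorings w r" for \<kappa>
    using that by (auto simp: colorings_def PiE_def extensional_def)
  show "\<forall>\<kappa>\<in>colorings w r. (\<kappa>(?k := y))(?k := undefined) = \<kappa>"
    using und by (metis fun_upd_triv fun_upd_upd)
  show "\<forall>\<kappa>\<in>colorings (w @ [North]) (y # r). (\<kappa>(?k := undefined))(?k := y) = \<kappa>"
    using w by (auto simp: colorings_def open_vertices_North)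
  show "(\<lambda>\<kappa>. \<kappa>(?k := y)) ` colorings w r \<subseteq> colorings (w @ [North]) (y # r)"
  proof (rule image_subsetI)
    fix \<kappa> assume \<kappa>: "\<kappa> \<in> colorings w r"
    then have r: "map \<kappa> (open_vertices w) = r" by (simp add: colorings_def)
    have "\<kappa> i \<noteq> y" if "i \<in> {easts w<..norths w}" for i
      using that y unfolding r[symmetric] by (auto simp: set_open_vertices)
    moreover have "\<kappa>(?k := y) \<in> {1..?k} \<rightarrow>\<^sub>E {1..N}"
      using \<kappa> y by (auto simp: colorings_def PiE_def extensional_def Pi_def)
    moreover have "(\<kappa>(?k := y)) i \<noteq> (\<kappa>(?k := y)) j" if "(i, j) \<in> edges w" for i j
      using ek[OF that] \<kappa> that by (auto simp: colorings_def)
    ultimately show "\<kappa>(?k := y) \<in> colorings (w @ [North]) (y # r)"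
      using \<kappa> w k by (auto simp: colorings_def open_vertices_North simp del: fun_upd_apply) auto
  qed
  show "(\<lambda>\<kappa>. \<kappa>(?k := undefined)) ` colorings (w @ [North]) (y # r) \<subseteq> colorings w r"
  proof (rule image_subsetI)
    fix \<kappa> assume \<kappa>: "\<kappa> \<in> colorings (w @ [North]) (y # r)"
    then have "\<kappa>(?k := undefined) \<in> {1..norths w} \<rightarrow>\<^sub>E {1..N}"
      by (auto simp: colorings_def PiE_def extensional_def Pi_def)
    moreover have "(\<kappa>(?k := undefined)) i \<noteq> (\<kappa>(?k := undefined)) j" if "(i, j) \<in> edges w" for i j
      using ek[OF that] \<kappa> that by (auto simp: colorings_def)
    ultimately show "\<kappa>(?k := undefined) \<in> colorings w r"
      using \<kappa> w k by (auto simp: colorings_def open_vertices_North simp del: fun_upd_apply)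
  qed
qed

theorem path_fn_colorings:
  assumes "above_diagonal w"
  shows "eqv (norths w - easts w) (path_fn x w) (\<lambda>c. \<Sum>\<kappa>\<in>colorings w c. coloring_wt x w \<kappa>)"
  using assms
proof (induction w rule: rev_induct)
  case Nil
  show ?case
    by (auto simp: eqv_def tuples_def colorings_def coloring_wt_def open_vertices_def)
next
  case (snoc s w)
  have w: "above_diagonal w" using snoc.prems above_diagonal_prefix by blast
  note le = above_diagonal_le[OF w] above_diagonal_le[OF snoc.prems]
  show ?case
  proof (cases s)
    case North
    then have k: "norths (w @ [s]) - easts (w @ [s]) = Suc (norths w - easts w)" using le by simp
    show ?thesis unfolding k
    proof (rule eqvI, erule tuples_SucE)
      fix c y r assume c: "c = y # r" "r \<in> tuples (norths w - easts w)" "y \<in> {1..N} - set r"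
      have "(\<Sum>\<kappa>\<in>colorings (w @ [s]) c. coloring_wt x (w @ [s]) \<kappa>) =
         (\<Sum>\<kappa>\<in>colorings w r. coloring_wt x (w @ [North]) (\<kappa>(Suc (norths w) := y)))"
        unfolding North c(1) by (rule sum.reindex_bij_betw[symmetric], rule colorings_North) (use w c in auto)
      also have "\<dots> = (\<Sum>\<kappa>\<in>colorings w r. new_wt x y r * coloring_wt x w \<kappa>)"
        using c by (intro sum.cong refl coloring_wt_North) (auto simp: tuples_def)
      also have "\<dots> = new_wt x y r * path_fn x w r"
        using eqvD[OF snoc.IH[OF w] c(2)] by (simp add: sum_distrib_left)
      finally show "path_fn x (w @ [s]) c = (\<Sum>\<kappa>\<in>colorings (w @ [s]) c. coloring_wt x (w @ [s]) \<kappa>)"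
        by (simp add: North c dplus_Cons)
    qed
  next
    case East
    then have k: "norths w - easts w = Suc (norths (w @ [s]) - easts (w @ [s]))" using le by simp
    show ?thesis
    proof (rule eqvI)
      fix r assume r: "r \<in> tuples (norths (w @ [s]) - easts (w @ [s]))"
      let ?S = "{1..N} - set r"
      have ov: "open_vertices w = open_vertices (w @ [East]) @ [Suc (easts w)]"
        using snoc.prems East by (intro open_vertices_East) simp
      have wt: "coloring_wt x (w @ [s]) \<kappa> = coloring_wt x w \<kappa>" for \<kappa>
        by (simp add: coloring_wt_def East)
      have un: "colorings (w @ [s]) r = (\<Union>b\<in>?S. colorings w (r @ [b]))"
      proof (intro set_eqI iffI)
        fix \<kappa> assume \<kappa>: "\<kappa> \<in> colorings (w @ [s]) r"
        then have mr: "map \<kappa> (open_vertices (w @ [East])) = r" by (simp add: colorings_def East)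
        let ?b = "\<kappa> (Suc (easts w))"
        have "?b \<in> {1..N}" using \<kappa> le East by (auto simp: colorings_def PiE_def Pi_def)
        moreover have "?b \<notin> set r"
        proof
          assume "?b \<in> set r"
          then obtain i where i: "i \<in> {Suc (easts w)<..norths w}" "?b = \<kappa> i"
            unfolding mr[symmetric] by (auto simp: set_open_vertices)
          then have "(Suc (easts w), i) \<in> edges w" by (intro open_vertices_adjacent) auto
          with \<kappa> i show False by (auto simp: colorings_def East)
        qed
        ultimately have "?b \<in> ?S" by simp
        moreover have "\<kappa> \<in> colorings w (r @ [?b])"
          using \<kappa> mr by (auto simp: colorings_def East ov)
        ultimately show "\<kappa> \<in> (\<Union>b\<in>?S. colorings w (r @ [b]))" by blast
      qed (auto simp: colorings_def East ov)
      have "(\<Sum>\<kappa>\<in>colorings (w @ [s]) r. coloring_wt x (w @ [s]) \<kappa>) =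
         (\<Sum>b\<in>?S. \<Sum>\<kappa>\<in>colorings w (r @ [b]). coloring_wt x w \<kappa>)"
        unfolding un wt
        by (rule sum.UNION_disjoint) (auto intro: finite_colorings, auto simp: colorings_def)
      also have "\<dots> = (\<Sum>b\<in>?S. path_fn x w (r @ [b]))"
        using r snoc.IH[OF w] by (intro sum.cong refl) (auto simp: k eqv_def tuples_snoc)
      finally show "path_fn x (w @ [s]) r = (\<Sum>\<kappa>\<in>colorings (w @ [s]) r. coloring_wt x (w @ [s]) \<kappa>)"
        by (simp add: East dminus_def)
    qed
  qed
qed

end

text \<open>A rook (a, b) is read as an arc from a to b. At most one arc leaves and at most one
  enters each vertex, so an arc set is a disjoint union of chains, which is what linked rooks that
  do not attack each other amount to.\<close>

definition arc_sets :: "step list \<Rightarrow> (nat \<times> nat) set set" where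
  "arc_sets w = {A. A \<subseteq> non_edges w \<and> single_valued A \<and> single_valued (A\<inverse>)}"

text \<open>
  Positions count from \<open>1\<close>, so that \<open>pos A i\<close> is the rank of the topmost extended rook in column \<open>i\<close>.
\<close>

definition pos :: "(nat \<times> nat) set \<Rightarrow> nat \<Rightarrow> nat" where
  "pos A i = card {j. (j, i) \<in> A\<^sup>*}"

text \<open>The closed chain ends, newest first. Arcs start at closed vertices, so every open vertex
  ends its chain as well.\<close>

definition lasts :: "(nat \<times> nat) set \<Rightarrow> nat \<Rightarrow> nat list" where
  "lasts A e = filter (\<lambda>i. i \<notin> Domain A) (rev [1..<Suc e])"

text \<open>The free cell condition in terms of positions. A leftmost rook (i', j) has rank
  \<open>pos A i'\<close> = \<open>pos A j\<close> - 1, which explains the \<open>Suc\<close>. If no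
  arc enters j, the leftmost cell is (j, j) of rank 0 and the comparison holds; if none leaves i,
  the topmost cell lies in the extended row.\<close>

definition free_arc :: "(nat \<times> nat) set \<Rightarrow> nat \<Rightarrow> nat \<Rightarrow> bool" where
  "free_arc A i j \<longleftrightarrow> (\<forall>j'. (i, j') \<in> A \<longrightarrow> j < j') \<and>
     (\<forall>i'. (i', j) \<in> A \<longrightarrow> i < i' \<and> pos A j \<le> Suc (pos A i) \<or> i' < i \<and> pos A j \<le> pos A i)"

definition free_arcs :: "step list \<Rightarrow> (nat \<times> nat) set \<Rightarrow> (nat \<times> nat) set" where
  "free_arcs w A = {(i, j) \<in> non_edges w. free_arc A i j}"

text \<open>On partitions this is the statistic \<open>n(\<mu>)\<close>.\<close>

fun min_stat :: "nat list \<Rightarrow> nat" where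
  "min_stat [] = 0"
| "min_stat (a # \<rho>) = sum_list (map (min a) \<rho>) + min_stat \<rho>"

text \<open>For the whole path this is the exponent of \<open>q\<close> in the theorem: area minus
  n(\<mu>) plus the number of free cells.\<close>

definition arc_stat :: "step list \<Rightarrow> (nat \<times> nat) set \<Rightarrow> int" where
  "arc_stat w A = int (card (edges w)) + int (card (free_arcs w A)) -
     int (min_stat (map (pos A) (open_vertices w @ lasts A (easts w))))"

lemma min_stat_append:
  "min_stat (\<alpha> @ \<beta>) = min_stat \<alpha> + min_stat \<beta> + (\<Sum>a\<leftarrow>\<alpha>. \<Sum>b\<leftarrow>\<beta>. min a b)"
  by (induction \<alpha>) (auto simp: algebra_simps)

lemma min_stat_move: "min_stat (\<alpha> @ d # \<beta>) = min_stat (d # \<alpha> @ \<beta>)"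
proof -
  have "(\<Sum>a\<leftarrow>\<alpha>. min a d) = sum_list (map (min d) \<alpha>)"
    by (induction \<alpha>) (auto simp: min.commute)
  then show ?thesis by (simp add: min_stat_append sum_list_addf)
qed

lemma min_stat_perm: "mset \<rho> = mset \<rho>' \<Longrightarrow> min_stat \<rho> = min_stat \<rho>'"
proof (induction \<rho> arbitrary: \<rho>')
  case (Cons a \<rho>)
  then have "a \<in> set \<rho>'" by (metis list.set_intros(1) set_mset_mset)
  then obtain \<alpha> \<beta> where \<rho>': "\<rho>' = \<alpha> @ a # \<beta>" by (meson split_list)
  with Cons.prems have m: "mset \<rho> = mset (\<alpha> @ \<beta>)" by simp
  then have "mset (map (min a) \<rho>) = mset (map (min a) (\<alpha> @ \<beta>))" by (metis mset_map)
  then have "sum_list (map (min a) \<rho>) = sum_list (map (min a) (\<alpha> @ \<beta>))" by (metis sum_mset_sum_list)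
  then show ?case using Cons.IH[OF m] unfolding \<rho>' min_stat_move by simp
qed simp

lemma sum_list_min_Suc:
  "sum_list (map (min (Suc d)) \<rho>) = sum_list (map (min d) \<rho>) + length (filter (\<lambda>b. d < b) \<rho>)"
  by (induction \<rho>) (auto simp: min_def)

lemma sum_list_min_1: "0 \<notin> set \<rho> \<Longrightarrow> sum_list (map (min 1) \<rho>) = length \<rho>"
proof (induction \<rho>)
  case (Cons a \<rho>)
  then show ?case by (cases a) auto
qed simp

lemma length_filter_le_less:
  "length (filter (\<lambda>b. b \<le> (d::nat)) \<eta>) + length (filter (\<lambda>b. d < b) \<eta>) = length \<eta>"
  by (induction \<eta>) auto

lemma count_list_map_distinct:
  "distinct xs \<Longrightarrow> count_list (map f xs) d = card {i \<in> set xs. f i = d}"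
proof -
  assume "distinct xs"
  moreover have "count_list (map f xs) d = length (filter (\<lambda>i. f i = d) xs)"
    by (induction xs) auto
  ultimately show ?thesis by (simp add: distinct_card[symmetric])
qed

lemma filter_neq_nth:
  assumes "distinct xs" "r < length xs"
  shows "filter (\<lambda>i. i \<noteq> xs ! r) xs = take r xs @ drop (Suc r) xs"
proof -
  have xs: "xs = take r xs @ xs ! r # drop (Suc r) xs" using assms by (simp add: id_take_nth_drop)
  define a where "a = xs ! r"
  have "distinct (take r xs @ a # drop (Suc r) xs)" using assms(1) xs a_def by simp
  then have "filter (\<lambda>i. i \<noteq> a) (take r xs) = take r xs" "filter (\<lambda>i. i \<noteq> a) (drop (Suc r) xs) = drop (Suc r) xs"
    by (auto intro!: filter_True)
  then have "filter (\<lambda>i. i \<noteq> a) (take r xs @ a # drop (Suc r) xs) = take r xs @ drop (Suc r) xs" by simp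
  then show ?thesis using xs unfolding a_def by simp
qed

lemma rtrancl_to_le:
  assumes "(j, i) \<in> A\<^sup>*" "\<And>a b. (a, b) \<in> A \<Longrightarrow> a < b"
  shows "j \<le> (i :: nat)"
  using assms(1) by (induction rule: rtrancl_induct) (auto dest: assms(2))

lemma finite_ancestors:
  assumes "finite A"
  shows "finite {j. (j, i) \<in> A\<^sup>*}"
proof (rule finite_subset)
  show "{j. (j, i) \<in> A\<^sup>*} \<subseteq> insert i (Domain A)" by (auto elim: converse_rtranclE)
qed (use assms in \<open>simp add: finite_Domain\<close>)

lemma pos_positive: "finite A \<Longrightarrow> pos A i \<ge> 1"
  unfolding pos_def using finite_ancestors[of A i] by (simp add: Suc_le_eq card_gt_0_iff) blast

lemma zero_notin_map_pos:
  assumes "finite A"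
  shows "0 \<notin> set (map (pos A) xs)"
proof
  assume "0 \<in> set (map (pos A) xs)"
  then obtain i where "pos A i = 0" by auto
  with pos_positive[OF assms, of i] show False by simp
qed

lemma pos_no_pred:
  assumes "i \<notin> Range A"
  shows "pos A i = 1"
proof -
  have "{j. (j, i) \<in> A\<^sup>*} = {i}" using assms by (auto elim: rtranclE)
  then show ?thesis by (simp add: pos_def)
qed

lemma pos_pred:
  assumes "single_valued (A\<inverse>)" "finite A" "(s, i) \<in> A" "\<And>a b. (a, b) \<in> A \<Longrightarrow> a < b"
  shows "pos A i = Suc (pos A s)"
proof -
  have "{j. (j, i) \<in> A\<^sup>*} = insert i {j. (j, s) \<in> A\<^sup>*}"
    using assms(1,3) by (auto elim: rtranclE dest: single_valuedD intro: rtrancl_into_rtrancl)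
  moreover have "i \<notin> {j. (j, s) \<in> A\<^sup>*}"
    using rtrancl_to_le[OF _ assms(4), of i s A] assms(3,4) by fastforce
  ultimately show ?thesis using finite_ancestors[OF assms(2)] by (simp add: pos_def)
qed

lemma pos_insert:
  assumes "i \<le> k" "\<And>a b. (a, b) \<in> A \<Longrightarrow> a < b"
  shows "pos (insert (s, Suc k) A) i = pos A i"
proof -
  have "(j, i) \<in> A\<^sup>*" if "(j, i) \<in> (insert (s, Suc k) A)\<^sup>*" "i \<le> k" for j i
    using that
  proof (induction rule: rtrancl_induct)
    case (step y z)
    then have "(y, z) \<in> A" by auto
    with step assms(2)[of y z] show ?case by (auto intro: rtrancl_into_rtrancl)
  qed simp
  moreover have "A\<^sup>* \<subseteq> (insert (s, Suc k) A)\<^sup>*" by (rule rtrancl_mono) auto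
  ultimately have "{j. (j, i) \<in> (insert (s, Suc k) A)\<^sup>*} = {j. (j, i) \<in> A\<^sup>*}"
    using assms(1) by blast
  then show ?thesis by (simp add: pos_def)
qed

lemma arc_sets_bounds:
  assumes "above_diagonal w" "A \<in> arc_sets w" "(a, b) \<in> A"
  shows "1 \<le> a" "a < b" "b \<le> norths w" "a \<le> easts w"
  using assms non_edges_bounds by (auto simp: arc_sets_def)

lemma finite_arc_set: "above_diagonal w \<Longrightarrow> A \<in> arc_sets w \<Longrightarrow> finite A"
  using finite_non_edges finite_subset by (auto simp: arc_sets_def)

lemma finite_arc_sets: "above_diagonal w \<Longrightarrow> finite (arc_sets w)"
  by (rule finite_subset[of _ "Pow (non_edges w)"]) (auto simp: arc_sets_def finite_non_edges)

lemma set_lasts: "set (lasts A e) = {1..e} - Domain A"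
  by (auto simp: lasts_def simp del: upt_Suc)

lemma distinct_lasts: "distinct (lasts A e)"
  by (simp add: lasts_def del: upt_Suc)

lemma sorted_lasts: "sorted_wrt (>) (lasts A e)"
  unfolding lasts_def by (rule sorted_wrt_filter) (simp add: sorted_wrt_rev del: upt_Suc)

lemma lasts_after_nth:
  assumes "r < length (lasts A e)"
  shows "set (drop (Suc r) (lasts A e)) = {i \<in> set (lasts A e). i < lasts A e ! r}"
proof -
  let ?L = "lasts A e"
  have L: "?L = take r ?L @ ?L ! r # drop (Suc r) ?L" using assms by (rule id_take_nth_drop)
  have "sorted_wrt (>) (take r ?L @ ?L ! r # drop (Suc r) ?L)" using sorted_lasts L by metis
  then have 1: "\<forall>i\<in>set (take r ?L). ?L ! r < i" "\<forall>i\<in>set (drop (Suc r) ?L). i < ?L ! r"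
    by (auto simp: sorted_wrt_append)
  have "set ?L = set (take r ?L) \<union> {?L ! r} \<union> set (drop (Suc r) ?L)" using L
    by (metis Un_insert_right list.simps(15) set_append sup_bot.right_neutral Un_insert_left)
  with 1 show ?thesis by auto
qed

lemma arc_sets_East [simp]: "arc_sets (w @ [East]) = arc_sets w"
  by (simp add: arc_sets_def)

lemma single_valued_insert:
  "single_valued (insert (a, b) A) \<longleftrightarrow> single_valued A \<and> (\<forall>c. (a, c) \<in> A \<longrightarrow> c = b)"
  by (auto simp: single_valued_def)

lemma converse_insert: "(insert (a, b) A)\<inverse> = insert (b, a) (A\<inverse>)"
  by auto

lemma arc_sets_North:
  assumes w: "above_diagonal w"
  shows "arc_sets (w @ [North]) = arc_sets w \<union>
    (\<lambda>(A, s). insert (s, Suc (norths w)) A) ` (SIGMA A:arc_sets w. set (lasts A (easts w)))"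
    (is "_ = _ \<union> ?g ` ?S")
proof (intro set_eqI iffI)
  let ?k = "Suc (norths w)"
  fix B assume B: "B \<in> arc_sets (w @ [North])"
  then have sub: "B \<subseteq> non_edges w \<union> {1..easts w} \<times> {?k}" and sv: "single_valued B" "single_valued (B\<inverse>)"
    by (auto simp: arc_sets_def)
  show "B \<in> arc_sets w \<union> ?g ` ?S"
  proof (cases "\<exists>s. (s, ?k) \<in> B")
    case True
    then obtain s where s: "(s, ?k) \<in> B" by blast
    let ?A = "B - {(s, ?k)}"
    have "?A \<subseteq> non_edges w"
    proof (rule subrelI)
      fix a b assume ab: "(a, b) \<in> ?A"
      then have "b \<noteq> ?k" using s sv(2) by (auto dest: single_valuedD)
      then show "(a, b) \<in> non_edges w" using sub ab by auto
    qed
    moreover have "single_valued ?A" "single_valued (?A\<inverse>)"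
      using sv by (auto simp: single_valued_def)
    ultimately have "?A \<in> arc_sets w" by (simp add: arc_sets_def)
    moreover have "s \<in> set (lasts ?A (easts w))"
      using s sub sv(1) non_edges_bounds[OF w] by (fastforce simp: set_lasts dest: single_valuedD)
    ultimately have "(?A, s) \<in> ?S" by auto
    moreover have "B = ?g (?A, s)" using s by auto
    ultimately show ?thesis by blast
  next
    case False
    then have "B \<subseteq> non_edges w" using sub by auto
    then show ?thesis using sv by (simp add: arc_sets_def)
  qed
next
  let ?k = "Suc (norths w)"
  fix B assume "B \<in> arc_sets w \<union> ?g ` ?S"
  then show "B \<in> arc_sets (w @ [North])"
  proof
    assume "B \<in> ?g ` ?S"
    then obtain A s where A: "A \<in> arc_sets w" "s \<in> {1..easts w} - Domain A" "B = insert (s, ?k) A"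
      by (auto simp: set_lasts)
    moreover have "(x, ?k) \<notin> A" for x using arc_sets_bounds(3)[OF w A(1), of x ?k] by auto
    ultimately show ?thesis
      by (auto simp: arc_sets_def single_valued_insert converse_insert)
  qed (auto simp: arc_sets_def)
qed

lemma sum_arc_sets_North:
  fixes h :: "(nat \<times> nat) set \<Rightarrow> 'a::comm_monoid_add"
  assumes w: "above_diagonal w"
  shows "(\<Sum>B\<in>arc_sets (w @ [North]). h B) = (\<Sum>A\<in>arc_sets w. h A +
    (\<Sum>r<length (lasts A (easts w)). h (insert (lasts A (easts w) ! r, Suc (norths w)) A)))"
proof -
  let ?k = "Suc (norths w)"
  let ?g = "\<lambda>(A, s). insert (s, ?k) A" and ?S = "SIGMA A:arc_sets w. set (lasts A (easts w))"
  have notin: "(x, ?k) \<notin> A" if "A \<in> arc_sets w" for A x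
    using arc_sets_bounds(3)[OF w that, of x ?k] by auto
  have inj: "inj_on ?g ?S"
  proof (rule inj_onI)
    fix p p' assume p: "p \<in> ?S" "p' \<in> ?S" and eq: "?g p = ?g p'"
    obtain A s A' s' where ps: "p = (A, s)" "p' = (A', s')" by fastforce
    with p eq have A: "A \<in> arc_sets w" "A' \<in> arc_sets w" "insert (s, ?k) A = insert (s', ?k) A'" by auto
    then have "s = s'" using notin by (metis insertE insertI1 prod.inject)
    moreover have "A = A'" using A notin by (metis \<open>s = s'\<close> insert_ident)
    ultimately show "p = p'" by (simp add: ps)
  qed
  have "(\<Sum>B\<in>arc_sets (w @ [North]). h B) = (\<Sum>A\<in>arc_sets w. h A) + (\<Sum>B\<in>?g ` ?S. h B)"
    unfolding arc_sets_North[OF w]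
    by (rule sum.union_disjoint) (use finite_arc_sets[OF w] notin in auto)
  also have "(\<Sum>B\<in>?g ` ?S. h B) = (\<Sum>(A, s)\<in>?S. h (insert (s, ?k) A))"
    by (subst sum.reindex[OF inj]) (auto intro!: sum.cong)
  also have "\<dots> = (\<Sum>A\<in>arc_sets w. \<Sum>s\<in>set (lasts A (easts w)). h (insert (s, ?k) A))"
    by (rule sum.Sigma[symmetric]) (use finite_arc_sets[OF w] in auto)
  also have "\<dots> = (\<Sum>A\<in>arc_sets w. \<Sum>r<length (lasts A (easts w)). h (insert (lasts A (easts w) ! r, ?k) A))"
  proof (rule sum.cong[OF refl])
    fix A
    show "(\<Sum>s\<in>set (lasts A (easts w)). h (insert (s, ?k) A)) =
        (\<Sum>r<length (lasts A (easts w)). h (insert (lasts A (easts w) ! r, ?k) A))"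
      by (rule sum.reindex_bij_betw[OF bij_betw_nth, symmetric]) (simp_all add: distinct_lasts)
  qed
  finally show ?thesis by (simp add: sum.distrib)
qed

text \<open>Without a link the new vertex adds an edge for each open vertex and, in its row, a free
  cell for each closed chain end; its length 1 raises \<open>min_stat\<close> by the number of both
  together.\<close>

lemma arc_stat_North:
  assumes w: "above_diagonal w" and A: "A \<in> arc_sets w"
  shows "arc_stat (w @ [North]) A = arc_stat w A"
proof -
  let ?k = "Suc (norths w)" and ?L = "lasts A (easts w)"
  note b = arc_sets_bounds[OF w A]
  have fin: "finite A" using finite_arc_set w A .
  have nk: "?k \<notin> Range A" using b(3) by force
  have "edges w \<inter> {easts w<..norths w} \<times> {?k} = {}" by (auto dest: edges_bounds)
  then have area: "card (edges (w @ [North])) = card (edges w) + length (open_vertices w)"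
    by (simp add: card_Un_disjoint finite_edges card_cartesian_product length_open_vertices)
  have "free_arc A i ?k \<longleftrightarrow> i \<notin> Domain A" for i
    using nk b(3) by (fastforce simp: free_arc_def)
  then have "free_arcs (w @ [North]) A = free_arcs w A \<union> set ?L \<times> {?k}"
    by (auto simp: free_arcs_def set_lasts)
  moreover have "free_arcs w A \<inter> set ?L \<times> {?k} = {}" by (auto simp: free_arcs_def dest: non_edges_bounds[OF w])
  moreover have "finite (free_arcs w A)" by (rule finite_subset[OF _ finite_non_edges[OF w]]) (auto simp: free_arcs_def)
  ultimately have fc: "card (free_arcs (w @ [North]) A) = card (free_arcs w A) + length ?L"
    by (simp add: card_Un_disjoint card_cartesian_product distinct_card distinct_lasts)
  let ?\<rho> = "map (pos A) (open_vertices w @ ?L)"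
  have "0 \<notin> set ?\<rho>" using zero_notin_map_pos[OF fin] .
  then have "min_stat (map (pos A) (open_vertices (w @ [North]) @ ?L)) = length ?\<rho> + min_stat ?\<rho>"
    using sum_list_min_1[of ?\<rho>] by (simp add: open_vertices_North[OF w] pos_no_pred[OF nk])
  then show ?thesis unfolding arc_stat_def area fc by simp
qed

text \<open>The increase of \<open>arc_stat\<close> is the exponent in
  \<open>dplus_state_fn\<close>. Let d be the length of the prolonged chain. The new edges count all
  open vertices, the new free cells count the closed ends of length above d and the ends older than
  s of length d, and raising d to d + 1 adds to \<open>min_stat\<close> the number of lengths above
  d, open or closed.\<close>

lemma arc_set_insert:
  assumes w: "above_diagonal w" and A: "A \<in> arc_sets w" and r: "r < length (lasts A (easts w))"
  defines "s \<equiv> lasts A (easts w) ! r" and "L \<equiv> lasts A (easts w)"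
  defines "A' \<equiv> insert (s, Suc (norths w)) A"
  shows "map (pos A') (open_vertices (w @ [North])) = Suc (pos A s) # map (pos A) (open_vertices w)"
    and "map (pos A') (lasts A' (easts w)) = take r (map (pos A) L) @ drop (Suc r) (map (pos A) L)"
    and "arc_stat (w @ [North]) A' = arc_stat w A +
      int (length (filter (\<lambda>b. b \<le> pos A s) (map (pos A) (open_vertices w))) +
        count_list (drop (Suc r) (map (pos A) L)) (pos A s))"
proof -
  let ?k = "Suc (norths w)"
  note b = arc_sets_bounds[OF w A]
  have fin: "finite A" using finite_arc_set w A .
  have le: "easts w \<le> norths w" using above_diagonal_le[OF w] .
  have sL: "s \<in> set L" using r by (simp add: s_def L_def)
  then have s: "1 \<le> s" "s \<le> easts w" "s \<notin> Domain A" by (auto simp: L_def set_lasts)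
  have "A' \<in> arc_sets (w @ [North])" using arc_sets_North[OF w] A sL by (auto simp: A'_def L_def)
  then have sv: "single_valued (A'\<inverse>)" by (simp add: arc_sets_def)
  have lt: "x < y" if "(x, y) \<in> A'" for x y using that b(2) s le by (auto simp: A'_def)
  have old: "pos A' i = pos A i" if "i \<le> norths w" for i
    unfolding A'_def using that b(2) by (rule pos_insert)
  have new: "pos A' ?k = Suc (pos A s)"
    using pos_pred[OF sv _ _ lt, of s ?k] fin old[of s] s le by (simp add: A'_def)
  have mo: "map (pos A') (open_vertices w) = map (pos A) (open_vertices w)"
    by (rule map_cong) (auto simp: set_open_vertices old)
  show ov: "map (pos A') (open_vertices (w @ [North])) = Suc (pos A s) # map (pos A) (open_vertices w)"
    using new mo by (simp add: open_vertices_North[OF w])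
  have "lasts A' (easts w) = filter (\<lambda>i. i \<noteq> s) L"
    unfolding L_def lasts_def by (auto simp: A'_def intro!: filter_cong simp del: upt_Suc)
  also have "\<dots> = take r L @ drop (Suc r) L"
    unfolding s_def L_def[symmetric] by (rule filter_neq_nth) (use r distinct_lasts in \<open>auto simp: L_def\<close>)
  finally have l': "lasts A' (easts w) = \<dots>" .
  have "map (pos A') (take r L @ drop (Suc r) L) = map (pos A) (take r L @ drop (Suc r) L)"
    using le by (intro map_cong refl old) (auto simp: L_def set_lasts dest!: in_set_takeD in_set_dropD)
  then show la: "map (pos A') (lasts A' (easts w)) = take r (map (pos A) L) @ drop (Suc r) (map (pos A) L)"
    unfolding l' by (simp add: take_map drop_map)
  let ?d = "pos A s"
  let ?\<eta> = "map (pos A) (open_vertices w)" and ?\<Lambda> = "map (pos A) L"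
  have \<Lambda>: "?\<Lambda> = take r ?\<Lambda> @ ?d # drop (Suc r) ?\<Lambda>"
    using r id_take_nth_drop[of r ?\<Lambda>] by (simp add: L_def s_def)
  have "edges w \<inter> {easts w<..norths w} \<times> {?k} = {}" by (auto dest: edges_bounds)
  then have area: "card (edges (w @ [North])) = card (edges w) + length ?\<eta>"
    by (simp add: card_Un_disjoint finite_edges card_cartesian_product length_open_vertices)
  \<comment> \<open>A chain end i < s gives a free cell from length d on, an end i > s only beyond
    d; the entries of L behind s are the smaller ones.\<close>
  let ?F = "{i \<in> set L. ?d < pos A i} \<union> {i \<in> set (drop (Suc r) L). pos A i = ?d}"
  have pk: "(x, ?k) \<in> A' \<longleftrightarrow> x = s" for x using b(3)[of x ?k] by (auto simp: A'_def)
  have f1: "free_arc A' i ?k \<longleftrightarrow> i \<in> ?F" if i: "i \<in> {1..easts w}" for i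
  proof -
    have "(\<forall>j'. (i, j') \<in> A' \<longrightarrow> ?k < j') \<longleftrightarrow> i \<in> set L \<and> i \<noteq> s"
    proof
      assume "\<forall>j'. (i, j') \<in> A' \<longrightarrow> ?k < j'"
      then have "i \<notin> Domain A" "i \<noteq> s" using b(3) by (fastforce simp: A'_def)+
      then show "i \<in> set L \<and> i \<noteq> s" using i by (simp add: L_def set_lasts)
    qed (auto simp: A'_def L_def set_lasts)
    moreover have "i \<le> norths w" using i le by simp
    moreover have "set (drop (Suc r) L) = {i \<in> set L. i < s}"
      unfolding L_def s_def by (rule lasts_after_nth[OF r])
    ultimately show ?thesis
      using old[of i] by (auto simp: free_arc_def pk new)
  qed
  have f2: "free_arc A' i j \<longleftrightarrow> free_arc A i j" if ij: "(i, j) \<in> non_edges w" for i j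
  proof -
    have "1 \<le> i" "i < j" "j \<le> norths w" using non_edges_bounds[OF w ij] by auto
    moreover from this have "(x, j) \<in> A' \<longleftrightarrow> (x, j) \<in> A" for x by (auto simp: A'_def)
    ultimately show ?thesis
      using old[of i] old[of j] by (auto simp: free_arc_def A'_def)
  qed
  have "?F \<subseteq> {1..easts w}" by (auto simp: L_def set_lasts dest!: in_set_dropD)
  then have "free_arcs (w @ [North]) A' = free_arcs w A \<union> ?F \<times> {?k}"
    using f1 f2 by (auto simp: free_arcs_def)
  moreover have "free_arcs w A \<inter> ?F \<times> {?k} = {}" by (auto simp: free_arcs_def dest: non_edges_bounds[OF w])
  moreover have "finite (free_arcs w A)" by (rule finite_subset[OF _ finite_non_edges[OF w]]) (auto simp: free_arcs_def)
  moreover have "card ?F = length (filter (\<lambda>b. ?d < b) ?\<Lambda>) + count_list (drop (Suc r) ?\<Lambda>) ?d"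
  proof -
    have dL: "distinct L" by (simp add: L_def distinct_lasts)
    have "card {i \<in> set L. ?d < pos A i} = length (filter (\<lambda>b. ?d < b) ?\<Lambda>)"
      using distinct_card[OF distinct_filter[OF dL], of "\<lambda>i. ?d < pos A i"] by (simp add: filter_map comp_def)
    moreover have "card {i \<in> set (drop (Suc r) L). pos A i = ?d} = count_list (drop (Suc r) ?\<Lambda>) ?d"
      using dL by (simp add: drop_map count_list_map_distinct)
    moreover have "card ?F = card {i \<in> set L. ?d < pos A i} + card {i \<in> set (drop (Suc r) L). pos A i = ?d}"
      by (rule card_Un_disjoint) auto
    ultimately show ?thesis by simp
  qed
  ultimately have fc: "card (free_arcs (w @ [North]) A') = card (free_arcs w A) +
      (length (filter (\<lambda>b. ?d < b) ?\<Lambda>) + count_list (drop (Suc r) ?\<Lambda>) ?d)"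
    by (simp add: card_Un_disjoint card_cartesian_product)
  let ?rest = "?\<eta> @ take r ?\<Lambda> @ drop (Suc r) ?\<Lambda>"
  have "min_stat (?\<eta> @ ?\<Lambda>) = min_stat ((?\<eta> @ take r ?\<Lambda>) @ ?d # drop (Suc r) ?\<Lambda>)"
    using \<Lambda> by simp
  also have "\<dots> = sum_list (map (min ?d) ?rest) + min_stat ?rest"
    unfolding min_stat_move by simp
  finally have m1: "min_stat (?\<eta> @ ?\<Lambda>) = \<dots>" .
  have "filter (\<lambda>b. ?d < b) ?\<Lambda> = filter (\<lambda>b. ?d < b) (take r ?\<Lambda> @ drop (Suc r) ?\<Lambda>)"
    by (subst \<Lambda>) simp
  then have m2: "min_stat (Suc ?d # ?rest) = min_stat (?\<eta> @ ?\<Lambda>) +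
      length (filter (\<lambda>b. ?d < b) ?\<eta>) + length (filter (\<lambda>b. ?d < b) ?\<Lambda>)"
    unfolding m1 min_stat.simps sum_list_min_Suc by simp
  have "arc_stat (w @ [North]) A' = int (card (edges w) + length ?\<eta>) +
      int (card (free_arcs w A) + (length (filter (\<lambda>b. ?d < b) ?\<Lambda>) + count_list (drop (Suc r) ?\<Lambda>) ?d)) -
      int (min_stat (Suc ?d # ?rest))"
    unfolding arc_stat_def area fc map_append using ov la by simp
  moreover have as: "arc_stat w A = int (card (edges w)) + int (card (free_arcs w A)) - int (min_stat (?\<eta> @ ?\<Lambda>))"
    by (simp add: arc_stat_def L_def)
  ultimately show "arc_stat (w @ [North]) A' = arc_stat w A +
      int (length (filter (\<lambda>b. b \<le> ?d) ?\<eta>) + count_list (drop (Suc r) ?\<Lambda>) ?d)"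
    unfolding m2 as using length_filter_le_less[of ?d ?\<eta>] by linarith
qed

context colour_tuples
begin

text \<open>A north step matches \<open>dplus_state_fn\<close> term by term, with r running through
  the closed ends to which the new vertex can be linked. An east step turns the last open vertex
  into the first closed end, which leaves the combined word of lengths as it is.\<close>

theorem path_fn_arc_sets:
  assumes "above_diagonal w"
  shows "eqv (norths w - easts w) (path_fn x w) (\<lambda>c. \<Sum>A\<in>arc_sets w. t powi arc_stat w A *
     state_fn x (map (pos A) (open_vertices w)) (map (pos A) (lasts A (easts w))) c)"
  using assms
proof (induction w rule: rev_induct)
  case Nil
  have "arc_sets [] = {{}}" by (auto simp: arc_sets_def)
  then show ?case
    by (simp add: eqv_def arc_stat_def free_arcs_def open_vertices_def lasts_def state_fn_def)
next
  case (snoc s w)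
  have w: "above_diagonal w" using snoc.prems above_diagonal_prefix by blast
  note le = above_diagonal_le[OF w] above_diagonal_le[OF snoc.prems]
  let ?\<eta> = "\<lambda>A. map (pos A) (open_vertices w)" and ?\<Lambda> = "\<lambda>A. map (pos A) (lasts A (easts w))"
  show ?case
  proof (cases s)
    case North
    let ?k = "Suc (norths w)"
    have k: "norths (w @ [s]) - easts (w @ [s]) = Suc (norths w - easts w)" using le North by simp
    show ?thesis unfolding k
    proof (rule eqvI)
      fix c assume c: "c \<in> tuples (Suc (norths w - easts w))"
      have exp: "t powi arc_stat w A * dplus x (state_fn x (?\<eta> A) (?\<Lambda> A)) c =
         t powi arc_stat (w @ [North]) A * state_fn x (map (pos A) (open_vertices (w @ [North]))) (map (pos A) (lasts A (easts w))) c +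
         (\<Sum>r<length (lasts A (easts w)). let A' = insert (lasts A (easts w) ! r, ?k) A in
           t powi arc_stat (w @ [North]) A' * state_fn x (map (pos A') (open_vertices (w @ [North]))) (map (pos A') (lasts A' (easts w))) c)"
        if A: "A \<in> arc_sets w" for A
      proof -
        have fin: "finite A" using finite_arc_set w A .
        have nk: "?k \<notin> Range A" using arc_sets_bounds(3)[OF w A] by force
        have "0 \<notin> set (?\<eta> A @ ?\<Lambda> A)" using zero_notin_map_pos[OF fin] by simp
        from dplus_state_fn[OF this, of x] c
        have "dplus x (state_fn x (?\<eta> A) (?\<Lambda> A)) c = state_fn x (1 # ?\<eta> A) (?\<Lambda> A) c +
          (\<Sum>r<length (?\<Lambda> A). t ^ (length (filter (\<lambda>b. b \<le> ?\<Lambda> A ! r) (?\<eta> A)) + count_list (drop (Suc r) (?\<Lambda> A)) (?\<Lambda> A ! r)) *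
            state_fn x (Suc (?\<Lambda> A ! r) # ?\<eta> A) (take r (?\<Lambda> A) @ drop (Suc r) (?\<Lambda> A)) c)"
          by (simp add: eqv_def length_open_vertices)
        then have "t powi arc_stat w A * dplus x (state_fn x (?\<eta> A) (?\<Lambda> A)) c =
          t powi arc_stat w A * state_fn x (1 # ?\<eta> A) (?\<Lambda> A) c +
          (\<Sum>r<length (?\<Lambda> A). t powi arc_stat w A * (t ^ (length (filter (\<lambda>b. b \<le> ?\<Lambda> A ! r) (?\<eta> A)) + count_list (drop (Suc r) (?\<Lambda> A)) (?\<Lambda> A ! r)) *
            state_fn x (Suc (?\<Lambda> A ! r) # ?\<eta> A) (take r (?\<Lambda> A) @ drop (Suc r) (?\<Lambda> A)) c))"
          by (simp only: distrib_left sum_distrib_left)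
        also have "t powi arc_stat w A * state_fn x (1 # ?\<eta> A) (?\<Lambda> A) c =
          t powi arc_stat (w @ [North]) A * state_fn x (map (pos A) (open_vertices (w @ [North]))) (map (pos A) (lasts A (easts w))) c"
          unfolding arc_stat_North[OF w A] open_vertices_North[OF w] by (simp add: pos_no_pred[OF nk])
        also have "(\<Sum>r<length (?\<Lambda> A). t powi arc_stat w A * (t ^ (length (filter (\<lambda>b. b \<le> ?\<Lambda> A ! r) (?\<eta> A)) + count_list (drop (Suc r) (?\<Lambda> A)) (?\<Lambda> A ! r)) *
            state_fn x (Suc (?\<Lambda> A ! r) # ?\<eta> A) (take r (?\<Lambda> A) @ drop (Suc r) (?\<Lambda> A)) c)) =
          (\<Sum>r<length (lasts A (easts w)). let A' = insert (lasts A (easts w) ! r, ?k) A in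
           t powi arc_stat (w @ [North]) A' * state_fn x (map (pos A') (open_vertices (w @ [North]))) (map (pos A') (lasts A' (easts w))) c)"
        proof (rule sum.cong)
          fix r assume "r \<in> {..<length (lasts A (easts w))}"
          then have r: "r < length (lasts A (easts w))" by simp
          show "t powi arc_stat w A * (t ^ (length (filter (\<lambda>b. b \<le> ?\<Lambda> A ! r) (?\<eta> A)) + count_list (drop (Suc r) (?\<Lambda> A)) (?\<Lambda> A ! r)) *
            state_fn x (Suc (?\<Lambda> A ! r) # ?\<eta> A) (take r (?\<Lambda> A) @ drop (Suc r) (?\<Lambda> A)) c) =
            (let A' = insert (lasts A (easts w) ! r, ?k) A in
           t powi arc_stat (w @ [North]) A' * state_fn x (map (pos A') (open_vertices (w @ [North]))) (map (pos A') (lasts A' (easts w))) c)"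
            unfolding Let_def arc_set_insert[OF w A r] nth_map[OF r]
            by (simp only: power_int_add[OF disjI1[OF t_nonzero]] power_int_of_nat mult.assoc)
        qed simp
        finally show ?thesis .
      qed
      have "path_fn x (w @ [s]) c = dplus x (\<lambda>c. \<Sum>A\<in>arc_sets w. t powi arc_stat w A * state_fn x (?\<eta> A) (?\<Lambda> A) c) c"
        using eqv_dplus[OF snoc.IH[OF w], of x] c North by (simp add: eqv_def)
      also have "\<dots> = (\<Sum>A\<in>arc_sets w. t powi arc_stat w A * dplus x (state_fn x (?\<eta> A) (?\<Lambda> A)) c)"
        by (simp add: dplus_sum dplus_scale)
      also have "\<dots> = (\<Sum>A\<in>arc_sets (w @ [North]). t powi arc_stat (w @ [North]) A *
         state_fn x (map (pos A) (open_vertices (w @ [North]))) (map (pos A) (lasts A (easts w))) c)"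
        unfolding sum_arc_sets_North[OF w] using exp by (intro sum.cong refl) (simp add: Let_def)
      finally show "path_fn x (w @ [s]) c = (\<Sum>A\<in>arc_sets (w @ [s]). t powi arc_stat (w @ [s]) A *
         state_fn x (map (pos A) (open_vertices (w @ [s]))) (map (pos A) (lasts A (easts (w @ [s])))) c)"
        by (simp add: North)
    qed
  next
    case East
    then have k: "norths w - easts w = Suc (norths (w @ [s]) - easts (w @ [s]))" using le by simp
    let ?e = "Suc (easts w)"
    have ov: "open_vertices w = open_vertices (w @ [East]) @ [?e]"
      using snoc.prems East by (intro open_vertices_East) simp
    have la: "lasts A ?e = ?e # lasts A (easts w)" if "A \<in> arc_sets w" for A
      using arc_sets_bounds(4)[OF w that] by (force simp: lasts_def)
    have st: "arc_stat (w @ [East]) A = arc_stat w A" if "A \<in> arc_sets w" for A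
      using la[OF that] ov by (simp add: arc_stat_def free_arcs_def)
    show ?thesis
    proof (rule eqvI)
      fix c assume c: "c \<in> tuples (norths (w @ [s]) - easts (w @ [s]))"
      have "path_fn x (w @ [s]) c = dminus (\<lambda>c. \<Sum>A\<in>arc_sets w. t powi arc_stat w A * state_fn x (?\<eta> A) (?\<Lambda> A) c) c"
        using eqv_dminus[OF snoc.IH[OF w, unfolded k]] c East by (simp add: eqv_def)
      also have "\<dots> = (\<Sum>A\<in>arc_sets w. t powi arc_stat w A * dminus (state_fn x (?\<eta> A) (?\<Lambda> A)) c)"
        by (simp add: dminus_sum dminus_scale)
      also have "\<dots> = (\<Sum>A\<in>arc_sets (w @ [s]). t powi arc_stat (w @ [s]) A *
         state_fn x (map (pos A) (open_vertices (w @ [s]))) (map (pos A) (lasts A (easts (w @ [s])))) c)"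
        using st la ov by (simp add: East dminus_state_fn cong: sum.cong)
      finally show "path_fn x (w @ [s]) c = \<dots>" .
    qed
  qed
qed

end

section \<open>Hall--Littlewood polynomials\<close>

lemma to_fract_sum: "to_fract (sum f A) = (\<Sum>a\<in>A. to_fract (f a))"
  by (induction A rule: infinite_finite_induct) auto

lemma to_fract_prod: "to_fract (prod f A) = (\<Prod>a\<in>A. to_fract (f a))"
  by (induction A rule: infinite_finite_induct) auto

lemma to_fract_power: "to_fract (x ^ n) = to_fract x ^ n"
  by (induction n) auto

lemma rf_const_eq: "rf_const c = to_fract (Poly_Mapping.single 0 c)"
  by (simp add: rf_const_def to_fract_def)

lemma rf_var_eq: "rf_var i = to_fract (Poly_Mapping.single (Poly_Mapping.single i 1) 1)"
  by (simp add: rf_var_def to_fract_def)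

lemma rf_const_0 [simp]: "rf_const 0 = 0" and rf_const_1 [simp]: "rf_const 1 = 1"
  by (simp_all add: rf_const_eq)

lemma rf_const_add: "rf_const (a + b) = rf_const a + rf_const b"
  by (simp add: rf_const_eq single_add)

lemma rf_const_mult: "rf_const (a * b) = rf_const a * rf_const b"
  by (simp add: rf_const_eq mult_single flip: to_fract_mult)

lemma rf_const_eq_iff [simp]: "rf_const a = rf_const b \<longleftrightarrow> a = b"
  by (simp add: rf_const_eq) (metis lookup_single_eq)

lemma rf_const_power: "rf_const (a ^ n) = rf_const a ^ n"
  by (induction n) (auto simp: rf_const_mult)

lemma rf_const_sum: "rf_const (sum f A) = (\<Sum>a\<in>A. rf_const (f a))"
  by (induction A rule: infinite_finite_induct) (auto simp: rf_const_add)

lemma rf_const_prod: "rf_const (prod f A) = (\<Prod>a\<in>A. rf_const (f a))"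
  by (induction A rule: infinite_finite_induct) (auto simp: rf_const_mult)

lemma rf_const_inverse: "rf_const (inverse a) = inverse (rf_const a)"
proof (cases "a = 0")
  case False
  then have "rf_const a * rf_const (inverse a) = 1" by (simp flip: rf_const_mult)
  then show ?thesis by (metis inverse_unique)
qed simp

lemma rf_const_power_int: "rf_const (a powi n) = rf_const a powi n"
  by (auto simp: power_int_def rf_const_power rf_const_inverse)

lemma inj_rf_var: "inj_on rf_var A"
proof (rule inj_onI)
  fix i j assume "rf_var i = rf_var j"
  then have "Poly_Mapping.single (Poly_Mapping.single i (1::nat)) (1::qfield) = Poly_Mapping.single (Poly_Mapping.single j 1) 1"
    by (simp add: rf_var_eq)
  then have "Poly_Mapping.single i (1::nat) = Poly_Mapping.single j 1"
    by (metis lookup_single_eq lookup_single_not_eq zero_neq_one)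
  then show "i = j"
    by (metis lookup_single_eq lookup_single_not_eq zero_neq_one)
qed

lemma q_eq: "q = to_fract [:0, 1:]"
  by (simp add: q_def to_fract_def)

lemma q_nonzero: "q \<noteq> 0"
  by (simp add: q_eq)

lemma q_int_nonzero:
  assumes "m \<ge> 1"
  shows "q_int m \<noteq> 0"
proof
  assume 0: "q_int m = 0"
  have "q_int m = to_fract (\<Sum>k<m. [:0, 1:] ^ k)"
    by (simp add: q_int_def q_eq to_fract_sum to_fract_power)
  with 0 have "(\<Sum>k<m. [:0, 1:] ^ k) = (0 :: rat poly)" by (metis to_fract_eq_0_iff)
  then have "poly (\<Sum>k<m. [:0, 1:] ^ k) 1 = (0 :: rat)" by simp
  then show False using assms by (simp add: poly_sum)
qed

lemma q_fact_nonzero: "q_fact m \<noteq> 0"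
  unfolding q_fact_def using q_int_nonzero by auto

lemma mult_q_fact_nonzero: "mult_q_fact \<mu> \<noteq> 0"
  by (simp add: mult_q_fact_def q_fact_nonzero)

text \<open>The padding zeros account for the factor \<open>t_fact (N - length \<mu>)\<close> in
  \<open>state_fn_symmetrization\<close>.\<close>

lemma mult_q_fact_pad:
  assumes "0 \<notin> set \<mu>"
  shows "mult_q_fact (pad N \<mu>) = mult_q_fact \<mu> * q_fact (N - length \<mu>)"
proof -
  have c: "count_list (replicate m (0::nat)) i = (if i = 0 then m else 0)" for m i
    by (induction m) auto
  show ?thesis
  proof (cases "N \<le> length \<mu>")
    case True
    then show ?thesis by (simp add: pad_def mult_q_fact_def q_fact_def)
  next
    case False
    then have "set (pad N \<mu>) = insert 0 (set \<mu>)" by (simp add: pad_def)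
    moreover have "count_list (pad N \<mu>) 0 = N - length \<mu>"
      using assms by (simp add: pad_def c count_list_0_iff)
    moreover have "count_list (pad N \<mu>) i = count_list \<mu> i" if "i \<in> set \<mu>" for i
      using assms that by (auto simp: pad_def c)
    ultimately show ?thesis using assms
      by (simp add: mult_q_fact_def mult.commute cong: prod.cong)
  qed
qed

interpretation hl: colour_tuples N "rf_const q" for N
  by standard (use q_nonzero rf_const_eq_iff[of q 0] in simp)

lemma rf_const_q_fact: "rf_const (q_fact m) = hl.t_fact m"
  by (simp add: q_fact_def q_int_def hl.t_fact_def hl.t_int_def rf_const_prod rf_const_sum rf_const_power)

lemma prod_pad_eq_word_mono:
  assumes "length \<mu> \<le> N"
  shows "(\<Prod>i=1..N. y i ^ (pad N \<mu> ! (i - 1))) = word_mono y [1..<Suc (length \<mu>)] \<mu>"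
proof -
  have "word_mono y [1..<Suc (length \<mu>)] \<mu> = (\<Prod>i<length \<mu>. y (Suc i) ^ (\<mu> ! i))"
    by (simp add: word_mono_def prod.list_conv_set_nth atLeast0LessThan del: upt_Suc)
  also have "\<dots> = (\<Prod>i<N. y (Suc i) ^ (pad N \<mu> ! i))"
    using assms by (intro prod.mono_neutral_cong_left) (auto simp: pad_def nth_append)
  also have "\<dots> = (\<Prod>i=1..N. y i ^ (pad N \<mu> ! (i - 1)))"
    by (rule prod.reindex_bij_witness[of _ "\<lambda>i. i - 1" Suc]) auto
  finally show ?thesis ..
qed

lemma hall_littlewood_rf_eq:
  assumes "sorted_wrt (\<ge>) \<mu>" "0 \<notin> set \<mu>" "length \<mu> \<le> N"
  shows "rf_const (mult_q_fact \<mu>) * hall_littlewood_rf N \<mu> = hl.state_fn N rf_var [] \<mu> []"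
proof -
  let ?S = "hl.sym_sum N 1 (\<lambda>x. word_mono x [1..<Suc (length \<mu>)] \<mu>) rf_var"
  have rf: "hall_littlewood_rf N \<mu> = rf_const (1 / mult_q_fact (pad N \<mu>)) * ?S"
    unfolding hall_littlewood_rf_def hl.sym_sum_def
    by (simp only: prod_pad_eq_word_mono[OF assms(3)] hl.ratio_def[abs_def] comp_def)
  have S: "?S = hl.state_fn N rf_var [] \<mu> [] * rf_const (q_fact (N - length \<mu>))"
    unfolding rf_const_q_fact by (rule hl.state_fn_symmetrization[symmetric]) (use assms inj_rf_var in auto)
  have "rf_const (mult_q_fact \<mu>) * hall_littlewood_rf N \<mu> =
    rf_const (mult_q_fact \<mu> * (1 / mult_q_fact (pad N \<mu>)) * q_fact (N - length \<mu>)) * hl.state_fn N rf_var [] \<mu> []"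
    unfolding rf S by (simp only: rf_const_mult mult_ac)
  also have "mult_q_fact \<mu> * (1 / mult_q_fact (pad N \<mu>)) * q_fact (N - length \<mu>) = 1"
    using mult_q_fact_pad[OF assms(2), of N] mult_q_fact_nonzero[of \<mu>] q_fact_nonzero by simp
  finally show ?thesis by simp
qed

section \<open>Polynomiality and stability of the Hall--Littlewood functions\<close>

definition polys :: "mpolynomial fract set" where
  "polys = range to_fract"

lemma polys_simps:
  "to_fract p \<in> polys" "0 \<in> polys" "1 \<in> polys" "rf_const c \<in> polys" "rf_var i \<in> polys"
  "a \<in> polys \<Longrightarrow> b \<in> polys \<Longrightarrow> a + b \<in> polys"
  "a \<in> polys \<Longrightarrow> b \<in> polys \<Longrightarrow> a - b \<in> polys"
  "a \<in> polys \<Longrightarrow> b \<in> polys \<Longrightarrow> a * b \<in> polys"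
proof -
  show 1: "to_fract p \<in> polys" for p by (simp add: polys_def)
  show "0 \<in> polys" using 1[of 0] by simp
  show "1 \<in> polys" using 1[of 1] by simp
  show "rf_const c \<in> polys" "rf_var i \<in> polys" by (simp_all add: rf_const_eq rf_var_eq 1)
  assume "a \<in> polys" "b \<in> polys"
  then obtain p p' where "a = to_fract p" "b = to_fract p'" by (auto simp: polys_def)
  then show "a + b \<in> polys" "a - b \<in> polys" "a * b \<in> polys"
    by (simp_all flip: to_fract_add to_fract_diff to_fract_mult add: 1)
qed

lemma polys_sum: "(\<And>a. a \<in> A \<Longrightarrow> f a \<in> polys) \<Longrightarrow> sum f A \<in> polys"
  by (induction A rule: infinite_finite_induct) (auto simp: polys_simps)

lemma polys_prod: "(\<And>a. a \<in> A \<Longrightarrow> f a \<in> polys) \<Longrightarrow> prod f A \<in> polys"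
  by (induction A rule: infinite_finite_induct) (auto simp: polys_simps)

text \<open>Each vertex contributes the variable of its colour, and the recursion has no
  denominators. So this also shows that the Hall--Littlewood functions are polynomials; the
  divisibility yields \<open>hall_littlewood_unused_variable\<close>.\<close>

lemma word_fn_divisible:
  assumes "c \<in> hl.tuples N (length \<rho>)"
  shows "\<exists>s\<in>polys. hl.word_fn N rf_var \<rho> c = (\<Prod>i\<in>set c. rf_var i) * s"
  using assms
proof (induction "rf_var" \<rho> arbitrary: c rule: hl.word_fn.induct)
  case 1
  then show ?case by (simp add: polys_simps hl.tuples_def)
next
  case (2 \<rho>)
  then show ?case by (auto intro: polys_simps)
next
  case (3 \<rho>)
  then obtain y r where c: "c = y # r" "r \<in> hl.tuples N (length \<rho>)" "y \<notin> set r"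
    by (auto elim!: hl.tuples_SucE)
  then obtain s where s: "s \<in> polys" "hl.word_fn N rf_var \<rho> r = (\<Prod>i\<in>set r. rf_var i) * s"
    using 3 by blast
  have "(\<Prod>b\<in>set r. hl.asc_wt b y) \<in> polys"
    by (rule polys_prod) (auto simp: hl.asc_wt_def polys_simps)
  then have "(\<Prod>b\<in>set r. hl.asc_wt b y) * s \<in> polys" using s polys_simps by blast
  moreover have "hl.word_fn N rf_var (Suc 0 # \<rho>) c = (\<Prod>i\<in>set c. rf_var i) * ((\<Prod>b\<in>set r. hl.asc_wt b y) * s)"
    using c s by (simp add: hl.dplus_Cons hl.new_wt_def algebra_simps)
  ultimately show ?case by blast
next
  case (4 d \<rho>)
  then obtain y r where c: "c = y # r" "r \<in> hl.tuples N (length \<rho>)" "y \<notin> set r"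
    by (auto elim!: hl.tuples_SucE)
  let ?S = "{1..N} - set r"
  have "\<forall>b\<in>?S. \<exists>s\<in>polys. hl.word_fn N rf_var (\<rho> @ [Suc d]) (r @ [b]) = (\<Prod>i\<in>set (r @ [b]). rf_var i) * s"
    using c by (intro ballI 4) (auto simp: hl.tuples_snoc)
  then obtain s where s: "\<And>b. b \<in> ?S \<Longrightarrow> s b \<in> polys"
    "\<And>b. b \<in> ?S \<Longrightarrow> hl.word_fn N rf_var (\<rho> @ [Suc d]) (r @ [b]) = (\<Prod>i\<in>set (r @ [b]). rf_var i) * s b"
    by metis
  define z where "z = (\<Prod>b\<in>set r. hl.asc_wt b y) * (\<Sum>b\<in>?S. hl.link b y * (rf_var b * s b))"
  have "(\<Prod>b\<in>set r. hl.asc_wt b y) \<in> polys"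
    by (rule polys_prod) (auto simp: hl.asc_wt_def polys_simps)
  moreover have "hl.link b y \<in> polys" for b by (simp add: hl.link_def polys_simps)
  ultimately have "z \<in> polys" unfolding z_def
    using s(1) by (intro polys_simps(8) polys_sum) (auto simp: polys_simps)
  moreover have "hl.word_fn N rf_var (Suc (Suc d) # \<rho>) c = (\<Prod>i\<in>set c. rf_var i) * z"
  proof -
    have "(\<Sum>b\<in>?S. hl.link b y * hl.word_fn N rf_var (\<rho> @ [Suc d]) (r @ [b])) =
      (\<Prod>i\<in>set r. rf_var i) * (\<Sum>b\<in>?S. hl.link b y * (rf_var b * s b))"
      unfolding sum_distrib_left by (intro sum.cong) (auto simp: s(2) mult_ac)
    then show ?thesis using c by (simp add: hl.Phi_Cons hl.new_wt_def z_def mult_ac)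
  qed
  ultimately show ?case by blast
qed

lemma dminus_pow_polys:
  assumes "\<And>c. c \<in> hl.tuples N (k + l) \<Longrightarrow> F c \<in> polys" "c \<in> hl.tuples N k"
  shows "(hl.dminus N ^^ l) F c \<in> polys"
  using assms
proof (induction l arbitrary: k c)
  case (Suc l)
  have "(hl.dminus N ^^ l) F (c @ [b]) \<in> polys" if "b \<in> {1..N} - set c" for b
    using that Suc.prems by (intro Suc.IH[of "Suc k"]) (auto simp: hl.tuples_snoc)
  then have "hl.dminus N ((hl.dminus N ^^ l) F) c \<in> polys"
    unfolding hl.dminus_def[of N "(hl.dminus N ^^ l) F" c] by (rule polys_sum)
  then show ?case by simp
qed auto

lemma Nil_tuples: "[] \<in> hl.tuples N 0"
  by (simp add: hl.tuples_def)

lemma state_fn_polys: "hl.state_fn N rf_var [] \<mu> [] \<in> polys"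
proof -
  have "hl.word_fn N rf_var \<mu> c \<in> polys" if "c \<in> hl.tuples N (length \<mu>)" for c
    using word_fn_divisible[OF that] by (auto intro!: polys_simps polys_prod)
  then have "(hl.dminus N ^^ length \<mu>) (hl.word_fn N rf_var \<mu>) [] \<in> polys"
    by (intro dminus_pow_polys[of N 0] Nil_tuples) auto
  then show ?thesis
    by (auto simp: hl.state_fn_def simp flip: rf_const_power_int intro!: polys_simps)
qed

lemma hall_littlewood_poly_eq:
  assumes "sorted_wrt (\<ge>) \<mu>" "0 \<notin> set \<mu>" "length \<mu> \<le> N"
  shows "to_fract (Poly_Mapping.single 0 (mult_q_fact \<mu>) * hall_littlewood_poly N \<mu>) = hl.state_fn N rf_var [] \<mu> []"
proof -
  have "rf_const (inverse (mult_q_fact \<mu>)) * (rf_const (mult_q_fact \<mu>) * hall_littlewood_rf N \<mu>) = hall_littlewood_rf N \<mu>"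
    using mult_q_fact_nonzero[of \<mu>] by (simp add: mult.assoc[symmetric] flip: rf_const_mult)
  then have "hall_littlewood_rf N \<mu> \<in> polys"
    unfolding hall_littlewood_rf_eq[OF assms] by (metis polys_simps(4,8) state_fn_polys)
  then obtain p where p: "to_fract p = hall_littlewood_rf N \<mu>" by (auto simp: polys_def)
  \<comment> \<open>The definite description is meaningful: a polynomial p exists, and it is unique
    because \<open>to_fract\<close> is injective.\<close>
  have "to_fract (hall_littlewood_poly N \<mu>) = hall_littlewood_rf N \<mu>"
    unfolding hall_littlewood_poly_def to_fract_def
    by (rule theI[of _ p]) (metis p to_fract_def to_fract_eq_iff)+
  then show ?thesis
    using hall_littlewood_rf_eq[OF assms] by (simp flip: rf_const_eq)
qed

lemma state_fn_too_long:
  assumes "N < length \<mu>"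
  shows "hl.state_fn N x [] \<mu> [] = 0"
proof -
  have "hl.tuples N (length \<mu>) = {}"
  proof (rule ccontr)
    assume "hl.tuples N (length \<mu>) \<noteq> {}"
    then obtain c where "distinct c" "length c = length \<mu>" "set c \<subseteq> {1..N}" by (auto simp: hl.tuples_def)
    then have "length \<mu> \<le> N" by (metis card_atLeastAtMost card_mono diff_Suc_1 distinct_card finite_atLeastAtMost)
    with assms show False by simp
  qed
  \<comment> \<open>There are no tuples to compare on, so any right-hand side will do; a product
    with 0 has the form of \<open>dminus_pow_scale\<close>.\<close>
  then have "hl.eqv N (0 + length \<mu>) (hl.word_fn N x \<mu>) (\<lambda>c. 0 * 0)"
    by (simp add: hl.eqv_def)
  from hl.eqv_dminus_pow[OF this]
  have "hl.eqv N 0 ((hl.dminus N ^^ length \<mu>) (hl.word_fn N x \<mu>)) (\<lambda>c. 0 * (hl.dminus N ^^ length \<mu>) (\<lambda>c. 0) c)"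
    by (simp only: hl.dminus_pow_scale)
  then show ?thesis
    using Nil_tuples by (simp add: hl.eqv_def hl.state_fn_def)
qed

lemma lookup_single_0_mult:
  "Poly_Mapping.lookup (Poly_Mapping.single 0 a * p) \<alpha> = a * Poly_Mapping.lookup p (\<alpha> :: monomial)"
  for a :: qfield
  by (simp flip: mult_map_scale_conv_mult add: map.rep_eq when_def)

text \<open>With as many variables as parts, every tuple uses all colours, so the polynomial is
  divisible by the last variable. Hence a partition with more parts than the largest index in a
  monomial does not contribute to its coefficient.\<close>

lemma hall_littlewood_unused_variable:
  assumes "sorted_wrt (\<ge>) \<mu>" "0 \<notin> set \<mu>" "length \<mu> > 0" "length \<mu> \<notin> Poly_Mapping.keys \<alpha>"
  shows "Poly_Mapping.lookup (hall_littlewood_poly (length \<mu>) \<mu>) \<alpha> = 0"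
proof -
  let ?l = "length \<mu>"
  have "\<exists>s\<in>polys. hl.word_fn ?l rf_var \<mu> c = rf_var ?l * s" if c: "c \<in> hl.tuples ?l ?l" for c
  proof -
    have "set c = {1..?l}"
      using c by (intro card_subset_eq) (auto simp: hl.tuples_def distinct_card)
    moreover obtain s where "s \<in> polys" "hl.word_fn ?l rf_var \<mu> c = (\<Prod>i\<in>set c. rf_var i) * s"
      using word_fn_divisible[OF c] by blast
    moreover have "{1..?l} = insert ?l {1..<?l}" using assms(3) by (auto simp: Suc_le_eq)
    ultimately have "hl.word_fn ?l rf_var \<mu> c = rf_var ?l * ((\<Prod>i\<in>{1..<?l}. rf_var i) * s)"
      "(\<Prod>i\<in>{1..<?l}. rf_var i) * s \<in> polys"
      by (auto simp: mult_ac intro!: polys_simps polys_prod)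
    then show ?thesis by blast
  qed
  then obtain s where s: "\<And>c. c \<in> hl.tuples ?l ?l \<Longrightarrow> s c \<in> polys"
    "\<And>c. c \<in> hl.tuples ?l ?l \<Longrightarrow> hl.word_fn ?l rf_var \<mu> c = rf_var ?l * s c" by metis
  have "hl.eqv ?l (0 + ?l) (hl.word_fn ?l rf_var \<mu>) (\<lambda>c. rf_var ?l * s c)"
    using s(2) by (simp add: hl.eqv_def)
  from hl.eqv_dminus_pow[OF this]
  have "(hl.dminus ?l ^^ ?l) (hl.word_fn ?l rf_var \<mu>) [] = rf_var ?l * (hl.dminus ?l ^^ ?l) s []"
    using Nil_tuples by (simp add: hl.eqv_def hl.dminus_pow_scale)
  moreover have "(hl.dminus ?l ^^ ?l) s [] \<in> polys"
    using s(1) by (intro dminus_pow_polys[of ?l 0] Nil_tuples) auto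
  ultimately have "\<exists>z\<in>polys. hl.state_fn ?l rf_var [] \<mu> [] = rf_var ?l * z"
    by (auto simp: hl.state_fn_def mult.left_commute simp flip: rf_const_power_int intro!: polys_simps)
  then obtain p where "hl.state_fn ?l rf_var [] \<mu> [] = rf_var ?l * to_fract p" by (auto simp: polys_def)
  then have "Poly_Mapping.single 0 (mult_q_fact \<mu>) * hall_littlewood_poly ?l \<mu> = Poly_Mapping.single (Poly_Mapping.single ?l 1) 1 * p"
    using hall_littlewood_poly_eq[OF assms(1,2) order_refl] by (simp add: rf_var_eq flip: to_fract_mult)
  then have "mult_q_fact \<mu> * Poly_Mapping.lookup (hall_littlewood_poly ?l \<mu>) \<alpha> =
    Poly_Mapping.lookup (Poly_Mapping.single (Poly_Mapping.single ?l 1) 1 * p) \<alpha>"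
    by (simp flip: lookup_single_0_mult)
  also have "\<alpha> \<notin> Poly_Mapping.keys (Poly_Mapping.single (Poly_Mapping.single ?l 1) 1 * p)"
  proof
    assume "\<alpha> \<in> Poly_Mapping.keys (Poly_Mapping.single (Poly_Mapping.single ?l 1) 1 * p)"
    then obtain \<beta> where "\<alpha> = Poly_Mapping.single ?l 1 + \<beta>"
      using keys_mult[of "Poly_Mapping.single (Poly_Mapping.single ?l 1) 1" p] by (auto split: if_splits)
    then have "Poly_Mapping.lookup \<alpha> ?l \<noteq> 0" by (simp add: lookup_add)
    with assms(4) show False by (simp add: in_keys_iff)
  qed
  then have "Poly_Mapping.lookup (Poly_Mapping.single (Poly_Mapping.single ?l 1) 1 * p) \<alpha> = 0"
    by (simp add: in_keys_iff)
  finally show ?thesis using mult_q_fact_nonzero by simp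
qed

section \<open>Linked rook placements and arc sets\<close>

lemma east_heights_append:
  "east_heights y (u @ v) = east_heights y u @ east_heights (y + norths u) v"
  by (induction y u rule: east_heights.induct) auto

lemma length_east_heights: "length (east_heights y w) = easts w"
  by (induction y w rule: east_heights.induct) auto

lemma east_heights_bounds: "h \<in> set (east_heights y w) \<Longrightarrow> y \<le> h \<and> h \<le> y + norths w"
  by (induction y w rule: east_heights.induct) auto

text \<open>Translates inequalities for column heights into the prefix decompositions by which
  \<open>edges\<close> and \<open>non_edges\<close> are defined: the east step of column i comes
  behind the north step of the row in question.\<close>

lemma col_height_split:
  assumes "w = u @ North # v" "1 \<le> i" "i \<le> easts w"
  shows "Suc (norths u) \<le> col_height w i \<longleftrightarrow> easts u < i"
proof (cases "i \<le> easts u")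
  case True
  then have "i - 1 < length (east_heights 0 u)" using assms by (simp add: length_east_heights)
  then have "col_height w i \<in> set (east_heights 0 u)"
    by (simp add: assms(1) col_height_def east_heights_append nth_append)
  then have "col_height w i \<le> norths u" using east_heights_bounds by fastforce
  with True show ?thesis by simp
next
  case False
  then have "\<not> i - 1 < easts u" "i - 1 - easts u < length (east_heights (Suc (norths u)) v)"
    using assms by (auto simp: length_east_heights)
  then have "col_height w i \<in> set (east_heights (Suc (norths u)) v)"
    by (simp add: assms(1) col_height_def east_heights_append nth_append length_east_heights)
  then have "Suc (norths u) \<le> col_height w i" using east_heights_bounds by blast
  with False show ?thesis by simp
qed

lemma split_at_north:
  "1 \<le> j \<Longrightarrow> j \<le> norths w \<Longrightarrow> \<exists>u v. w = u @ North # v \<and> Suc (norths u) = j"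
proof (induction w rule: rev_induct)
  case (snoc s w)
  show ?case
  proof (cases "j \<le> norths w")
    case True
    then obtain u v where "w = u @ North # v" "Suc (norths u) = j" using snoc by blast
    then have "w @ [s] = u @ North # (v @ [s])" "Suc (norths u) = j" by auto
    then show ?thesis by blast
  next
    case False
    then have "s = North" "j = Suc (norths w)" using snoc.prems by (auto split: if_splits)
    then show ?thesis by blast
  qed
qed simp

context
  fixes n :: nat and \<gamma> :: "step list"
  assumes \<gamma>: "\<gamma> \<in> dyck_paths n"
begin

lemma norths_dyck: "norths \<gamma> = n" and easts_dyck: "easts \<gamma> = n"
  using \<gamma> by (auto simp: dyck_paths_def)

lemma above_diagonal_dyck: "above_diagonal \<gamma>"
  unfolding above_diagonal_def
proof (intro allI impI)
  fix u v assume "\<gamma> = u @ v"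
  then have "u = take (length u) \<gamma>" "length u \<le> length \<gamma>" by auto
  then show "easts u \<le> norths u" using \<gamma> unfolding dyck_paths_def by (metis (mono_tags, lifting) mem_Collect_eq)
qed

lemma graph_edges_dyck: "graph_edges n \<gamma> = edges \<gamma>"
proof (intro set_eqI iffI; clarify)
  fix i j assume ij: "(i, j) \<in> graph_edges n \<gamma>"
  then obtain u v where u: "\<gamma> = u @ North # v" "Suc (norths u) = j"
    using split_at_north[of j \<gamma>] by (auto simp: graph_edges_def norths_dyck)
  then show "(i, j) \<in> edges \<gamma>"
    using col_height_split[OF u(1), of i] ij unfolding easts_dyck by (auto simp: graph_edges_def edges_def)
next
  fix i j assume ij: "(i, j) \<in> edges \<gamma>"
  then obtain u v where u: "\<gamma> = u @ North # v" "j = Suc (norths u)" "easts u < i" by (auto simp: edges_def)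
  then show "(i, j) \<in> graph_edges n \<gamma>"
    using col_height_split[OF u(1), of i] edges_bounds[OF ij] unfolding easts_dyck norths_dyck
    by (auto simp: graph_edges_def)
qed

lemma cells_above_dyck: "cells_above n \<gamma> = non_edges \<gamma>"
proof (intro set_eqI iffI; clarify)
  fix i j assume ij: "(i, j) \<in> cells_above n \<gamma>"
  then obtain u v where u: "\<gamma> = u @ North # v" "Suc (norths u) = j"
    using split_at_north[of j \<gamma>] by (auto simp: cells_above_def norths_dyck)
  then show "(i, j) \<in> non_edges \<gamma>"
    using col_height_split[OF u(1), of i] ij unfolding easts_dyck
    by (auto simp: cells_above_def non_edges_def)
next
  fix i j assume ij: "(i, j) \<in> non_edges \<gamma>"
  then obtain u v where u: "\<gamma> = u @ North # v" "j = Suc (norths u)" "i \<le> easts u" by (auto simp: non_edges_def)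
  then show "(i, j) \<in> cells_above n \<gamma>"
    using col_height_split[OF u(1), of i] non_edges_bounds[OF above_diagonal_dyck ij] unfolding easts_dyck norths_dyck
    by (auto simp: cells_above_def)
qed

lemma area_dyck: "area n \<gamma> = int (card (edges \<gamma>))"
proof -
  have h: "i \<le> col_height \<gamma> i \<and> col_height \<gamma> i \<le> n" if i: "i \<in> {1..n}" for i
  proof
    obtain u v where u: "\<gamma> = u @ North # v" "Suc (norths u) = i"
      using split_at_north[of i \<gamma>] i by (auto simp: norths_dyck)
    have "easts u \<le> norths u" using above_diagonal_dyck u(1) by (auto simp: above_diagonal_def)
    then have "Suc (norths u) \<le> col_height \<gamma> i"
      using col_height_split[OF u(1), of i] i u(2) easts_dyck by simp
    then show "i \<le> col_height \<gamma> i" using u(2) by simp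
    have "col_height \<gamma> i \<in> set (east_heights 0 \<gamma>)"
      unfolding col_height_def using i by (intro nth_mem) (auto simp: length_east_heights easts_dyck)
    then show "col_height \<gamma> i \<le> n" using east_heights_bounds norths_dyck by fastforce
  qed
  have "edges \<gamma> = (SIGMA i:{1..n}. {i<..col_height \<gamma> i})"
    unfolding graph_edges_dyck[symmetric] graph_edges_def using h by (fastforce intro: order_trans)
  then have "card (edges \<gamma>) = (\<Sum>i=1..n. col_height \<gamma> i - i)" by simp
  then show ?thesis unfolding area_def using h by (simp add: of_nat_diff)
qed

end

section \<open>Chains of an arc set and their extended rooks\<close>

definition anc :: "(nat \<times> nat) set \<Rightarrow> nat \<Rightarrow> nat list" where
  "anc A s = sorted_list_of_set {j. (j, s) \<in> A\<^sup>*}"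

text \<open>The linked rook with nodes \<open>anc A s\<close>; it is empty if no arc enters
  s.\<close>

definition arc_chain :: "(nat \<times> nat) set \<Rightarrow> nat \<Rightarrow> (nat \<times> nat) list" where
  "arc_chain A s = zip (anc A s) (tl (anc A s))"

lemma length_anc: "length (anc A s) = pos A s"
  by (simp add: anc_def pos_def)

lemma zip_tl_snoc: "xs \<noteq> [] \<Longrightarrow> zip (xs @ [s]) (tl (xs @ [s])) = zip xs (tl xs) @ [(last xs, s)]"
proof (induction xs)
  case (Cons a xs)
  then show ?case by (cases xs) auto
qed simp

locale arc_set =
  fixes n :: nat and A :: "(nat \<times> nat) set"
  assumes arc: "(a, b) \<in> A \<Longrightarrow> 1 \<le> a \<and> a < b \<and> b \<le> n"
    and sv: "single_valued A" and sv': "single_valued (A\<inverse>)"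
begin

lemma fin: "finite A"
  by (rule finite_subset[of _ "{..n} \<times> {..n}"]) (auto dest: arc)

lemma set_anc: "set (anc A s) = {j. (j, s) \<in> A\<^sup>*}"
  by (simp add: anc_def finite_ancestors fin)

lemma rtrancl_le: "(i, j) \<in> A\<^sup>* \<Longrightarrow> i \<le> j"
  by (rule rtrancl_to_le) (auto dest: arc)

lemma anc_pred:
  assumes "(s', s) \<in> A"
  shows "anc A s = anc A s' @ [s]"
proof -
  have e: "{j. (j, s) \<in> A\<^sup>*} = insert s {j. (j, s') \<in> A\<^sup>*}"
    using assms sv' by (auto elim: rtranclE dest: single_valuedD intro: rtrancl_into_rtrancl)
  have lt: "j < s" if "(j, s') \<in> A\<^sup>*" for j
    using rtrancl_le[OF that] arc[OF assms] by simp
  have fin': "finite {j. (j, s') \<in> A\<^sup>*}" by (rule finite_ancestors[OF fin])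
  define X where "X = {j. (j, s') \<in> A\<^sup>*}"
  define l where "l = sorted_list_of_set X"
  have l: "sorted l" "distinct l" "set l = X" using fin' by (auto simp: l_def X_def)
  have "set (sorted_list_of_set (insert s X)) = insert s X"
    using fin' by (intro set_sorted_list_of_set) (simp add: X_def)
  moreover have "sorted (l @ [s])" "distinct (l @ [s])" "set (l @ [s]) = insert s X"
    using l lt by (auto simp: sorted_append X_def intro: less_imp_le)
  ultimately have "sorted_list_of_set (insert s X) = l @ [s]"
    by (intro sorted_distinct_set_unique sorted_sorted_list_of_set distinct_sorted_list_of_set) auto
  then show ?thesis by (simp add: anc_def e X_def l_def)
qed

lemma anc_no_pred:
  assumes "s \<notin> Range A"
  shows "anc A s = [s]"
proof -
  have "{j. (j, s) \<in> A\<^sup>*} = {s}" using assms by (auto elim: rtranclE)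
  then show ?thesis by (simp add: anc_def)
qed

lemma anc_not_Nil: "anc A s \<noteq> []" and last_anc: "last (anc A s) = s"
  by (cases "s \<in> Range A"; auto simp: anc_no_pred anc_pred)+

lemma arc_chain_pred: "(s', s) \<in> A \<Longrightarrow> arc_chain A s = arc_chain A s' @ [(s', s)]"
  by (simp only: arc_chain_def anc_pred zip_tl_snoc[OF anc_not_Nil] last_anc)

lemma arc_chain_no_pred: "s \<notin> Range A \<Longrightarrow> arc_chain A s = []"
  by (simp add: arc_chain_def anc_no_pred)

lemma arc_chain_eq_Nil: "arc_chain A s = [] \<longleftrightarrow> s \<notin> Range A"
  by (cases "s \<in> Range A") (auto simp: arc_chain_no_pred arc_chain_pred)

lemma pred_induct [case_names no_pred pred]:
  assumes "\<And>s. s \<notin> Range A \<Longrightarrow> Q s" "\<And>s s'. (s', s) \<in> A \<Longrightarrow> Q s' \<Longrightarrow> Q s"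
  shows "Q s"
proof (induction s rule: less_induct)
  case (less s)
  then show ?case using assms arc by (cases "s \<in> Range A") blast+
qed

lemma arc_chain_subset: "set (arc_chain A s) \<subseteq> A"
  by (induction s rule: pred_induct) (auto simp: arc_chain_no_pred arc_chain_pred)

lemma arc_chain_ancestors: "(a, b) \<in> set (arc_chain A s) \<Longrightarrow> (a, s) \<in> A\<^sup>* \<and> (b, s) \<in> A\<^sup>*"
proof -
  assume ab: "(a, b) \<in> set (arc_chain A s)"
  then have "a \<in> set (anc A s)" by (auto simp: arc_chain_def dest: set_zip_leftD)
  moreover have "b \<in> set (tl (anc A s))" using ab by (auto simp: arc_chain_def dest: set_zip_rightD)
  then have "b \<in> set (anc A s)" by (rule list.set_sel(2)[OF anc_not_Nil])
  ultimately show ?thesis by (simp add: set_anc)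
qed

lemma arc_in_chain:
  assumes "(i, j) \<in> A" "(j, s) \<in> A\<^sup>*"
  shows "(i, j) \<in> set (arc_chain A s)"
  using assms(2,1) by (induction rule: rtrancl_induct) (auto simp: arc_chain_pred)

lemma nodes_arc_chain:
  assumes "s \<in> Range A"
  shows "nodes (arc_chain A s) = anc A s"
proof -
  from assms have l: "length (anc A s) \<ge> 2"
    using anc_pred anc_not_Nil by (auto simp: Suc_le_eq numeral_2_eq_2)
  then obtain a b ns where ns: "anc A s = a # b # ns"
    by (metis Suc_le_length_iff numeral_2_eq_2)
  have "map snd (zip xs (tl xs)) = tl xs" for xs :: "nat list" by (simp add: map_snd_zip_take)
  then have "map snd (arc_chain A s) = tl (anc A s)" by (simp only: arc_chain_def)
  then show ?thesis by (simp add: nodes_def) (simp add: arc_chain_def ns)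
qed

lemma arc_chain_linked: "Suc m < length (arc_chain A s) \<Longrightarrow> snd (arc_chain A s ! m) = fst (arc_chain A s ! Suc m)"
  by (simp add: arc_chain_def nth_tl)

lemma ex_last:
  assumes "i \<in> {1..n}"
  shows "\<exists>s\<in>set (lasts A n). (i, s) \<in> A\<^sup>*"
  using assms
proof (induction "n - i" arbitrary: i rule: less_induct)
  case less
  show ?case
  proof (cases "i \<in> Domain A")
    case True
    then obtain j where j: "(i, j) \<in> A" by blast
    with arc[OF j] less obtain s where "s \<in> set (lasts A n)" "(j, s) \<in> A\<^sup>*"
      by (metis atLeastAtMost_iff diff_less_mono2 le_trans less_imp_le less_le_trans)
    with j show ?thesis by (meson converse_rtrancl_into_rtrancl)
  next
    case False
    then show ?thesis using less.prems by (auto simp: set_lasts)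
  qed
qed

lemma last_unique:
  assumes "(i, s) \<in> A\<^sup>*" "(i, s') \<in> A\<^sup>*" "s \<notin> Domain A" "s' \<notin> Domain A"
  shows "s = s'"
  using single_valued_confluent[OF sv assms(1,2)] assms(3,4) by (auto elim: converse_rtranclE)

lemma pos_anc_nth: "m < length (anc A s) \<Longrightarrow> pos A (anc A s ! m) = Suc m"
proof (induction s rule: pred_induct)
  case (no_pred s)
  then show ?case by (simp add: anc_no_pred pos_no_pred)
next
  case (pred s s')
  then have "pos A s = Suc (pos A s')" using pos_pred[OF sv' fin] arc by blast
  with pred show ?case by (auto simp: anc_pred nth_append length_anc less_Suc_eq)
qed

lemma arc_anc_nth: "Suc m < length (anc A s) \<Longrightarrow> (anc A s ! m, anc A s ! Suc m) \<in> A"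
proof (induction s rule: pred_induct)
  case (no_pred s)
  then show ?case by (simp add: anc_no_pred)
next
  case (pred s s')
  show ?case
  proof (cases "Suc m < length (anc A s')")
    case True
    then show ?thesis using pred by (simp add: anc_pred nth_append)
  next
    case False
    then have m: "Suc m = length (anc A s')" using pred by (simp add: anc_pred)
    then have "anc A s' ! m = s'" using last_anc[of s'] anc_not_Nil[of s'] by (simp add: last_conv_nth flip: m)
    with pred m show ?thesis by (simp add: anc_pred nth_append)
  qed
qed

lemma anc_nth_pos:
  assumes "(i, s) \<in> A\<^sup>*"
  shows "pos A i \<le> length (anc A s)" "anc A s ! (pos A i - 1) = i" "1 \<le> pos A i"
proof -
  have "i \<in> set (anc A s)" using assms by (simp add: set_anc)
  then obtain m where "m < length (anc A s)" "anc A s ! m = i" by (auto simp: in_set_conv_nth)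
  with pos_anc_nth show "pos A i \<le> length (anc A s)" "anc A s ! (pos A i - 1) = i" "1 \<le> pos A i" by fastforce+
qed

end

lemma length_extended_rook: "length (extended_rook n ns) = 2 * length ns"
  by (induction n ns rule: extended_rook.induct) auto

lemma extended_rook_nth:
  assumes "m < length ns"
  shows "extended_rook n ns ! (2 * m) = (ns ! m, ns ! m)"
    "extended_rook n ns ! Suc (2 * m) = (ns ! m, if Suc m < length ns then ns ! Suc m else n + 1)"
  using assms
proof (induction n ns arbitrary: m rule: extended_rook.induct)
  case (3 n c d cs)
  {
    case 1
    then show ?case using 3(1)[of "m - 1"] by (cases m) auto
  next
    case 2
    then show ?case using 3(2)[of "m - 1"] by (cases m) auto
  }
qed auto

lemma extended_rook_eq_Nil [simp]: "extended_rook n ns = [] \<longleftrightarrow> ns = []"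
  by (cases "(n, ns)" rule: extended_rook.cases) auto

lemma last_extended_rook: "ns \<noteq> [] \<Longrightarrow> last (extended_rook n ns) = (last ns, n + 1)"
  by (induction n ns rule: extended_rook.induct) auto

context arc_set
begin

text \<open>The placement with arc set \<open>A\<close> enters below only through its extended placement.\<close>

context
  fixes P :: "(nat \<times> nat) list set"
  assumes P: "ext n P = (\<lambda>s. extended_rook n (anc A s)) ` set (lasts A n)"
begin

lemma placement_type_eq: "placement_type n P = rev (sort (map (pos A) (lasts A n)))"
proof -
  have inj: "inj_on (\<lambda>s. extended_rook n (anc A s)) (set (lasts A n))"
    by (rule inj_onI) (metis anc_not_Nil last_anc last_extended_rook prod.inject)
  have "image_mset (\<lambda>U. length U div 2) (mset_set (ext n P)) = mset (map (pos A) (lasts A n))"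
    unfolding P image_mset_mset_set[OF inj, symmetric]
    by (simp add: image_mset.compositionality comp_def length_extended_rook length_anc mset_set_set distinct_lasts)
  then show ?thesis unfolding placement_type_def by (simp only: sorted_list_of_multiset_mset)
qed

text \<open>The left-hand side is the description inside \<open>ext_rank\<close>, so ranks can be
  read off from it; with the rank left open it also gives the cells of the extended
  placement.\<close>

lemma ranked_cell_iff:
  "(\<exists>U\<in>ext n P. \<exists>m\<in>{1..length U}. U ! (m - 1) = u \<and> r = m div 2) \<longleftrightarrow>
   (\<exists>i\<in>{1..n}. u = (i, i) \<and> r = pos A i - 1 \<or>
      r = pos A i \<and> ((\<exists>j. u = (i, j) \<and> (i, j) \<in> A) \<or> u = (i, n + 1) \<and> i \<notin> Domain A))" (is "?L \<longleftrightarrow> ?R")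
proof
  assume ?L
  then obtain s m where s: "s \<in> set (lasts A n)" and m: "m \<in> {1..length (extended_rook n (anc A s))}"
    and u: "extended_rook n (anc A s) ! (m - 1) = u" and r: "r = m div 2"
    unfolding P by auto
  let ?ns = "anc A s"
  \<comment> \<open>The cells with numbers 2h + 1 and 2h + 2, counted from 1, lie in the column of
    the node with index h, counted from 0.\<close>
  define h where "h = (m - 1) div 2"
  have h: "h < length ?ns" using m by (auto simp: h_def length_extended_rook)
  let ?i = "?ns ! h"
  have "(?i, s) \<in> A\<^sup>*" using h set_anc[of s] nth_mem by blast
  then have "?i \<le> n" "1 \<le> ?i"
    using rtrancl_le[of ?i s] s arc by (auto simp: set_lasts elim: converse_rtranclE)
  then have i: "?i \<in> {1..n}" by simp
  have p: "pos A ?i = Suc h" using pos_anc_nth[OF h] .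
  have "1 \<le> m" using m by simp
  then have "m = Suc (2 * h) \<or> m = Suc (Suc (2 * h))" unfolding h_def by presburger
  then consider "m - 1 = 2 * h" "r = h" | "m - 1 = Suc (2 * h)" "r = Suc h"
    using r by auto
  then show ?R
  proof cases
    case 1
    then have "u = (?i, ?i)" using extended_rook_nth(1)[OF h] u by simp
    then show ?thesis using i p 1 by force
  next
    case 2
    show ?thesis
    proof (cases "Suc h < length ?ns")
      case True
      then have "u = (?i, ?ns ! Suc h)" using extended_rook_nth(2)[OF h] u 2 by simp
      then show ?thesis using i p 2 arc_anc_nth[OF True] by force
    next
      case False
      then have "Suc h = length ?ns" using h by simp
      then have "?i = s" using last_anc[of s] anc_not_Nil[of s] by (simp add: last_conv_nth flip: \<open>Suc h = _\<close>)
      moreover have "u = (?i, n + 1)" using extended_rook_nth(2)[OF h] u 2 False by simp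
      ultimately show ?thesis using i p 2 s by (force simp: set_lasts)
    qed
  qed
next
  assume ?R
  then obtain i where i: "i \<in> {1..n}" and u: "u = (i, i) \<and> r = pos A i - 1 \<or>
      r = pos A i \<and> ((\<exists>j. u = (i, j) \<and> (i, j) \<in> A) \<or> u = (i, n + 1) \<and> i \<notin> Domain A)" by blast
  obtain s where s: "s \<in> set (lasts A n)" "(i, s) \<in> A\<^sup>*" using ex_last[OF i] by blast
  let ?ns = "anc A s"
  define h where "h = pos A i - 1"
  have h: "h < length ?ns" "?ns ! h = i" "pos A i = Suc h"
    using anc_nth_pos[OF s(2)] by (auto simp: h_def)
  have U: "extended_rook n ?ns \<in> ext n P" using s by (auto simp: P)
  from u show ?L
  proof (elim disjE conjE exE)
    assume "u = (i, i)" "r = pos A i - 1"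
    then have "extended_rook n ?ns ! (Suc (2 * h) - 1) = u" "r = Suc (2 * h) div 2" "Suc (2 * h) \<in> {1..length (extended_rook n ?ns)}"
      using extended_rook_nth(1)[OF h(1)] h by (auto simp: length_extended_rook)
    then show ?L using U by blast
  next
    fix j assume j: "r = pos A i" "u = (i, j)" "(i, j) \<in> A"
    have "Suc h < length ?ns"
    proof (rule ccontr)
      assume "\<not> Suc h < length ?ns"
      then have "Suc h = length ?ns" using h by simp
      then have "i = s" using h last_anc[of s] anc_not_Nil[of s] by (simp add: last_conv_nth flip: \<open>Suc h = _\<close>)
      with s j show False by (auto simp: set_lasts)
    qed
    moreover from this have "?ns ! Suc h = j" using arc_anc_nth[of h s] h j sv by (auto dest: single_valuedD)
    ultimately have "extended_rook n ?ns ! (Suc (Suc (2 * h)) - 1) = u" "r = Suc (Suc (2 * h)) div 2"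
      "Suc (Suc (2 * h)) \<in> {1..length (extended_rook n ?ns)}"
      using extended_rook_nth(2)[OF h(1)] h j by (auto simp: length_extended_rook)
    then show ?L using U by blast
  next
    assume j: "r = pos A i" "u = (i, n + 1)" "i \<notin> Domain A"
    then have "i = s" using last_unique[of i i s] s by (auto simp: set_lasts)
    have "\<not> Suc h < length ?ns"
    proof
      assume "Suc h < length ?ns"
      from arc_anc_nth[OF this] h j show False by auto
    qed
    then have "extended_rook n ?ns ! (Suc (Suc (2 * h)) - 1) = u" "r = Suc (Suc (2 * h)) div 2"
      "Suc (Suc (2 * h)) \<in> {1..length (extended_rook n ?ns)}"
      using extended_rook_nth(2)[OF h(1)] h j by (auto simp: length_extended_rook)
    then show ?L using U by blast
  qed
qed

lemma ext_cells_eq: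
  "u \<in> ext_cells n P \<longleftrightarrow> (\<exists>i\<in>{1..n}. u = (i, i) \<or> (\<exists>j. u = (i, j) \<and> (i, j) \<in> A) \<or> u = (i, n + 1) \<and> i \<notin> Domain A)"
proof -
  have "u \<in> ext_cells n P \<longleftrightarrow> (\<exists>r. \<exists>U\<in>ext n P. \<exists>m\<in>{1..length U}. U ! (m - 1) = u \<and> r = m div 2)"
  proof
    assume "u \<in> ext_cells n P"
    then obtain U m where "U \<in> ext n P" "m < length U" "U ! m = u"
      by (auto simp: ext_cells_def in_set_conv_nth)
    then have "U \<in> ext n P" "Suc m \<in> {1..length U}" "U ! (Suc m - 1) = u" by auto
    then show "\<exists>r. \<exists>U\<in>ext n P. \<exists>m\<in>{1..length U}. U ! (m - 1) = u \<and> r = m div 2" by blast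
  next
    assume "\<exists>r. \<exists>U\<in>ext n P. \<exists>m\<in>{1..length U}. U ! (m - 1) = u \<and> r = m div 2"
    then obtain U m where U: "U \<in> ext n P" "m \<in> {1..length U}" "U ! (m - 1) = u" by blast
    then have "U ! (m - 1) \<in> set U" by (intro nth_mem) auto
    then show "u \<in> ext_cells n P" using U by (auto simp: ext_cells_def)
  qed
  then show ?thesis unfolding ranked_cell_iff by blast
qed

lemma ext_rank_diag: "i \<in> {1..n} \<Longrightarrow> ext_rank n P (i, i) = pos A i - 1"
  unfolding ext_rank_def ranked_cell_iff by (rule the_equality) (auto dest: arc)

lemma ext_rank_arc: "(i, j) \<in> A \<Longrightarrow> ext_rank n P (i, j) = pos A i"
  unfolding ext_rank_def ranked_cell_iff by (rule the_equality) (use arc in fastforce)+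

lemma ext_rank_last: "i \<in> {1..n} \<Longrightarrow> i \<notin> Domain A \<Longrightarrow> ext_rank n P (i, n + 1) = pos A i"
  unfolding ext_rank_def ranked_cell_iff by (rule the_equality) (use arc in fastforce)+

lemma top_row_arc:
  assumes "(i, j) \<in> A"
  shows "top_row n P i = j"
proof -
  have "{j'. (i, j') \<in> ext_cells n P} = {i, j}"
    using assms arc[OF assms] sv by (auto simp: ext_cells_eq dest: single_valuedD)
  then show ?thesis using arc[OF assms] by (simp add: top_row_def)
qed

lemma top_row_last:
  assumes "i \<in> {1..n}" "i \<notin> Domain A"
  shows "top_row n P i = n + 1"
proof -
  have "{j'. (i, j') \<in> ext_cells n P} = {i, n + 1}"
    using assms by (auto simp: ext_cells_eq)
  then show ?thesis using assms by (simp add: top_row_def)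
qed

lemma left_col_arc:
  assumes "(i, j) \<in> A"
  shows "left_col n P j = i"
proof -
  have "{i'. (i', j) \<in> ext_cells n P} = {i, j}"
    using assms arc[OF assms] sv' by (auto simp: ext_cells_eq dest: single_valuedD)
  then show ?thesis using arc[OF assms] by (simp add: left_col_def)
qed

lemma left_col_first:
  assumes "j \<in> {1..n}" "j \<notin> Range A"
  shows "left_col n P j = j"
proof -
  have "{i'. (i', j) \<in> ext_cells n P} = {j}"
    using assms by (auto simp: ext_cells_eq)
  then show ?thesis by (simp add: left_col_def)
qed

lemma free_cells_eq: "free_cells n \<gamma> P = {(i, j) \<in> cells_above n \<gamma>. free_arc A i j}"
proof -
  have "(let j' = top_row n P i; i' = left_col n P j; a = ext_rank n P (i, j'); b = ext_rank n P (i', j)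
     in j < j' \<and> (i < i' \<and> b \<le> a \<or> i' < i \<and> b < a)) \<longleftrightarrow> free_arc A i j"
    if "(i, j) \<in> cells_above n \<gamma>" for i j
  proof -
    have ij: "1 \<le> i" "i < j" "j \<le> n" using that by (auto simp: cells_above_def)
    have a: "ext_rank n P (i, top_row n P i) = pos A i"
    proof (cases "i \<in> Domain A")
      case True
      then show ?thesis using top_row_arc ext_rank_arc by force
    next
      case False
      then show ?thesis using top_row_last[of i] ext_rank_last[of i] ij by simp
    qed
    have t: "j < top_row n P i \<longleftrightarrow> (\<forall>j'. (i, j') \<in> A \<longrightarrow> j < j')"
    proof (cases "i \<in> Domain A")
      case True
      then obtain j' where "(i, j') \<in> A" by blast
      then show ?thesis using top_row_arc sv by (auto dest: single_valuedD)
    next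
      case False
      then show ?thesis using top_row_last[of i] ij by auto
    qed
    show ?thesis
    proof (cases "j \<in> Range A")
      case True
      then obtain i' where i': "(i', j) \<in> A" by blast
      then have "pos A j = Suc (pos A i')" using pos_pred[OF sv' fin] arc by blast
      moreover have "(x, j) \<in> A \<longleftrightarrow> x = i'" for x using i' sv' by (auto dest: single_valuedD)
      ultimately show ?thesis
        unfolding Let_def a t left_col_arc[OF i'] ext_rank_arc[OF i'] free_arc_def
        by auto
    next
      case False
      then show ?thesis
        using left_col_first[of j] ext_rank_diag[of j] pos_no_pred[OF False] ij
        unfolding Let_def a t free_arc_def by auto
    qed
  qed
  then show ?thesis unfolding free_cells_def by blast
qed

end

end

text \<open>Each vertex lies in one chain, and prolonging a chain replaces d by d + 1. This makes
  the type a partition of n.\<close>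

lemma sum_list_pos_word:
  assumes "above_diagonal w" "A \<in> arc_sets w"
  shows "sum_list (map (pos A) (open_vertices w @ lasts A (easts w))) = norths w"
  using assms
proof (induction w arbitrary: A rule: rev_induct)
  case Nil
  then show ?case by (simp add: open_vertices_def lasts_def)
next
  case (snoc s w)
  have w: "above_diagonal w" using snoc.prems above_diagonal_prefix by blast
  show ?case
  proof (cases s)
    case East
    then have A: "A \<in> arc_sets w" using snoc.prems by simp
    have "lasts A (Suc (easts w)) = Suc (easts w) # lasts A (easts w)"
      using arc_sets_bounds(4)[OF w A] by (force simp: lasts_def)
    then show ?thesis
      using snoc.IH[OF w A] open_vertices_East[of w] snoc.prems by (simp add: East)
  next
    case North
    show ?thesis
    proof (cases "A \<in> arc_sets w")
      case True
      then have "Suc (norths w) \<notin> Range A" using arc_sets_bounds(3)[OF w True] by force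
      then show ?thesis
        using snoc.IH[OF w True] by (simp add: North open_vertices_North[OF w] pos_no_pred)
    next
      case False
      then obtain B s' where B: "B \<in> arc_sets w" "s' \<in> set (lasts B (easts w))" "A = insert (s', Suc (norths w)) B"
        using snoc.prems arc_sets_North[OF w] by (auto simp: North)
      then obtain r where r: "r < length (lasts B (easts w))" "s' = lasts B (easts w) ! r"
        by (auto simp: in_set_conv_nth)
      let ?\<Lambda> = "map (pos B) (lasts B (easts w))"
      have "?\<Lambda> = take r ?\<Lambda> @ pos B s' # drop (Suc r) ?\<Lambda>"
        using r id_take_nth_drop[of r ?\<Lambda>] by simp
      then have "sum_list ?\<Lambda> = sum_list (take r ?\<Lambda> @ pos B s' # drop (Suc r) ?\<Lambda>)" by (rule arg_cong)
      moreover have "sum_list (map (pos B) (open_vertices w)) + sum_list ?\<Lambda> = norths w"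
        using snoc.IH[OF w B(1)] by simp
      moreover have "sum_list (map (pos A) (open_vertices (w @ [North]) @ lasts A (easts w))) =
        sum_list (Suc (pos B s') # map (pos B) (open_vertices w)) + sum_list (take r ?\<Lambda> @ drop (Suc r) ?\<Lambda>)"
        unfolding map_append sum_list_append B(3) r(2) arc_set_insert(1,2)[OF w B(1) r(1)] by simp
      ultimately show ?thesis by (simp add: North)
    qed
  qed
qed

lemma finite_partitions: "finite (partitions m)"
proof (rule finite_subset)
  show "partitions m \<subseteq> {\<mu>. set \<mu> \<subseteq> {..m} \<and> length \<mu> \<le> m}"
  proof (rule subsetI, rule CollectI)
    fix \<mu> assume \<mu>: "\<mu> \<in> partitions m"
    have "length \<mu> \<le> sum_list \<mu>" if "0 \<notin> set \<mu>" for \<mu> :: "nat list"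
      using that by (induction \<mu>) auto
    then show "set \<mu> \<subseteq> {..m} \<and> length \<mu> \<le> m"
      using \<mu> member_le_sum_list by (auto simp: partitions_def)
  qed
qed (rule finite_lists_length_le, simp)

lemma n_stat_Cons: "n_stat (a # \<rho>) = sum_list \<rho> + n_stat \<rho>"
  by (simp add: n_stat_def sum.lessThan_Suc_shift sum.distrib sum_list_sum_nth atLeast0LessThan
      del: sum.lessThan_Suc)

lemma n_stat_eq_min_stat: "sorted_wrt (\<ge>) \<rho> \<Longrightarrow> n_stat \<rho> = min_stat \<rho>"
proof (induction \<rho>)
  case (Cons a \<rho>)
  then have "map (min a) \<rho> = \<rho>" by (intro map_idI) (auto simp: min_def)
  with Cons show ?case by (simp add: n_stat_Cons)
qed (simp add: n_stat_def)

section \<open>Bijection between linked rook placements and arc sets\<close>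

lemma linked_rook_arc:
  assumes "linked_rook n \<gamma> L" "m < length L"
  shows "fst (L ! m) < snd (L ! m)"
proof -
  have "L ! m \<in> cells_above n \<gamma>" using assms nth_mem[of m L] by (auto simp: linked_rook_def)
  then show ?thesis by (auto simp: cells_above_def)
qed

lemma linked_rook_less:
  assumes L: "linked_rook n \<gamma> L" and m: "m < m'" "m' < length L"
  shows "snd (L ! m) \<le> fst (L ! m')"
  using m
proof (induction m')
  case (Suc m')
  have link: "snd (L ! m') = fst (L ! Suc m')" using L Suc.prems by (simp add: linked_rook_def)
  have "fst (L ! m') < snd (L ! m')" using linked_rook_arc[OF L] Suc.prems by simp
  then show ?case using Suc link by (cases "m = m'") auto
qed simp

definition arcs_of :: "(nat \<times> nat) list set \<Rightarrow> (nat \<times> nat) set" where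
  "arcs_of P = \<Union> (set ` P)"

text \<open>A chain without arcs gives no linked rook, hence the restriction to
  \<open>Range A\<close>.\<close>

definition placement_of :: "nat \<Rightarrow> (nat \<times> nat) set \<Rightarrow> (nat \<times> nat) list set" where
  "placement_of n A = arc_chain A ` (set (lasts A n) \<inter> Range A)"

definition chromatic_poly :: "nat \<Rightarrow> step list \<Rightarrow> nat \<Rightarrow> mpolynomial" where
  "chromatic_poly n \<gamma> N = (\<Sum>\<kappa>\<in>hl.colorings N \<gamma> []. Poly_Mapping.single (coloring_monomial n \<kappa>) (q ^ ascents n \<gamma> \<kappa>))"

context
  fixes n :: nat and \<gamma> :: "step list"
  assumes \<gamma>: "\<gamma> \<in> dyck_paths n"
begin

lemma arc_set_dyck:
  assumes "A \<in> arc_sets \<gamma>"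
  shows "arc_set n A"
proof
  fix a b assume "(a, b) \<in> A"
  then show "1 \<le> a \<and> a < b \<and> b \<le> n"
    using arc_sets_bounds[OF above_diagonal_dyck[OF \<gamma>] assms] norths_dyck[OF \<gamma>] by auto
qed (use assms in \<open>auto simp: arc_sets_def\<close>)

lemma same_linked_rook:
  assumes "P \<in> linked_rook_placements n \<gamma>" "L \<in> P" "L' \<in> P" "u \<in> set L" "v \<in> set L'" "attacks u v"
  shows "L = L'"
  using assms unfolding linked_rook_placements_def by blast

lemma arcs_of_mem:
  assumes P: "P \<in> linked_rook_placements n \<gamma>"
  shows "arcs_of P \<in> arc_sets \<gamma>"
proof -
  have L: "linked_rook n \<gamma> L" if "L \<in> P" for L using P that by (simp add: linked_rook_placements_def)
  have "arcs_of P \<subseteq> non_edges \<gamma>"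
    using L unfolding cells_above_dyck[OF \<gamma>, symmetric] by (auto simp: arcs_of_def linked_rook_def)
  moreover have "u = v" if u: "u \<in> arcs_of P" and v: "v \<in> arcs_of P" and e: "fst u = fst v \<or> snd u = snd v" for u v
  proof -
    obtain L L' where LL: "L \<in> P" "L' \<in> P" "u \<in> set L" "v \<in> set L'" using u v by (auto simp: arcs_of_def)
    moreover have "attacks u v" using e by (auto simp: attacks_def)
    ultimately have "L = L'" using same_linked_rook[OF P] by blast
    then obtain m m' where m: "m < length L" "L ! m = u" "m' < length L" "L ! m' = v"
      using LL by (metis in_set_conv_nth)
    have "m = m'"
    proof (rule ccontr)
      assume "m \<noteq> m'"
      then consider "m < m'" | "m' < m" by linarith
      then show False
        using linked_rook_less[OF L[OF LL(1)], of m m'] linked_rook_less[OF L[OF LL(1)], of m' m]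
          linked_rook_arc[OF L[OF LL(1)], of m] linked_rook_arc[OF L[OF LL(1)], of m'] m e
        by cases auto
    qed
    then show ?thesis using m by simp
  qed
  ultimately show ?thesis by (fastforce simp: arc_sets_def single_valued_def)
qed

text \<open>A linked rook is a full chain: a rook of the placement that ends where L starts, or
  starts where L ends, would attack a rook of L and hence belong to L, which is impossible because
  the nodes of L increase.\<close>

lemma linked_rook_eq_arc_chain:
  assumes P: "P \<in> linked_rook_placements n \<gamma>" and L: "L \<in> P"
  defines "s \<equiv> snd (last L)"
  shows "L = arc_chain (arcs_of P) s" "s \<in> set (lasts (arcs_of P) n) \<inter> Range (arcs_of P)"
proof -
  let ?A = "arcs_of P"
  interpret arc_set n ?A by (rule arc_set_dyck[OF arcs_of_mem[OF P]])
  have lr: "linked_rook n \<gamma> L" using P L by (simp add: linked_rook_placements_def)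
  then have ne: "L \<noteq> []" by (simp add: linked_rook_def)
  have mem: "L ! m \<in> ?A" if "m < length L" for m
    using nth_mem[OF that] L by (auto simp: arcs_of_def)
  have "take (Suc m) L = arc_chain ?A (snd (L ! m))" if "m < length L" for m
    using that
  proof (induction m)
    case 0
    obtain a b where ab: "L ! 0 = (a, b)" by fastforce
    have "a \<notin> Range ?A"
    proof
      assume "a \<in> Range ?A"
      then obtain z L' where z: "L' \<in> P" "(z, a) \<in> set L'" by (auto simp: arcs_of_def)
      moreover have "(a, b) \<in> set L" using ab 0 nth_mem by metis
      ultimately have "L' = L" using same_linked_rook[OF P, of L' L "(z, a)" "(a, b)"] L by (auto simp: attacks_def)
      then obtain m where m: "m < length L" "L ! m = (z, a)" using z by (auto simp: in_set_conv_nth)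
      have "z < a" "a < b" using linked_rook_arc[OF lr m(1)] linked_rook_arc[OF lr 0] m ab by auto
      moreover have "m = 0 \<or> b \<le> z" using linked_rook_less[OF lr, of 0 m] m ab by auto
      ultimately show False using m ab by auto
    qed
    then show ?case
      using mem[OF 0] 0 by (simp add: ab arc_chain_pred arc_chain_no_pred take_Suc_conv_app_nth)
  next
    case (Suc m)
    obtain a b where ab: "L ! Suc m = (a, b)" by fastforce
    have "a = snd (L ! m)" using lr Suc.prems ab by (simp add: linked_rook_def)
    then show ?case
      using Suc mem[OF Suc.prems] by (simp add: ab arc_chain_pred take_Suc_conv_app_nth)
  qed
  from this[of "length L - 1"] ne show "L = arc_chain ?A s"
    by (simp add: s_def last_conv_nth)
  have last: "(fst (last L), s) \<in> set L" using ne by (simp add: s_def)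
  then have sA: "(fst (last L), s) \<in> ?A" using L by (auto simp: arcs_of_def)
  have "s \<notin> Domain ?A"
  proof
    assume "s \<in> Domain ?A"
    then obtain z L' where z: "L' \<in> P" "(s, z) \<in> set L'" by (auto simp: arcs_of_def)
    then have "L = L'" using same_linked_rook[OF P L _ last, of L' "(s, z)"] by (auto simp: attacks_def)
    then obtain m where m: "m < length L" "L ! m = (s, z)" using z by (auto simp: in_set_conv_nth)
    have lt: "fst (last L) < s" using arc[OF sA] by simp
    show False
    proof (cases "m = length L - 1")
      case True
      then show False using m lt ne by (simp add: last_conv_nth)
    next
      case False
      then have "snd (L ! m) \<le> fst (last L)"
        using linked_rook_less[OF lr, of m "length L - 1"] m ne by (simp add: last_conv_nth)
      then show False using m lt linked_rook_arc[OF lr m(1)] by simp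
    qed
  qed
  then show "s \<in> set (lasts ?A n) \<inter> Range ?A" using sA arc[OF sA] by (auto simp: set_lasts)
qed

lemma placement_of_arcs_of:
  assumes P: "P \<in> linked_rook_placements n \<gamma>"
  shows "placement_of n (arcs_of P) = P"
proof
  let ?A = "arcs_of P"
  interpret arc_set n ?A by (rule arc_set_dyck[OF arcs_of_mem[OF P]])
  show "P \<subseteq> placement_of n ?A"
  proof
    fix L assume "L \<in> P"
    from linked_rook_eq_arc_chain[OF P this] show "L \<in> placement_of n ?A"
      unfolding placement_of_def by (rule image_eqI)
  qed
  show "placement_of n ?A \<subseteq> P"
  proof
    fix K assume "K \<in> placement_of n ?A"
    then obtain s s' where s: "K = arc_chain ?A s" "s \<in> set (lasts ?A n)" "(s', s) \<in> ?A"
      by (auto simp: placement_of_def)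
    then obtain L where L: "L \<in> P" "(s', s) \<in> set L" by (auto simp: arcs_of_def)
    note c = linked_rook_eq_arc_chain[OF P L(1)]
    have "(s, snd (last L)) \<in> ?A\<^sup>*" using arc_chain_ancestors[of s' s] L(2) c(1) by metis
    then have "s = snd (last L)" using s(2) by (auto simp: set_lasts elim: converse_rtranclE)
    then show "K \<in> P" using s(1) c(1) L(1) by simp
  qed
qed

lemma arcs_of_placement_of:
  assumes A: "A \<in> arc_sets \<gamma>"
  shows "placement_of n A \<in> linked_rook_placements n \<gamma>" "arcs_of (placement_of n A) = A"
proof -
  interpret arc_set n A by (rule arc_set_dyck[OF A])
  have sub: "A \<subseteq> cells_above n \<gamma>" using A by (simp add: arc_sets_def cells_above_dyck[OF \<gamma>])
  have "linked_rook n \<gamma> L" if "L \<in> placement_of n A" for L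
    using that arc_chain_subset sub arc_chain_linked
    by (auto simp: placement_of_def linked_rook_def arc_chain_eq_Nil)
  moreover have "\<not> attacks u v" if LL: "L \<in> placement_of n A" "L' \<in> placement_of n A" "L \<noteq> L'" "u \<in> set L" "v \<in> set L'" for L L' u v
  proof
    assume at: "attacks u v"
    obtain s s' where s: "L = arc_chain A s" "s \<in> set (lasts A n)" "L' = arc_chain A s'" "s' \<in> set (lasts A n)"
      using LL by (auto simp: placement_of_def)
    have u: "(fst u, s) \<in> A\<^sup>*" "(snd u, s) \<in> A\<^sup>*" using arc_chain_ancestors[of "fst u" "snd u" s] LL s by auto
    have v: "(fst v, s') \<in> A\<^sup>*" "(snd v, s') \<in> A\<^sup>*" using arc_chain_ancestors[of "fst v" "snd v" s'] LL s by auto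
    obtain i where "(i, s) \<in> A\<^sup>*" "(i, s') \<in> A\<^sup>*" using at u v by (auto simp: attacks_def)
    then have "s = s'" using last_unique s by (auto simp: set_lasts)
    with s LL(3) show False by simp
  qed
  moreover have "finite (placement_of n A)" by (simp add: placement_of_def)
  ultimately show "placement_of n A \<in> linked_rook_placements n \<gamma>"
    unfolding linked_rook_placements_def by blast
  show "arcs_of (placement_of n A) = A"
  proof
    show "arcs_of (placement_of n A) \<subseteq> A" using arc_chain_subset by (auto simp: arcs_of_def placement_of_def)
    show "A \<subseteq> arcs_of (placement_of n A)"
    proof (rule subrelI)
      fix i j assume ij: "(i, j) \<in> A"
      then obtain s where s: "s \<in> set (lasts A n)" "(j, s) \<in> A\<^sup>*" using ex_last[of j] arc[OF ij] by auto
      have c: "(i, j) \<in> set (arc_chain A s)" using arc_in_chain[OF ij s(2)] .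
      then have "s \<in> Range A" using arc_chain_eq_Nil[of s] by auto
      with c s show "(i, j) \<in> arcs_of (placement_of n A)" by (auto simp: arcs_of_def placement_of_def)
    qed
  qed
qed

lemma bij_betw_arcs_of: "bij_betw arcs_of (linked_rook_placements n \<gamma>) (arc_sets \<gamma>)"
  by (rule bij_betw_byWitness[where f' = "placement_of n"])
     (auto simp: placement_of_arcs_of arcs_of_placement_of arcs_of_mem)

lemma ext_eq:
  assumes P: "P \<in> linked_rook_placements n \<gamma>"
  shows "ext n P = (\<lambda>s. extended_rook n (anc (arcs_of P) s)) ` set (lasts (arcs_of P) n)"
proof -
  let ?A = "arcs_of P"
  interpret arc_set n ?A by (rule arc_set_dyck[OF arcs_of_mem[OF P]])
  have "(\<lambda>L. extended_rook n (nodes L)) ` P =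
     (\<lambda>s. extended_rook n (anc ?A s)) ` (set (lasts ?A n) \<inter> Range ?A)"
    by (subst placement_of_arcs_of[OF P, symmetric])
       (auto simp: placement_of_def image_image nodes_arc_chain intro!: image_cong)
  moreover have "{extended_rook n [i] | i. i \<in> {1..n} \<and> (\<forall>L\<in>P. \<forall>(a, b)\<in>set L. i \<noteq> a \<and> i \<noteq> b)} =
     (\<lambda>s. extended_rook n (anc ?A s)) ` (set (lasts ?A n) - Range ?A)"
  proof -
    have "i \<in> {1..n} \<and> (\<forall>L\<in>P. \<forall>(a, b)\<in>set L. i \<noteq> a \<and> i \<noteq> b) \<longleftrightarrow> i \<in> set (lasts ?A n) - Range ?A" for i
      by (fastforce simp: set_lasts arcs_of_def)
    then have "{extended_rook n [i] | i. i \<in> {1..n} \<and> (\<forall>L\<in>P. \<forall>(a, b)\<in>set L. i \<noteq> a \<and> i \<noteq> b)} =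
      (\<lambda>i. extended_rook n [i]) ` (set (lasts ?A n) - Range ?A)" by auto
    also have "\<dots> = (\<lambda>s. extended_rook n (anc ?A s)) ` (set (lasts ?A n) - Range ?A)"
      by (rule image_cong) (auto simp: anc_no_pred)
    finally show ?thesis .
  qed
  ultimately show ?thesis by (simp only: ext_def image_Un[symmetric] Int_Diff_Un)
qed

text \<open>The type lists the chain lengths in sorted order, the expansion over arc sets lists them
  by position. Equality of multisets is enough, by \<open>state_fn_perm\<close> and
  \<open>min_stat_perm\<close>.\<close>

lemma placement_stats:
  assumes P: "P \<in> linked_rook_placements n \<gamma>"
  defines "A \<equiv> arcs_of P" and "\<mu> \<equiv> placement_type n P"
  shows "mset \<mu> = mset (map (pos A) (lasts A n))"
    and "\<mu> \<in> partitions n"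
    and "arc_stat \<gamma> A = area n \<gamma> - int (n_stat \<mu>) + int (card (free_cells n \<gamma> P))"
proof -
  have A: "A \<in> arc_sets \<gamma>" unfolding A_def by (rule arcs_of_mem[OF P])
  interpret arc_set n A by (rule arc_set_dyck[OF A])
  note e = ext_eq[OF P, folded A_def]
  have \<mu>: "\<mu> = rev (sort (map (pos A) (lasts A n)))" unfolding \<mu>_def by (rule placement_type_eq[OF e])
  then show ms: "mset \<mu> = mset (map (pos A) (lasts A n))" by simp
  have so: "sorted_wrt (\<ge>) \<mu>" by (simp add: \<mu> sorted_wrt_rev)
  have ov: "open_vertices \<gamma> = []" by (simp add: open_vertices_def norths_dyck[OF \<gamma>] easts_dyck[OF \<gamma>])
  have "sum_list \<mu> = sum_list (map (pos A) (lasts A n))"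
    using arg_cong[OF ms, of sum_mset] by (simp only: sum_mset_sum_list)
  then have "sum_list \<mu> = n"
    using sum_list_pos_word[OF above_diagonal_dyck[OF \<gamma>] A]
    unfolding ov norths_dyck[OF \<gamma>] easts_dyck[OF \<gamma>] by simp
  moreover have "0 \<notin> set \<mu>" using zero_notin_map_pos[OF fin] ms by (metis set_mset_mset)
  ultimately show "\<mu> \<in> partitions n" using so by (simp add: partitions_def)
  have "free_arcs \<gamma> A = free_cells n \<gamma> P"
    unfolding free_cells_eq[OF e] free_arcs_def cells_above_dyck[OF \<gamma>] ..
  moreover have "n_stat \<mu> = min_stat (map (pos A) (lasts A n))"
    using n_stat_eq_min_stat[OF so] min_stat_perm[OF ms] by simp
  ultimately show "arc_stat \<gamma> A = area n \<gamma> - int (n_stat \<mu>) + int (card (free_cells n \<gamma> P))"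
    by (simp add: arc_stat_def ov area_dyck[OF \<gamma>] easts_dyck[OF \<gamma>])
qed

section \<open>Expansion over placements and comparison of coefficients\<close>

lemma finite_linked_rook_placements: "finite (linked_rook_placements n \<gamma>)"
  using bij_betw_finite[OF bij_betw_arcs_of] finite_arc_sets[OF above_diagonal_dyck[OF \<gamma>]] by simp

lemma path_fn_placements:
  "hl.path_fn N rf_var \<gamma> [] = (\<Sum>P\<in>linked_rook_placements n \<gamma>.
     rf_const (q powi (area n \<gamma> - int (n_stat (placement_type n P))) * q ^ card (free_cells n \<gamma> P)) *
     hl.state_fn N rf_var [] (placement_type n P) [])"
proof -
  have ov: "open_vertices \<gamma> = []" by (simp add: open_vertices_def norths_dyck[OF \<gamma>] easts_dyck[OF \<gamma>])
  have "hl.path_fn N rf_var \<gamma> [] = (\<Sum>A\<in>arc_sets \<gamma>. rf_const q powi arc_stat \<gamma> A *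
     hl.state_fn N rf_var [] (map (pos A) (lasts A n)) [])"
    using hl.path_fn_arc_sets[OF above_diagonal_dyck[OF \<gamma>], of N rf_var] Nil_tuples[of N]
    by (simp add: hl.eqv_def ov norths_dyck[OF \<gamma>] easts_dyck[OF \<gamma>])
  also have "\<dots> = (\<Sum>P\<in>linked_rook_placements n \<gamma>. rf_const q powi arc_stat \<gamma> (arcs_of P) *
     hl.state_fn N rf_var [] (map (pos (arcs_of P)) (lasts (arcs_of P) n)) [])"
    by (rule sum.reindex_bij_betw[OF bij_betw_arcs_of, symmetric])
  also have "\<dots> = (\<Sum>P\<in>linked_rook_placements n \<gamma>.
     rf_const (q powi (area n \<gamma> - int (n_stat (placement_type n P))) * q ^ card (free_cells n \<gamma> P)) *
     hl.state_fn N rf_var [] (placement_type n P) [])"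
  proof (rule sum.cong[OF refl])
    fix P assume P: "P \<in> linked_rook_placements n \<gamma>"
    note st = placement_stats[OF P]
    have "0 \<notin> set ([] @ placement_type n P)" using st(2) by (simp add: partitions_def)
    from hl.state_fn_perm[OF st(1) this, of N rf_var]
    have "hl.state_fn N rf_var [] (map (pos (arcs_of P)) (lasts (arcs_of P) n)) [] = hl.state_fn N rf_var [] (placement_type n P) []"
      using Nil_tuples[of N] by (simp add: hl.eqv_def)
    moreover have "rf_const q powi arc_stat \<gamma> (arcs_of P) =
      rf_const (q powi (area n \<gamma> - int (n_stat (placement_type n P))) * q ^ card (free_cells n \<gamma> P))"
      unfolding st(3) rf_const_power_int[symmetric]
      by (simp only: power_int_add[OF disjI1[OF q_nonzero]] power_int_of_nat)
    ultimately show "rf_const q powi arc_stat \<gamma> (arcs_of P) *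
     hl.state_fn N rf_var [] (map (pos (arcs_of P)) (lasts (arcs_of P) n)) [] =
      rf_const (q powi (area n \<gamma> - int (n_stat (placement_type n P))) * q ^ card (free_cells n \<gamma> P)) *
      hl.state_fn N rf_var [] (placement_type n P) []" by simp
  qed
  finally show ?thesis .
qed

lemma path_fn_partitions:
  "hl.path_fn N rf_var \<gamma> [] = (\<Sum>\<mu>\<in>partitions n.
     rf_const (q powi (area n \<gamma> - int (n_stat \<mu>)) * r_poly n \<gamma> \<mu>) * hl.state_fn N rf_var [] \<mu> [])"
proof -
  let ?f = "\<lambda>P. rf_const (q powi (area n \<gamma> - int (n_stat (placement_type n P))) * q ^ card (free_cells n \<gamma> P)) *
     hl.state_fn N rf_var [] (placement_type n P) []"
  have "hl.path_fn N rf_var \<gamma> [] = (\<Sum>\<mu>\<in>partitions n. \<Sum>P\<in>{P \<in> linked_rook_placements n \<gamma>. placement_type n P = \<mu>}. ?f P)"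
    unfolding path_fn_placements
    by (rule sum.group[symmetric]) (use finite_linked_rook_placements finite_partitions placement_stats(2) in auto)
  also have "\<dots> = (\<Sum>\<mu>\<in>partitions n.
     rf_const (q powi (area n \<gamma> - int (n_stat \<mu>)) * r_poly n \<gamma> \<mu>) * hl.state_fn N rf_var [] \<mu> [])"
  proof (rule sum.cong[OF refl])
    fix \<mu>
    show "(\<Sum>P\<in>{P \<in> linked_rook_placements n \<gamma>. placement_type n P = \<mu>}. ?f P) =
      rf_const (q powi (area n \<gamma> - int (n_stat \<mu>)) * r_poly n \<gamma> \<mu>) * hl.state_fn N rf_var [] \<mu> []"
      unfolding r_poly_def LRP_def rf_const_mult rf_const_sum sum_distrib_left sum_distrib_right
      by (rule sum.cong) auto
  qed
  finally show ?thesis .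
qed

lemma to_fract_chromatic_poly: "to_fract (chromatic_poly n \<gamma> N) = hl.path_fn N rf_var \<gamma> []"
proof -
  have wt: "hl.coloring_wt rf_var \<gamma> \<kappa> = to_fract (Poly_Mapping.single (coloring_monomial n \<kappa>) (q ^ ascents n \<gamma> \<kappa>))" for \<kappa>
  proof -
    have "(\<Prod>v\<in>S. Poly_Mapping.single (Poly_Mapping.single (\<kappa> v) 1) 1) =
      (Poly_Mapping.single (\<Sum>v\<in>S. Poly_Mapping.single (\<kappa> v) 1) 1 :: mpolynomial)" for S
      by (induction S rule: infinite_finite_induct) (auto simp: mult_single)
    then show ?thesis
      by (simp add: hl.coloring_wt_def coloring_monomial_def ascents_def graph_edges_dyck[OF \<gamma>] norths_dyck[OF \<gamma>]
        rf_var_eq mult_single flip: rf_const_power to_fract_prod)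
        (simp add: rf_const_eq mult_single flip: to_fract_mult)
  qed
  have "norths \<gamma> - easts \<gamma> = 0" by (simp add: norths_dyck[OF \<gamma>] easts_dyck[OF \<gamma>])
  then have "hl.path_fn N rf_var \<gamma> [] = (\<Sum>\<kappa>\<in>hl.colorings N \<gamma> []. hl.coloring_wt rf_var \<gamma> \<kappa>)"
    using hl.path_fn_colorings[OF above_diagonal_dyck[OF \<gamma>], of N rf_var] Nil_tuples[of N]
    by (simp only: hl.eqv_def)
  then show ?thesis by (simp add: chromatic_poly_def to_fract_sum wt)
qed

text \<open>Every colour of a coloring is the index of a variable in its monomial, so the bound N
  excludes no coloring with monomial \<alpha>.\<close>

lemma lookup_chromatic_poly:
  assumes "\<And>i. i \<in> Poly_Mapping.keys \<alpha> \<Longrightarrow> i \<le> N"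
  shows "Poly_Mapping.lookup (chromatic_poly n \<gamma> N) \<alpha> = chromatic_qsym n \<gamma> \<alpha>"
proof -
  have ov: "open_vertices \<gamma> = []" by (simp add: open_vertices_def norths_dyck[OF \<gamma>] easts_dyck[OF \<gamma>])
  have col: "hl.colorings N \<gamma> [] = {\<kappa> \<in> {1..n} \<rightarrow>\<^sub>E {1..N}. \<forall>(i, j) \<in> graph_edges n \<gamma>. \<kappa> i \<noteq> \<kappa> j}"
    by (simp add: hl.colorings_def ov graph_edges_dyck[OF \<gamma>] norths_dyck[OF \<gamma>])
  have used: "\<kappa> v \<in> Poly_Mapping.keys (coloring_monomial n \<kappa>)" if "v \<in> {1..n}" for \<kappa> v
  proof -
    have "Poly_Mapping.lookup (coloring_monomial n \<kappa>) (\<kappa> v) = (\<Sum>u=1..n. Poly_Mapping.lookup (Poly_Mapping.single (\<kappa> u) 1) (\<kappa> v))"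
      by (simp add: coloring_monomial_def lookup_sum)
    moreover have "\<dots> \<ge> Poly_Mapping.lookup (Poly_Mapping.single (\<kappa> v) 1) (\<kappa> v)"
      using that by (intro member_le_sum) auto
    ultimately have "1 \<le> Poly_Mapping.lookup (coloring_monomial n \<kappa>) (\<kappa> v)" by simp
    then show ?thesis unfolding in_keys_iff by linarith
  qed
  have eq: "{\<kappa> \<in> hl.colorings N \<gamma> []. coloring_monomial n \<kappa> = \<alpha>} =
      {\<kappa>. \<kappa> \<in> proper_colorings n \<gamma> \<and> coloring_monomial n \<kappa> = \<alpha>}"
  proof (intro set_eqI iffI; clarify)
    fix \<kappa> assume "\<kappa> \<in> hl.colorings N \<gamma> []" "\<alpha> = coloring_monomial n \<kappa>"
    moreover have "{1..n} \<rightarrow>\<^sub>E {1..N} \<subseteq> {1..n} \<rightarrow>\<^sub>E {1..}" by (rule PiE_mono) auto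
    ultimately show "\<kappa> \<in> proper_colorings n \<gamma> \<and> coloring_monomial n \<kappa> = coloring_monomial n \<kappa>"
      unfolding col proper_colorings_def by blast
  next
    fix \<kappa> assume \<kappa>: "\<kappa> \<in> proper_colorings n \<gamma>" "\<alpha> = coloring_monomial n \<kappa>"
    then have "\<kappa> v \<le> N" if "v \<in> {1..n}" for v using used[OF that, of \<kappa>] assms by simp
    then have "\<kappa> \<in> {1..n} \<rightarrow>\<^sub>E {1..N}"
      using \<kappa>(1) by (intro PiE_I) (auto simp: proper_colorings_def PiE_def extensional_def Pi_def)
    then show "\<kappa> \<in> hl.colorings N \<gamma> [] \<and> coloring_monomial n \<kappa> = coloring_monomial n \<kappa>"
      using \<kappa>(1) unfolding col proper_colorings_def by blast
  qed
  have "Poly_Mapping.lookup (chromatic_poly n \<gamma> N) \<alpha> =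
      (\<Sum>\<kappa>\<in>hl.colorings N \<gamma> []. if coloring_monomial n \<kappa> = \<alpha> then q ^ ascents n \<gamma> \<kappa> else 0)"
    by (simp add: chromatic_poly_def lookup_sum lookup_single when_def)
  also have "\<dots> = chromatic_qsym n \<gamma> \<alpha>"
    unfolding chromatic_qsym_def eq[symmetric]
    by (rule sum.inter_filter[symmetric]) (rule hl.finite_colorings)
  finally show ?thesis .
qed

end

theorem theorem3p6:
  fixes n :: nat and \<gamma> :: "step list"
  assumes "n \<ge> 1" and "\<gamma> \<in> dyck_paths n"
  shows "chromatic_qsym n \<gamma> =
    (\<lambda>\<alpha>. \<Sum>\<mu>\<in>partitions n.
       q powi (area n \<gamma> - int (n_stat \<mu>)) * r_poly n \<gamma> \<mu> * mult_q_fact \<mu> * hall_littlewood \<mu> \<alpha>)"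
proof
  fix \<alpha> :: monomial
  \<comment> \<open>One number of variables for all \<mu>, whereas \<open>hall_littlewood\<close>
    takes at least the number of parts; partitions with more than N parts drop out on both sides.
    The 0 serves the constant monomial.\<close>
  define N where "N = Max (insert 0 (Poly_Mapping.keys \<alpha>))"
  have N: "i \<le> N" if "i \<in> Poly_Mapping.keys \<alpha>" for i using that by (simp add: N_def)
  let ?c = "\<lambda>\<mu>. q powi (area n \<gamma> - int (n_stat \<mu>)) * r_poly n \<gamma> \<mu>"
  let ?S = "{\<mu> \<in> partitions n. length \<mu> \<le> N}"
  have "to_fract (chromatic_poly n \<gamma> N) = (\<Sum>\<mu>\<in>partitions n. rf_const (?c \<mu>) * hl.state_fn N rf_var [] \<mu> [])"
    using to_fract_chromatic_poly[OF assms(2)] path_fn_partitions[OF assms(2)] by simp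
  also have "\<dots> = (\<Sum>\<mu>\<in>?S. rf_const (?c \<mu>) * hl.state_fn N rf_var [] \<mu> [])"
    using finite_partitions[of n] by (intro sum.mono_neutral_right) (auto simp: state_fn_too_long not_le)
  also have "\<dots> = (\<Sum>\<mu>\<in>?S. to_fract (Poly_Mapping.single 0 (?c \<mu>) * (Poly_Mapping.single 0 (mult_q_fact \<mu>) * hall_littlewood_poly N \<mu>)))"
  proof (rule sum.cong[OF refl])
    fix \<mu> assume "\<mu> \<in> ?S"
    then have "sorted_wrt (\<ge>) \<mu>" "0 \<notin> set \<mu>" "length \<mu> \<le> N" by (auto simp: partitions_def)
    from hall_littlewood_poly_eq[OF this]
    show "rf_const (?c \<mu>) * hl.state_fn N rf_var [] \<mu> [] =
        to_fract (Poly_Mapping.single 0 (?c \<mu>) * (Poly_Mapping.single 0 (mult_q_fact \<mu>) * hall_littlewood_poly N \<mu>))"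
      by (simp only: to_fract_mult[of "Poly_Mapping.single 0 (?c \<mu>)"] rf_const_eq[of "?c \<mu>"])
  qed
  finally have poly: "chromatic_poly n \<gamma> N = (\<Sum>\<mu>\<in>?S. Poly_Mapping.single 0 (?c \<mu>) * (Poly_Mapping.single 0 (mult_q_fact \<mu>) * hall_littlewood_poly N \<mu>))"
    by (simp only: to_fract_sum[symmetric] to_fract_eq_iff)
  have hl: "hall_littlewood \<mu> \<alpha> = (if length \<mu> \<le> N then Poly_Mapping.lookup (hall_littlewood_poly N \<mu>) \<alpha> else 0)"
    if "\<mu> \<in> partitions n" for \<mu>
  proof -
    \<comment> \<open>As n \<ge> 1, the partition has a part, so there is a last variable to divide
      by.\<close>
    have \<mu>: "sorted_wrt (\<ge>) \<mu>" "0 \<notin> set \<mu>" "length \<mu> > 0" using that assms(1) by (auto simp: partitions_def)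
    have M: "Max (insert (length \<mu>) (Poly_Mapping.keys \<alpha>)) = max (length \<mu>) N"
      by (cases "Poly_Mapping.keys \<alpha> = {}") (auto simp: N_def)
    show ?thesis
    proof (cases "length \<mu> \<le> N")
      case True
      then show ?thesis by (simp add: hall_littlewood_def M max_def)
    next
      case False
      then have "length \<mu> \<notin> Poly_Mapping.keys \<alpha>" using N by auto
      then show ?thesis
        using hall_littlewood_unused_variable[OF \<mu>] False by (simp add: hall_littlewood_def M max_def)
    qed
  qed
  have "chromatic_qsym n \<gamma> \<alpha> = Poly_Mapping.lookup (chromatic_poly n \<gamma> N) \<alpha>"
    using lookup_chromatic_poly[OF assms(2) N] by simp
  also have "\<dots> = (\<Sum>\<mu>\<in>?S. ?c \<mu> * mult_q_fact \<mu> * Poly_Mapping.lookup (hall_littlewood_poly N \<mu>) \<alpha>)"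
    unfolding poly lookup_sum lookup_single_0_mult by (simp add: mult.assoc)
  also have "\<dots> = (\<Sum>\<mu>\<in>partitions n. ?c \<mu> * mult_q_fact \<mu> * hall_littlewood \<mu> \<alpha>)"
    using finite_partitions[of n] by (intro sum.mono_neutral_cong_left) (auto simp: hl)
  finally show "chromatic_qsym n \<gamma> \<alpha> = (\<Sum>\<mu>\<in>partitions n.
       q powi (area n \<gamma> - int (n_stat \<mu>)) * r_poly n \<gamma> \<mu> * mult_q_fact \<mu> * hall_littlewood \<mu> \<alpha>)" .
qed

end
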